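(* Let $\hat X$ be a squared Bessel bridge, i.e. the unique solution of $$\hat X_t=x+2\int_0^t\sqrt{\hat X_s}\,dB_s+\int_0^t\Big(\delta-\frac{2\hat X_s}{1-s}\Big)ds,\qquad t\in[0,1),$$ where $x\ge0$ and $\delta\ge0$. Then for any $\lambda\ge0$, $\gamma>0$ and $t\in[0,1]$ $$\mathbb E e^{-\lambda\hat X_t-\gamma\int_0^t\hat X_udu}=e^{-x\phi(t,\lambda)-\psi(t,\lambda)},$$ where $$\phi(t,\lambda)=\sqrt{\frac{\gamma}{2}}-\frac12+\Big(\frac{e^{2\sqrt{2\gamma}t}}{\lambda+\frac{1}{2(1-t)}-\sqrt{\gamma/2}}-\frac{1}{\sqrt{2\gamma}}\big(1-e^{2\sqrt{2\gamma}t}\big)\Big)^{-1},$$ $$\psi(t,\lambda)=\delta\int_0^ty_{x_0}(u)\,du\Big|_{x_0=\phi(t,\lambda)},$$ $$y_{x_0}(t)=\sqrt{\frac{\gamma}{2}}-\frac12+e^{2\sqrt{2\gamma}t}\Big(\frac{1}{x_0+1/2-\sqrt{\gamma/2}}+\frac{1}{\sqrt{2\gamma}}\big(1-e^{2\sqrt{2\gamma}t}\big)\Big)^{-1}.$$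
   Context: $B$ is a standard Brownian motion.
   Formalization: In y_{x_0}(u) the constant -1/2 is replaced by -1/(2(1-u)); with the printed -1/2 the identity fails for every δ>0 and 0<t≤1. Quotients that degenerate, such as 1/(2(1-t)) at t=1, are read by continuous extension, and X̂_1 is the left limit of the path. *)

theory Defs
  imports "HOL-Probability.Probability"
begin

section \<open>Brownian motion on a filtered probability space\<close>

text \<open>The index type of the filtration is \<^typ>\<open>real\<close>, but only times \<open>t \<ge> 0\<close> matter. A filtration
  on \<open>[0,\<infinity>)\<close> is covered by putting \<open>F t = F 0\<close> for \<open>t < 0\<close>. The usual conditions are not required.\<close>

locale filtered_prob_space = prob_space M + filtration "space M" F
  for M :: "'a measure" and F :: "real \<Rightarrow> 'a measure" +
  assumes subalgebra_F: "subalgebra M (F t)"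

locale standard_brownian_motion = filtered_prob_space M F
  for M :: "'a measure" and F :: "real \<Rightarrow> 'a measure" +
  fixes B :: "real \<Rightarrow> 'a \<Rightarrow> real"
  assumes adapted: "0 \<le> t \<Longrightarrow> B t \<in> borel_measurable (F t)"
    and start: "AE \<omega> in M. B 0 \<omega> = 0"
    and continuous_paths: "AE \<omega> in M. continuous_on {0..} (\<lambda>t. B t \<omega>)"
    and normal_increments:
      "0 \<le> s \<Longrightarrow> s < t \<Longrightarrow>
        distributed M lborel (\<lambda>\<omega>. B t \<omega> - B s \<omega>) (\<lambda>z. ennreal (normal_density 0 (sqrt (t - s)) z))"
    and independent_increments:
      "0 \<le> s \<Longrightarrow> s < t \<Longrightarrow>
        indep_set (sets (F s)) (sets (vimage_algebra (space M) (\<lambda>\<omega>. B t \<omega> - B s \<omega>) borel))"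


section \<open>The Ito integral\<close>

text \<open>A simple process \<open>H\<^sub>u = (\<Sum>i<n. \<xi>\<^sub>i 1\<^bsub>(\<tau>\<^sub>i, \<tau>\<^sub>i\<^sub>+\<^sub>1]\<^esub>(u))\<close> is given by
  \<open>n\<close>, \<open>\<tau>\<close> and \<open>\<xi>\<close>; values of \<open>\<tau>\<close> beyond \<open>n\<close> and of \<open>\<xi>\<close> from \<open>n\<close> on are irrelevant.\<close>

datatype 'a simple_process =
  Simple_Process (steps: nat) (knot: "nat \<Rightarrow> real") (level: "nat \<Rightarrow> 'a \<Rightarrow> real")

definition simple_predictable :: "'a measure \<Rightarrow> (real \<Rightarrow> 'a measure) \<Rightarrow> 'a simple_process \<Rightarrow> bool" where
  "simple_predictable M F S \<longleftrightarrow>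
     0 \<le> knot S 0 \<and>
     (\<forall>i<steps S. knot S i \<le> knot S (Suc i) \<and>
        level S i \<in> borel_measurable (F (knot S i)) \<and>
        (\<exists>C. \<forall>\<omega>\<in>space M. \<bar>level S i \<omega>\<bar> \<le> C))"

definition simple_value :: "'a simple_process \<Rightarrow> real \<Rightarrow> 'a \<Rightarrow> real" where
  "simple_value S u \<omega> = (\<Sum>i<steps S. level S i \<omega> * indicator {knot S i<..knot S (Suc i)} u)"

definition simple_integral ::
    "(real \<Rightarrow> 'a \<Rightarrow> real) \<Rightarrow> 'a simple_process \<Rightarrow> real \<Rightarrow> 'a \<Rightarrow> real" where
  "simple_integral B S t \<omega> =
     (\<Sum>i<steps S. level S i \<omega> * (B (min t (knot S (Suc i))) \<omega> - B (min t (knot S i)) \<omega>))"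

definition progressively_measurable_upto ::
    "(real \<Rightarrow> 'a measure) \<Rightarrow> real \<Rightarrow> (real \<Rightarrow> 'a \<Rightarrow> real) \<Rightarrow> bool" where
  "progressively_measurable_upto F t H \<longleftrightarrow>
     (\<forall>r\<in>{0..t}. (\<lambda>(u, \<omega>). H u \<omega>) \<in> borel_measurable (restrict_space borel {0..r} \<Otimes>\<^sub>M F r))"

text \<open>\<open>has_ito_integral M F B H t Z\<close>: the random variable \<open>Z\<close> is (a version of) \<open>\<integral>\<^sub>0\<^sup>t H\<^sub>u dB\<^sub>u\<close>.
  This is the Ito integral for progressive integrands with \<open>\<integral>\<^sub>0\<^sup>t H\<^sub>u\<^sup>2 du < \<infinity>\<close> almost surely,
  obtained by extending the integral of simple processes by continuity in probability; it determines
  \<open>Z\<close> up to a null set. The distance \<open>\<integral>\<^sub>0\<^sup>t (S\<^sub>n - H)\<^sup>2 du\<close> is taken in \<^typ>\<open>ennreal\<close>,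
  so that it is infinite, rather than zero, when the integral diverges.\<close>

definition has_ito_integral ::
    "'a measure \<Rightarrow> (real \<Rightarrow> 'a measure) \<Rightarrow> (real \<Rightarrow> 'a \<Rightarrow> real) \<Rightarrow>
     (real \<Rightarrow> 'a \<Rightarrow> real) \<Rightarrow> real \<Rightarrow> ('a \<Rightarrow> real) \<Rightarrow> bool" where
  "has_ito_integral M F B H t Z \<longleftrightarrow>
     progressively_measurable_upto F t H \<and>
     (AE \<omega> in M. (\<integral>\<^sup>+u\<in>{0..t}. ennreal ((H u \<omega>)\<^sup>2) \<partial>lborel) < \<infinity>) \<and>
     Z \<in> borel_measurable M \<and>
     (\<exists>S. (\<forall>n. simple_predictable M F (S n)) \<and>
        (\<forall>\<epsilon>>0. (\<lambda>n. measure M {\<omega>\<in>space M.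
            (\<integral>\<^sup>+u\<in>{0..t}. ennreal ((simple_value (S n) u \<omega> - H u \<omega>)\<^sup>2) \<partial>lborel) > ennreal \<epsilon>})
          \<longlonglongrightarrow> 0) \<and>
        (\<forall>\<epsilon>>0. (\<lambda>n. measure M {\<omega>\<in>space M. \<bar>simple_integral B (S n) t \<omega> - Z \<omega>\<bar> > \<epsilon>})
          \<longlonglongrightarrow> 0))"


section \<open>Squared Bessel bridges\<close>

text \<open>The stochastic equation is imposed on \<open>[0,1)\<close>, where the drift makes sense. The value \<open>X\<^sub>1\<close> is
  the left limit of the path, which is what continuity on the closed interval says.\<close>

definition squared_bessel_bridge ::
    "'a measure \<Rightarrow> (real \<Rightarrow> 'a measure) \<Rightarrow> (real \<Rightarrow> 'a \<Rightarrow> real) \<Rightarrow>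
     real \<Rightarrow> real \<Rightarrow> (real \<Rightarrow> 'a \<Rightarrow> real) \<Rightarrow> bool" where
  "squared_bessel_bridge M F B x \<delta> X \<longleftrightarrow>
     (\<forall>t\<in>{0..1}. X t \<in> borel_measurable (F t)) \<and>
     (\<forall>\<omega>\<in>space M. continuous_on {0..1} (\<lambda>t. X t \<omega>) \<and> (\<forall>t\<in>{0..1}. 0 \<le> X t \<omega>)) \<and>
     (\<exists>I. \<forall>t\<in>{0..<1}.
        has_ito_integral M F B (\<lambda>s \<omega>. sqrt (X s \<omega>)) t (I t) \<and>
        (AE \<omega> in M. X t \<omega> = x + 2 * I t \<omega> + (LBINT s:{0..t}. \<delta> - 2 * X s \<omega> / (1 - s))))"


section \<open>The functions in the Laplace transform\<close>

text \<open>\<open>l\<close> is the Laplace variable \<open>\<lambda>\<close>. Both formulas contain quotients that degenerate: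
  \<open>1/(2(1-t))\<close> at \<open>t = 1\<close>, and the innermost ones when \<open>l + 1/(2(1-t)) = \<surd>(\<gamma>/2)\<close>, respectively
  \<open>x\<^sub>0 + 1/2 = \<surd>(\<gamma>/2)\<close>. They are read with \<open>1/0 = \<infinity>\<close> and \<open>1/\<infinity> = 0\<close>, i.e. by continuous
  extension. The bracket that is inverted is therefore formed in \<^typ>\<open>ereal\<close>, whose division obeys
  these conventions (in \<^typ>\<open>real\<close>, \<open>1/0 = 0\<close> would give wrong values).\<close>

definition bridge_phi :: "real \<Rightarrow> real \<Rightarrow> real \<Rightarrow> real" where
  "bridge_phi \<gamma> t l = sqrt (\<gamma> / 2) - 1 / 2 +
     real_of_ereal (inverse
       (ereal (exp (2 * sqrt (2 * \<gamma>) * t)) / (ereal l + 1 / (2 * (1 - ereal t)) - ereal (sqrt (\<gamma> / 2)))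
        - ereal (1 / sqrt (2 * \<gamma>) * (1 - exp (2 * sqrt (2 * \<gamma>) * t)))))"

text \<open>\<open>u \<mapsto> bridge_y \<gamma> x\<^sub>0 u\<close> solves \<open>y' = 2 y\<^sup>2 + 2 y / (1 - u) - \<gamma>\<close> with \<open>y(0) = x\<^sub>0\<close>, the Riccati
  equation belonging to the drift \<open>\<delta> - 2 X\<^sub>u / (1 - u)\<close>. The second summand is \<open>- 1/(2(1-u))\<close>; the
  constant \<open>- 1/2\<close>, its value at \<open>u = 0\<close>, which the source prints in its place, is a misprint: with
  it the equation fails and \<open>y\<close> has a non-integrable pole at \<open>u = 1\<close> when \<open>x\<^sub>0 = bridge_phi \<gamma> 1 l\<close>.\<close>

definition bridge_y :: "real \<Rightarrow> real \<Rightarrow> real \<Rightarrow> real" where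
  "bridge_y \<gamma> x\<^sub>0 u = sqrt (\<gamma> / 2) - 1 / (2 * (1 - u)) +
     exp (2 * sqrt (2 * \<gamma>) * u) *
     real_of_ereal (inverse
       (1 / (ereal x\<^sub>0 + 1 / 2 - ereal (sqrt (\<gamma> / 2)))
        + ereal (1 / sqrt (2 * \<gamma>) * (1 - exp (2 * sqrt (2 * \<gamma>) * u)))))"

definition bridge_psi :: "real \<Rightarrow> real \<Rightarrow> real \<Rightarrow> real \<Rightarrow> real" where
  "bridge_psi \<gamma> \<delta> t l = \<delta> * (LBINT u:{0..t}. bridge_y \<gamma> (bridge_phi \<gamma> t l) u)"

end

theory Submission
  imports Defs
begin

text \<open>
  Let \<open>a\<close> solve the Riccati equation \<open>a' = 2 a\<^sup>2 + 2 a / (1 - u) - \<gamma>\<close> on \<open>[0,t]\<close> with \<open>a(t) = l\<close>; it is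
  explicit and nonnegative, \<open>a(0)\<close> is \<open>bridge_phi\<close> and \<open>u \<mapsto> a(u)\<close> is \<open>bridge_y\<close>. By the product rule,
  \<open>exp (- a(r) X\<^sub>r - \<gamma> \<integral>\<^sub>0\<^sup>r X du + \<delta> \<integral>\<^sub>0\<^sup>r a du + a(0) x)\<close> is the stochastic exponential of
  \<open>- 2 \<integral> a \<surd>X dB\<close>. It is bounded since \<open>a, X \<ge> 0\<close>, so it should have expectation 1 at \<open>r = t\<close>.
  This is shown without Ito's formula. On a grid, with the integrand frozen at left endpoints and switched
  off once \<open>X\<close> has exceeded \<open>R\<close>, the exponential has expectation exactly 1 and bounded second moment, by the
  Gaussian moment generating function. As the mesh tends to 0 its exponent differs from the stopped true
  exponent by a term that vanishes pathwise by the Riccati equation and by an Ito integral that vanishes in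
  probability. Finally \<open>R \<rightarrow> \<infinity>\<close>, and the case \<open>t = 1\<close> follows by letting \<open>t \<rightarrow> 1\<close>.
\<close>

section \<open>The Riccati equation\<close>

text \<open>The substitution \<open>a = b - 1 / (2 * (1 - u))\<close> removes the linear term of the
  Riccati equation and leaves \<open>b' = 2 b^2 - \<gamma>\<close>. With
  \<open>b = D' / (2 * D)\<close> for a function \<open>D\<close> of the remaining time
  \<open>s = t - u\<close>, this becomes \<open>D'' = c^2 D\<close> with
  \<open>c = sqrt (2 * \<gamma>)\<close>; hence the hyperbolic functions. On the probabilistic side,
  a stochastic integral is given only as a version at each single time, as a limit in probability.
  No integral process with continuous paths is available, and a priori nothing ties the version at
  one time to that at another. The argument therefore rests on additivity in time and continuity in
  probability of such limits, both derived from one tail estimate for elementary integrals.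
  Convergence of the exponents in probability does not by itself preserve the expectation 1. The
  second moments supply uniform integrability, and bounding them is the purpose of the cut-off at
  \<open>R\<close>, since \<open>X\<close> has no deterministic bound. Working at
  \<open>t < 1\<close> keeps the drift continuous up to the end of the interval.\<close>

definition riccati_den :: "real \<Rightarrow> real \<Rightarrow> real \<Rightarrow> real \<Rightarrow> real" where
  "riccati_den c l q s = q * cosh (c * s) + (2 * l * q + 1) * (sinh (c * s) / c)"

definition riccati_num :: "real \<Rightarrow> real \<Rightarrow> real \<Rightarrow> real \<Rightarrow> real" where
  "riccati_num c l q s = q * (c * sinh (c * s)) + (2 * l * q + 1) * cosh (c * s)"

text \<open>With \<open>q = 1 - t\<close>, the initial values \<open>q\<close> of
  \<open>riccati_den\<close> and \<open>2 * l * q + 1\<close> of its derivative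
  \<open>riccati_num\<close> encode the terminal value \<open>l + 1 / (2 * q)\<close> of
  \<open>b\<close>. Clearing the denominator \<open>q\<close> keeps the formula meaningful at
  \<open>t = 1\<close>, where \<open>l\<close> drops out.\<close>

definition riccati_sol :: "real \<Rightarrow> real \<Rightarrow> real \<Rightarrow> real \<Rightarrow> real" where
  "riccati_sol c l t u =
     riccati_num c l (1 - t) (t - u) / (2 * riccati_den c l (1 - t) (t - u)) - 1 / (2 * (1 - u))"

lemma riccati_den_pos:
  assumes "c > 0" "l \<ge> 0" "q \<ge> 0" "s \<ge> 0" "q + s > 0"
  shows "riccati_den c l q s > 0"
proof (cases "q = 0")
  case True
  then show ?thesis using assms by (simp add: riccati_den_def)
next
  case False
  then have "q * cosh (c * s) > 0" using assms by simp
  moreover have "(2 * l * q + 1) * (sinh (c * s) / c) \<ge> 0"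
    using assms by (intro mult_nonneg_nonneg divide_nonneg_nonneg) auto
  ultimately show ?thesis unfolding riccati_den_def by linarith
qed

lemma DERIV_riccati_den: "c \<noteq> 0 \<Longrightarrow> (riccati_den c l q has_real_derivative riccati_num c l q s) (at s)"
  unfolding riccati_den_def[abs_def] riccati_num_def
  by (auto intro!: derivative_eq_intros)

lemma DERIV_riccati_num: "c \<noteq> 0 \<Longrightarrow> (riccati_num c l q has_real_derivative c\<^sup>2 * riccati_den c l q s) (at s)"
  unfolding riccati_den_def riccati_num_def[abs_def]
  by (auto intro!: derivative_eq_intros simp: field_simps power2_eq_square)

lemma DERIV_riccati_sol:
  assumes "c > 0" "l \<ge> 0" "t \<le> 1" "u \<le> t" "u < 1"
  shows "(riccati_sol c l t has_real_derivative
     2 * (riccati_sol c l t u)\<^sup>2 + 2 * riccati_sol c l t u / (1 - u) - c\<^sup>2 / 2) (at u)"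
proof -
  define N D where "N = riccati_num c l (1 - t)" and "D = riccati_den c l (1 - t)"
  have D: "D (t - u) > 0" unfolding D_def by (rule riccati_den_pos) (use assms in auto)
  have d0: "((\<lambda>u. t - u) has_real_derivative - 1) (at u)"
    by (auto intro!: derivative_eq_intros)
  have dN: "((\<lambda>u. N (t - u)) has_real_derivative - (c\<^sup>2 * D (t - u))) (at u)"
    unfolding N_def D_def
    using DERIV_chain2[of "riccati_num c l (1 - t)" _ "\<lambda>u. t - u" u "- 1" UNIV, OF DERIV_riccati_num d0] assms(1) by simp
  have dD: "((\<lambda>u. D (t - u)) has_real_derivative - N (t - u)) (at u)"
    unfolding N_def D_def
    using DERIV_chain2[of "riccati_den c l (1 - t)" _ "\<lambda>u. t - u" u "- 1" UNIV, OF DERIV_riccati_den d0] assms(1) by simp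
  have f1: "((\<lambda>u. N (t - u) / (2 * D (t - u)) - 1 / (2 * (1 - u))) has_real_derivative
    (- (c\<^sup>2 * D (t - u)) * (2 * D (t - u)) - N (t - u) * (2 * - N (t - u))) / (2 * D (t - u) * (2 * D (t - u)))
     - 1 / (2 * (1 - u)\<^sup>2)) (at u)"
  proof (rule DERIV_diff)
    show "((\<lambda>u. N (t - u) / (2 * D (t - u))) has_real_derivative
      (- (c\<^sup>2 * D (t - u)) * (2 * D (t - u)) - N (t - u) * (2 * - N (t - u))) / (2 * D (t - u) * (2 * D (t - u)))) (at u)"
      by (rule DERIV_divide[OF dN DERIV_cmult[OF dD]]) (use D in simp)
    show "((\<lambda>u. 1 / (2 * (1 - u))) has_real_derivative 1 / (2 * (1 - u)\<^sup>2)) (at u)"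
      using assms by (auto intro!: derivative_eq_intros simp: power2_eq_square divide_simps)
        (simp_all add: algebra_simps)
  qed
  have f2: "(- (c\<^sup>2 * D (t - u)) * (2 * D (t - u)) - N (t - u) * (2 * - N (t - u))) / (2 * D (t - u) * (2 * D (t - u)))
     = 2 * (N (t - u) / (2 * D (t - u)))\<^sup>2 - c\<^sup>2 / 2"
    using D by (simp add: field_simps power2_eq_square)
  \<comment> \<open>Completing the square: the shift by \<open>1 / (2 * r)\<close> with
    \<open>r = 1 - u\<close> absorbs the linear term of the Riccati equation.\<close>
  have f3: "2 * b\<^sup>2 - e / 2 - 1 / (2 * r\<^sup>2) = 2 * (b - 1 / (2 * r))\<^sup>2 + 2 * (b - 1 / (2 * r)) / r - e / 2"
    if "r \<noteq> 0" for b e r :: real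
    using that by (simp add: field_simps power2_eq_square)
  have r0: "1 - u \<noteq> 0" using assms by simp
  show ?thesis
    using f1 unfolding f2 riccati_sol_def[abs_def] N_def[symmetric] D_def[symmetric] f3[OF r0] .
qed

lemma sinh_le_mult_cosh:
  fixes x :: real
  assumes "x \<ge> 0"
  shows "sinh x \<le> x * cosh x"
proof -
  have "(\<lambda>x::real. x * cosh x - sinh x) 0 \<le> (\<lambda>x. x * cosh x - sinh x) x"
  proof (rule DERIV_nonneg_imp_nondecreasing[OF assms])
    fix y :: real
    assume "0 \<le> y" "y \<le> x"
    moreover have "((\<lambda>x. x * cosh x - sinh x) has_real_derivative y * sinh y) (at y)"
      by (auto intro!: derivative_eq_intros)
    ultimately show "\<exists>d. ((\<lambda>x. x * cosh x - sinh x) has_real_derivative d) (at y) \<and> 0 \<le> d"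
      by (intro exI[of _ "y * sinh y"]) simp
  qed
  then show ?thesis by simp
qed

text \<open>Nonnegativity is what will make the exponential bounded. Since
  \<open>1 - u = q + s\<close>, it amounts to
  \<open>riccati_den \<le> (q + s) * riccati_num\<close>; expanded, the difference is a sum of
  nonnegative terms, the last one by \<open>sinh y \<le> y * cosh y\<close>.\<close>

lemma riccati_sol_nonneg:
  assumes "c > 0" "l \<ge> 0" "t \<le> 1" "u \<le> t" "u < 1"
  shows "riccati_sol c l t u \<ge> 0"
proof -
  define q s where "q = 1 - t" and "s = t - u"
  have qs: "q \<ge> 0" "s \<ge> 0" "q + s > 0" "1 - u = q + s" using assms by (auto simp: q_def s_def)
  have D: "riccati_den c l q s > 0" using assms qs by (intro riccati_den_pos) auto
  have "sinh (c * s) \<le> c * s * cosh (c * s)" by (rule sinh_le_mult_cosh) (use assms qs in auto)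
  then have e: "s * cosh (c * s) - sinh (c * s) / c \<ge> 0" using assms by (simp add: field_simps)
  have S: "sinh (c * s) \<ge> 0" using assms qs by simp
  have "(q + s) * riccati_num c l q s - riccati_den c l q s
     = q * (q + s) * c * sinh (c * s) + 2 * l * q\<^sup>2 * cosh (c * s)
        + (2 * l * q + 1) * (s * cosh (c * s) - sinh (c * s) / c)"
    unfolding riccati_num_def riccati_den_def by (simp add: algebra_simps power2_eq_square)
  also have "\<dots> \<ge> 0" using assms qs e S by (intro add_nonneg_nonneg mult_nonneg_nonneg) auto
  finally have "riccati_den c l q s \<le> (q + s) * riccati_num c l q s" by simp
  then have "1 / (2 * (q + s)) \<le> riccati_num c l q s / (2 * riccati_den c l q s)"
    using D qs(3) by (simp add: frac_le_eq divide_le_0_iff mult_less_0_iff) (simp add: field_simps)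
  then show ?thesis unfolding riccati_sol_def qs(4) by (simp add: q_def s_def)
qed

lemma riccati_sol_end:
  assumes "t < 1"
  shows "riccati_sol c l t t = l"
proof -
  have "(2 * l * q + 1) / (2 * q) - 1 / (2 * q) = l" if "q \<noteq> 0" for q :: real
    using that by (simp add: field_simps)
  from this[of "1 - t"] show ?thesis
    using assms by (simp add: riccati_sol_def riccati_num_def riccati_den_def)
qed

section \<open>Exponential form, and agreement with the closed formulas for phi and y\<close>

lemma riccati_exp:
  assumes "c > 0"
  shows "2 * c * exp (c * s) * riccati_den c l q s
           = (c * q + (2 * l * q + 1)) * exp (2 * c * s) + (c * q - (2 * l * q + 1))"
    and "riccati_num c l q s - c * riccati_den c l q s
           = ((2 * l * q + 1) - c * q) * exp (- c * s)"
proof -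
  have "exp (c * s) * exp (c * s) = exp (2 * c * s)" "exp (c * s) * exp (- (c * s)) = 1"
    by (simp_all flip: exp_add)
  moreover have "2 * c * e * (q * ((e + f) / 2) + m * ((e - f) / 2 / c))
      = c * q * (e * e + e * f) + m * (e * e - e * f)" for e f m
    using assms by (simp add: field_simps)
  from this[of "exp (c * s)" "exp (- (c * s))" "2 * l * q + 1"]
  have "2 * c * exp (c * s) * riccati_den c l q s
      = c * q * (exp (c * s) * exp (c * s) + exp (c * s) * exp (- (c * s)))
       + (2 * l * q + 1) * (exp (c * s) * exp (c * s) - exp (c * s) * exp (- (c * s)))"
    unfolding riccati_den_def cosh_field_def sinh_field_def .
  ultimately show "2 * c * exp (c * s) * riccati_den c l q s
           = (c * q + (2 * l * q + 1)) * exp (2 * c * s) + (c * q - (2 * l * q + 1))"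
    by (simp add: algebra_simps)
  show "riccati_num c l q s - c * riccati_den c l q s
           = ((2 * l * q + 1) - c * q) * exp (- c * s)"
    using assms unfolding riccati_den_def riccati_num_def cosh_def sinh_def by (simp add: field_simps)
qed

text \<open>Write \<open>N\<close> and \<open>D\<close> for \<open>riccati_num\<close> and
  \<open>riccati_den\<close>. The inverted bracket of \<open>bridge_phi\<close> is the exponential
  form of \<open>(N - c * D) / (2 * D)\<close>; adding \<open>sqrt (\<gamma> / 2) = c / 2\<close>
  turns it into \<open>N / (2 * D)\<close>, and the remaining \<open>1 / 2\<close> is
  \<open>1 / (2 * (1 - u))\<close> at \<open>u = 0\<close>.\<close>

lemma bridge_phi_eq:
  assumes "\<gamma> > 0" "l \<ge> 0" "0 \<le> t" "t \<le> 1"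
  shows "bridge_phi \<gamma> t l = riccati_sol (sqrt (2 * \<gamma>)) l t 0"
proof -
  define c where "c = sqrt (2 * \<gamma>)"
  have c: "c > 0" "sqrt (\<gamma> / 2) = c / 2" using assms
    by (auto simp: c_def real_sqrt_mult real_sqrt_divide field_simps)
  define q where "q = 1 - t"
  \<comment> \<open>For \<open>q > 0\<close> the innermost denominator
    \<open>l + 1 / (2 * q) - c / 2\<close> of \<open>bridge_phi\<close> is
    \<open>p / (2 * q)\<close>; unlike this quotient, \<open>p\<close> stays finite at
    \<open>q = 0\<close>.\<close>
  define p where "p = (2 * l * q + 1) - c * q"
  define E where "E = exp (2 * c * t)"
  have q: "q \<ge> 0" "q + t > 0" using assms by (auto simp: q_def)
  have D: "riccati_den c l q t > 0" using assms c q by (intro riccati_den_pos) auto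
  have re: "2 * c * exp (c * t) * riccati_den c l q t = (2 * c * q + p) * E - p"
    "riccati_num c l q t - c * riccati_den c l q t = p * exp (- c * t)"
    using riccati_exp[OF c(1), where s = t and l = l and q = q] by (auto simp: p_def E_def algebra_simps)
  have "E > 0" by (simp add: E_def)
  define br where "br = inverse (ereal E / (ereal l + 1 / (2 * (1 - ereal t)) - ereal (c / 2))
        - ereal (1 / c * (1 - E)))"
  have key: "real_of_ereal br = p * exp (- c * t) / (2 * riccati_den c l q t)"
  proof (cases "q = 0")
    case True
    then have "t = 1" by (simp add: q_def)
    then have "E \<noteq> 1" using c by (simp add: E_def)
    \<comment> \<open>At \<open>t = 1\<close> the innermost denominator is infinite, so the first
      quotient is 0 by the conventions of \<open>ereal\<close>.\<close>
    have "br = inverse (0 - ereal (1 / c * (1 - E)))"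
      unfolding br_def using \<open>t = 1\<close> by (simp add: one_ereal_def[symmetric] divide_ereal_def)
    also have "\<dots> = ereal (c / (E - 1))"
      using c \<open>E \<noteq> 1\<close> by (simp add: zero_ereal_def field_simps)
    finally have "real_of_ereal br = c / (E - 1)" by simp
    moreover have "p = 1" using True by (simp add: p_def)
    moreover have "2 * c * exp (c * t) * riccati_den c l q t = E - 1" using re(1) True \<open>p = 1\<close> by simp
    ultimately have "real_of_ereal br = c / (2 * c * exp (c * t) * riccati_den c l q t)" by simp
    then show ?thesis using c D \<open>p = 1\<close> by (simp add: exp_minus field_simps)
  next
    case False
    with q have q0: "q > 0" by simp
    have "2 * (1 - ereal t) = ereal (2 * q)" by (simp add: q_def one_ereal_def)
    then have "1 / (2 * (1 - ereal t)) = ereal (1 / (2 * q))" using q0 by (simp add: one_ereal_def)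
    then have eq: "ereal l + 1 / (2 * (1 - ereal t)) - ereal (c / 2) = ereal (p / (2 * q))"
      using q0 by (simp add: p_def field_simps)
    show ?thesis
    proof (cases "p = 0")
      case True
      \<comment> \<open>A vanishing innermost denominator makes the bracket infinite and its inverse
        0, in agreement with the factor \<open>p = 0\<close> on the right.\<close>
      then show ?thesis unfolding br_def eq
        using \<open>E > 0\<close> by (simp add: zero_ereal_def[symmetric] divide_ereal_def)
    next
      case False
      then have "ereal E / ereal (p / (2 * q)) = ereal (2 * q * E / p)"
        using q0 by (simp add: field_simps)
      moreover have "2 * q * E / p - 1 / c * (1 - E) = ((2 * c * q + p) * E - p) / (c * p)"
        using False c by (simp add: field_simps)
      moreover have "\<dots> = 2 * exp (c * t) * riccati_den c l q t / p"
        unfolding re(1)[symmetric] using c by simp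
      moreover have "\<dots> \<noteq> 0" using False D by simp
      ultimately have "br = ereal (p / (2 * exp (c * t) * riccati_den c l q t))"
        unfolding br_def eq by (simp add: field_simps)
      then show ?thesis by (simp add: exp_minus field_simps)
    qed
  qed
  have "bridge_phi \<gamma> t l = c / 2 - 1 / 2 + real_of_ereal br"
    unfolding bridge_phi_def br_def c E_def c_def[symmetric] by simp
  also have "\<dots> = c / 2 - 1 / 2 + (riccati_num c l q t - c * riccati_den c l q t) / (2 * riccati_den c l q t)"
    unfolding key re(2) ..
  also have "\<dots> = riccati_sol c l t 0" using D by (simp add: riccati_sol_def q_def field_simps)
  finally show ?thesis by (simp add: c_def)
qed

text \<open>By the exponential form of \<open>riccati_den\<close>, the reciprocal of
  \<open>bridge_phi \<gamma> t l + 1 / 2 - c / 2\<close> and the second summand of the bracket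
  combine so that \<open>exp (2 * c * u)\<close> factors out; the cofactor has the same exponential
  form, now at the remaining time \<open>t - u\<close>. At \<open>u = 1\<close> the term
  \<open>1 / (2 * (1 - u))\<close> degenerates, but a single point does not affect the integral in
  \<open>bridge_psi\<close>.\<close>

lemma bridge_y_eq:
  assumes "\<gamma> > 0" "l \<ge> 0" "0 \<le> u" "u \<le> t" "t \<le> 1" "u < 1"
  shows "bridge_y \<gamma> (bridge_phi \<gamma> t l) u = riccati_sol (sqrt (2 * \<gamma>)) l t u"
proof -
  define c where "c = sqrt (2 * \<gamma>)"
  have c: "c > 0" "sqrt (\<gamma> / 2) = c / 2" using assms
    by (auto simp: c_def real_sqrt_mult real_sqrt_divide field_simps)
  define q where "q = 1 - t"
  define p where "p = (2 * l * q + 1) - c * q"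
  define D where "D = riccati_den c l q"
  have q: "q \<ge> 0" using assms by (auto simp: q_def)
  have D: "D t > 0" "D (t - u) > 0" unfolding D_def using assms c q
    by (intro riccati_den_pos; auto simp: q_def)+
  have num: "riccati_num c l q s = c * D s + p * exp (- c * s)" for s
    using riccati_exp(2)[OF c(1), where s = s and l = l and q = q] by (simp add: p_def D_def)
  have den: "2 * c * exp (c * s) * D s = (2 * c * q + p) * exp (2 * c * s) - p" for s
    using riccati_exp(1)[OF c(1), where s = s and l = l and q = q] by (auto simp: p_def D_def algebra_simps)
  have "bridge_phi \<gamma> t l = riccati_sol c l t 0"
    unfolding c_def by (rule bridge_phi_eq) (use assms in auto)
  then have phi: "bridge_phi \<gamma> t l + 1 / 2 - c / 2 = p * exp (- c * t) / (2 * D t)"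
    unfolding riccati_sol_def q_def[symmetric] num D_def[symmetric] using D by (simp add: field_simps)
  define br where "br = inverse (1 / (ereal (bridge_phi \<gamma> t l) + 1 / 2 - ereal (c / 2))
       + ereal (1 / c * (1 - exp (2 * c * u))))"
  have half: "(1::ereal) / 2 = ereal (1 / 2)" by (simp add: one_ereal_def)
  have eq: "ereal (bridge_phi \<gamma> t l) + 1 / 2 - ereal (c / 2) = ereal (p * exp (- c * t) / (2 * D t))"
    unfolding phi[symmetric] half by simp
  have key: "exp (2 * c * u) * real_of_ereal br = p * exp (- c * (t - u)) / (2 * D (t - u))"
  proof (cases "p = 0")
    case True
    then show ?thesis unfolding br_def eq by (simp add: zero_ereal_def[symmetric] divide_ereal_def)
  next
    case False
    have "1 / ereal (p * exp (- c * t) / (2 * D t)) = ereal (2 * D t * exp (c * t) / p)"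
      using False D by (simp add: one_ereal_def exp_minus field_simps)
    moreover have "2 * D t * exp (c * t) / p + 1 / c * (1 - exp (2 * c * u))
      = ((2 * c * exp (c * t) * D t) + p - p * exp (2 * c * u)) / (c * p)"
      using False c by (simp add: field_simps)
    moreover have "\<dots> = ((2 * c * q + p) * exp (2 * c * t) - p * exp (2 * c * u)) / (c * p)"
      by (simp add: den)
    moreover have "exp (2 * c * t) = exp (2 * c * u) * exp (2 * c * (t - u))"
      by (simp add: algebra_simps flip: exp_add)
    then have "(2 * c * q + p) * exp (2 * c * t) - p * exp (2 * c * u)
       = exp (2 * c * u) * (2 * c * exp (c * (t - u)) * D (t - u))"
      unfolding den by (simp add: algebra_simps)
    ultimately have "br = inverse (ereal (exp (2 * c * u) * (2 * c * exp (c * (t - u)) * D (t - u)) / (c * p)))"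
      unfolding br_def eq by simp
    also have "\<dots> = ereal (p / (exp (2 * c * u) * (2 * exp (c * (t - u)) * D (t - u))))"
      using False c D by (simp add: field_simps)
    finally have "exp (2 * c * u) * real_of_ereal br
      = exp (2 * c * u) * (p / (exp (2 * c * u) * (2 * exp (c * (t - u)) * D (t - u))))" by simp
    also have "\<dots> = p / (2 * exp (c * (t - u)) * D (t - u))" by simp
    also have "\<dots> = p * exp (- c * (t - u)) / (2 * D (t - u))"
      by (simp only: exp_minus mult_minus_left) (simp add: field_simps)
    finally show ?thesis .
  qed
  have "bridge_y \<gamma> (bridge_phi \<gamma> t l) u = c / 2 - 1 / (2 * (1 - u)) + exp (2 * c * u) * real_of_ereal br"
    unfolding bridge_y_def br_def c c_def[symmetric] by simp
  also have "\<dots> = riccati_sol c l t u"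
    unfolding key riccati_sol_def q_def[symmetric] num D_def[symmetric] using D by (simp add: field_simps)
  finally show ?thesis by (simp add: c_def)
qed

section \<open>Integral of the Riccati solution, and the function psi\<close>

lemma isCont_riccati_sol:
  assumes "c > 0" "l \<ge> 0" "t \<le> 1" "u \<le> t" "u < 1"
  shows "isCont (riccati_sol c l t) u"
  using DERIV_isCont[OF DERIV_riccati_sol[OF assms]] .

text \<open>Since \<open>riccati_num\<close> is the derivative of \<open>riccati_den\<close>, half
  the logarithm of \<open>D (t - u) / (1 - u)\<close> is, up to sign, an antiderivative. For
  \<open>t = 1\<close> both terms of \<open>riccati_sol\<close> have a pole at \<open>u = 1\<close>
  and only their difference is integrable. Hence a single logarithm of a quotient, and the
  fundamental theorem on the open interval in its version for nonnegative integrands.\<close>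

lemma riccati_integral:
  assumes "c > 0" "l \<ge> 0" "0 < t" "t \<le> 1"
  shows "set_integrable lborel (einterval 0 t) (riccati_sol c l t)"
    and "(LBINT u=0..t. riccati_sol c l t u) = ln (riccati_den c l (1 - t) t) / 2"
proof -
  define D where "D = riccati_den c l (1 - t)"
  define G where "G u = ln (D (t - u) / (1 - u)) / 2" for u
  have D: "D (t - u) > 0" if "0 \<le> u" "u \<le> t" "u < 1" for u
    unfolding D_def by (rule riccati_den_pos) (use assms that in auto)
  have dG: "((\<lambda>u. - G u) has_real_derivative riccati_sol c l t u) (at u)"
    if "0 \<le> u" "u \<le> t" "u < 1" for u
  proof -
    have d0: "((\<lambda>u. t - u) has_real_derivative - 1) (at u)"
      by (auto intro!: derivative_eq_intros)
    have dD: "((\<lambda>u. D (t - u)) has_real_derivative - riccati_num c l (1 - t) (t - u)) (at u)"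
      unfolding D_def
      using DERIV_chain2[of "riccati_den c l (1 - t)" _ "\<lambda>u. t - u" u "- 1" UNIV,
          OF DERIV_riccati_den d0] assms(1) by simp
    have "((\<lambda>u. ln (1 - u)) has_real_derivative - 1 / (1 - u)) (at u)"
      using that by (auto intro!: derivative_eq_intros)
    from DERIV_minus[OF DERIV_cdivide[OF DERIV_diff[OF DERIV_chain2[OF DERIV_ln_divide dD] this], of 2]]
    have "((\<lambda>u. - ((ln (D (t - u)) - ln (1 - u)) / 2)) has_real_derivative riccati_sol c l t u) (at u)"
      using D[OF that] by (simp add: riccati_sol_def D_def diff_divide_distrib add_divide_distrib mult.commute)
    \<comment> \<open>The logarithm of the quotient is split only near \<open>u\<close>, where both
      arguments are positive.\<close>
    moreover have "eventually (\<lambda>v. v \<in> {..<1} \<inter> {v. 0 < D (t - v)}) (nhds u)"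
    proof (rule eventually_nhds_in_open)
      have "continuous_on UNIV (\<lambda>v. D (t - v))"
        unfolding D_def riccati_den_def using assms by (intro continuous_intros) auto
      then show "open ({..<1} \<inter> {v. 0 < D (t - v)})"
        by (intro open_Int open_Collect_less continuous_intros) auto
    qed (use D that in auto)
    then have "eventually (\<lambda>v. - ((ln (D (t - v)) - ln (1 - v)) / 2) = - G v) (nhds u)"
      by eventually_elim (simp add: G_def ln_div)
    ultimately show ?thesis by (simp add: DERIV_cong_ev)
  qed
  have G0: "G 0 = ln (D t) / 2" by (simp add: G_def)
  have Gt: "(G \<longlongrightarrow> 0) (at_left t)"
  proof (cases "t < 1")
    case True
    then have "isCont (\<lambda>u. - G u) t" using assms by (intro DERIV_isCont[OF dG]) auto
    then have "isCont G t" using continuous_minus[of "at t" "\<lambda>u. - G u"] by simp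
    then have "(G \<longlongrightarrow> G t) (at_left t)"
      by (simp add: isCont_def filterlim_at_split)
    moreover have "G t = 0" using True by (simp add: G_def D_def riccati_den_def)
    ultimately show ?thesis by simp
  next
    case False
    with assms have t: "t = 1" by simp
    \<comment> \<open>At \<open>t = 1\<close> the quotient in \<open>G\<close> is
      \<open>sinh (c * (1 - u)) / (c * (1 - u))\<close>; its limit 1 is the derivative of
      \<open>sinh\<close> at 0.\<close>
    have "(sinh has_real_derivative 1) (at (0::real))" by (auto intro!: derivative_eq_intros)
    then have "((\<lambda>y::real. sinh y / y) \<longlongrightarrow> 1) (at 0)" by (simp add: has_field_derivative_iff)
    moreover have "filterlim (\<lambda>u. c * (1 - u)) (at 0) (at_left 1)"
      unfolding filterlim_at
    proof
      show "((\<lambda>u. c * (1 - u)) \<longlongrightarrow> 0) (at_left 1)"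
        by (rule tendsto_eq_intros refl | simp)+
      show "\<forall>\<^sub>F u in at_left 1. c * (1 - u) \<in> UNIV \<and> c * (1 - u) \<noteq> 0"
        using assms by (auto simp: eventually_at_filter)
    qed
    ultimately have "((\<lambda>u. sinh (c * (1 - u)) / (c * (1 - u))) \<longlongrightarrow> 1) (at_left 1)"
      by (rule filterlim_compose)
    then have "((\<lambda>u. ln (sinh (c * (1 - u)) / (c * (1 - u))) / 2) \<longlongrightarrow> ln 1 / 2) (at_left 1)"
      by (intro tendsto_intros) auto
    then show ?thesis by (simp add: t G_def[abs_def] D_def riccati_den_def)
  qed
  have *: "((\<lambda>u. - G u) \<longlongrightarrow> - G 0) (at_right 0)"
    using DERIV_isCont[OF dG[of 0]] assms by (simp add: isCont_def filterlim_at_split)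
  have e0: "ereal 0 = 0" by simp
  have ev0: "(((\<lambda>u. - G u) \<circ> real_of_ereal) \<longlongrightarrow> - G 0) (at_right (0::ereal))"
    using * unfolding e0[symmetric] by (simp add: at_right_ereal filterlim_def filtermap_filtermap comp_def)
  have ev1: "(((\<lambda>u. - G u) \<circ> real_of_ereal) \<longlongrightarrow> 0) (at_left (ereal t))"
    using tendsto_minus[OF Gt] by (simp add: at_left_ereal filterlim_def filtermap_filtermap comp_def)
  note FTC = interval_integral_FTC_nonneg[of 0 "ereal t" "\<lambda>u. - G u" "riccati_sol c l t", OF _ _ _ _ ev0 ev1]
  show "set_integrable lborel (einterval 0 t) (riccati_sol c l t)"
    by (rule FTC) (use assms in \<open>auto simp flip: zero_ereal_def intro!: dG isCont_riccati_sol AE_I2 riccati_sol_nonneg\<close>)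
  have "(LBINT u=0..t. riccati_sol c l t u) = 0 - (- G 0)"
    by (rule FTC) (use assms in \<open>auto simp flip: zero_ereal_def intro!: dG isCont_riccati_sol AE_I2 riccati_sol_nonneg\<close>)
  then show "(LBINT u=0..t. riccati_sol c l t u) = ln (riccati_den c l (1 - t) t) / 2"
    by (simp add: G0 D_def)
qed

text \<open>The functions \<open>bridge_y\<close> and \<open>riccati_sol\<close> agree in the
  interior of the interval, which is all that the integral sees.\<close>

lemma bridge_psi_eq:
  assumes "\<gamma> > 0" "l \<ge> 0" "0 \<le> t" "t \<le> 1"
  shows "bridge_psi \<gamma> \<delta> t l = \<delta> * (ln (riccati_den (sqrt (2 * \<gamma>)) l (1 - t) t) / 2)"
proof (cases "t = 0")
  case True
  have "(LBINT u:{0..0}. f u) = 0" for f :: "real \<Rightarrow> real"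
    by (subst interval_integral_Icc[symmetric]) auto
  then show ?thesis using True by (simp add: bridge_psi_def riccati_den_def)
next
  case False
  with assms have t: "0 < t" by simp
  have "(LBINT u:{0..t}. bridge_y \<gamma> (bridge_phi \<gamma> t l) u)
      = (LBINT u=0..t. bridge_y \<gamma> (bridge_phi \<gamma> t l) u)"
    unfolding zero_ereal_def by (rule interval_integral_Icc[symmetric]) (use t in simp)
  also have "\<dots> = (LBINT u=0..t. riccati_sol (sqrt (2 * \<gamma>)) l t u)"
    using t assms by (intro interval_integral_cong bridge_y_eq) (auto simp: einterval_iff min_def max_def)
  also have "\<dots> = ln (riccati_den (sqrt (2 * \<gamma>)) l (1 - t) t) / 2"
    using assms t by (intro riccati_integral) auto
  finally show ?thesis by (simp add: bridge_psi_def)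
qed

section \<open>Brownian increments\<close>

text \<open>Completing the square tilts the centred Gaussian of variance \<open>v\<close> into the
  one with mean \<open>k * v\<close>, and the compensator \<open>k^2 * v / 2\<close> is exactly the
  constant that this produces.\<close>

lemma gaussian_exp:
  fixes v k a :: real
  assumes "v > 0"
  shows "(\<integral>\<^sup>+z. ennreal (normal_density 0 (sqrt v) z) * ennreal (exp (a + (k * z - k\<^sup>2 * v / 2))) \<partial>lborel)
    = ennreal (exp a)"
proof -
  have "normal_density 0 (sqrt v) z * exp (a + (k * z - k\<^sup>2 * v / 2)) = exp a * normal_density (k * v) (sqrt v) z" for z
  proof -
    have "- (z\<^sup>2 / (2 * v)) + (a + (k * z - k\<^sup>2 * v / 2)) = a + - ((z - k * v)\<^sup>2 / (2 * v))"
      using assms by (simp add: field_simps power2_eq_square)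
    then show ?thesis
      using assms by (simp add: normal_density_def mult_ac flip: exp_add)
  qed
  then have "(\<integral>\<^sup>+z. ennreal (normal_density 0 (sqrt v) z) * ennreal (exp (a + (k * z - k\<^sup>2 * v / 2))) \<partial>lborel)
    = (\<integral>\<^sup>+z. ennreal (exp a) * ennreal (normal_density (k * v) (sqrt v) z) \<partial>lborel)"
    by (simp flip: ennreal_mult)
  also have "\<dots> = ennreal (exp a) * (\<integral>\<^sup>+z. ennreal (normal_density (k * v) (sqrt v) z) \<partial>lborel)"
    by (rule nn_integral_cmult) simp
  also have "(\<integral>\<^sup>+z. ennreal (normal_density (k * v) (sqrt v) z) \<partial>lborel) = 1"
    using assms by (subst nn_integral_eq_integral) auto
  finally show ?thesis by simp
qed

text \<open>In the isometry below, \<open>y\<close> is the sum over the past and \<open>k\<close>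
  the next coefficient, both held fixed.\<close>

lemma gaussian_square:
  fixes v k y :: real
  assumes "v > 0"
  shows "(\<integral>\<^sup>+z. ennreal (normal_density 0 (sqrt v) z) * ennreal ((y + k * z)\<^sup>2) \<partial>lborel)
    = ennreal (y\<^sup>2 + k\<^sup>2 * v)"
proof -
  define n where "n = normal_density 0 (sqrt v)"
  have s: "sqrt v > 0" using assms by simp
  have i0: "has_bochner_integral lborel n 1"
    unfolding n_def has_bochner_integral_iff
    using integrable_normal_density[OF s] integral_normal_density[OF s] by simp
  have i1: "has_bochner_integral lborel (\<lambda>z. n z * z) 0"
    unfolding n_def by (rule normal_moment_nz_1[OF s])
  have i2: "has_bochner_integral lborel (\<lambda>z. n z * z\<^sup>2) v"
    using normal_moment_even[OF s, of 0 1] assms by (simp add: n_def power2_eq_square fact_numeral mult_ac)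
  have "has_bochner_integral lborel (\<lambda>z. y\<^sup>2 * n z + (2 * y * k * (n z * z) + k\<^sup>2 * (n z * z\<^sup>2)))
      (y\<^sup>2 * 1 + (2 * y * k * 0 + k\<^sup>2 * v))"
    by (intro has_bochner_integral_add has_bochner_integral_mult_right i0 i1 i2)
  moreover have "y\<^sup>2 * n z + (2 * y * k * (n z * z) + k\<^sup>2 * (n z * z\<^sup>2)) = n z * (y + k * z)\<^sup>2" for z
    by (simp add: power2_eq_square algebra_simps)
  ultimately have "has_bochner_integral lborel (\<lambda>z. n z * (y + k * z)\<^sup>2) (y\<^sup>2 + k\<^sup>2 * v)" by simp
  then have "(\<integral>\<^sup>+z. ennreal (n z * (y + k * z)\<^sup>2) \<partial>lborel) = ennreal (y\<^sup>2 + k\<^sup>2 * v)"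
    by (subst nn_integral_eq_integral) (auto simp: has_bochner_integral_iff n_def)
  then show ?thesis by (simp add: n_def ennreal_mult)
qed

context filtered_prob_space
begin

lemma measurable_F: "f \<in> measurable (F s) N \<Longrightarrow> f \<in> measurable M N"
  using measurable_from_subalg[OF subalgebra_F] .

lemma measurable_F_mono: "s \<le> t \<Longrightarrow> f \<in> measurable (F s) N \<Longrightarrow> f \<in> measurable (F t) N"
  by (rule measurable_from_subalg[of "F t" "F s"])
     (use sets_F_mono in \<open>auto simp: subalgebra_def space_F\<close>)

end

section \<open>Expectations of sums over Brownian increments\<close>

context standard_brownian_motion
begin

lemma measurable_B: "0 \<le> t \<Longrightarrow> B t \<in> borel_measurable M"
  using measurable_F[OF adapted] .

text \<open>Independence of \<open>F s\<close> and the increment gives the product form on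
  rectangles, and rectangles determine the joint law.\<close>

lemma distr_pair_increment:
  assumes st: "0 \<le> s" "s < t" and Y: "Y \<in> measurable (F s) N"
  shows "distr M N Y \<Otimes>\<^sub>M distr M borel (\<lambda>\<omega>. B t \<omega> - B s \<omega>)
    = distr M (N \<Otimes>\<^sub>M borel) (\<lambda>\<omega>. (Y \<omega>, B t \<omega> - B s \<omega>))"
proof -
  define \<Delta> where "\<Delta> = (\<lambda>\<omega>. B t \<omega> - B s \<omega>)"
  have [measurable]: "Y \<in> measurable M N" "\<Delta> \<in> borel_measurable M"
    using measurable_F[OF Y] st unfolding \<Delta>_def by (auto intro!: borel_measurable_diff measurable_B)
  interpret Y: prob_space "distr M N Y" by (rule prob_space_distr) simp
  interpret D: prob_space "distr M borel \<Delta>" by (rule prob_space_distr) simp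
  have "distr M N Y \<Otimes>\<^sub>M distr M borel \<Delta> = distr M (N \<Otimes>\<^sub>M borel) (\<lambda>\<omega>. (Y \<omega>, \<Delta> \<omega>))"
  proof (rule pair_measure_eqI)
    fix A C assume "A \<in> sets (distr M N Y)" "C \<in> sets (distr M borel \<Delta>)"
    then have AC [measurable]: "A \<in> sets N" "C \<in> sets borel" by auto
    have "Y -` A \<inter> space M \<in> sets (F s)"
      using measurable_sets[OF Y AC(1)] by (simp add: space_F)
    moreover have "\<Delta> -` C \<inter> space M \<in> sets (vimage_algebra (space M) \<Delta> borel)"
      using AC by (auto simp: sets_vimage_algebra intro!: sigma_sets.Basic)
    ultimately have "prob ((Y -` A \<inter> space M) \<inter> (\<Delta> -` C \<inter> space M))
       = prob (Y -` A \<inter> space M) * prob (\<Delta> -` C \<inter> space M)"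
      using independent_increments[OF st] unfolding \<Delta>_def by (intro indep_setD)
    moreover have "(\<lambda>\<omega>. (Y \<omega>, \<Delta> \<omega>)) -` (A \<times> C) \<inter> space M = (Y -` A \<inter> space M) \<inter> (\<Delta> -` C \<inter> space M)"
      by auto
    ultimately show "emeasure (distr M N Y) A * emeasure (distr M borel \<Delta>) C
      = emeasure (distr M (N \<Otimes>\<^sub>M borel) (\<lambda>\<omega>. (Y \<omega>, \<Delta> \<omega>))) (A \<times> C)"
      by (simp add: emeasure_distr emeasure_eq_measure ennreal_mult)
  qed (auto intro: Y.sigma_finite_measure_axioms D.sigma_finite_measure_axioms sets_pair_measure_cong)
  then show ?thesis by (simp add: \<Delta>_def)
qed

text \<open>This freezing formula takes the place of conditional expectation given
  \<open>F s\<close>: by Fubini for the product law, the increment is integrated out while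
  \<open>Y\<close> is held fixed. Nonnegative integrals spare any check of integrability.\<close>

lemma nn_integral_increment:
  assumes st: "0 \<le> s" "s < t" and Y: "Y \<in> measurable (F s) N"
    and g [measurable]: "g \<in> borel_measurable (N \<Otimes>\<^sub>M borel)"
  shows "(\<integral>\<^sup>+\<omega>. g (Y \<omega>, B t \<omega> - B s \<omega>) \<partial>M)
    = (\<integral>\<^sup>+\<omega>. (\<integral>\<^sup>+z. ennreal (normal_density 0 (sqrt (t - s)) z) * g (Y \<omega>, z) \<partial>lborel) \<partial>M)"
proof -
  define \<Delta> where "\<Delta> = (\<lambda>\<omega>. B t \<omega> - B s \<omega>)"
  have rv [measurable]: "Y \<in> measurable M N" "\<Delta> \<in> borel_measurable M"
    and d: "distr M N Y \<Otimes>\<^sub>M distr M borel \<Delta> = distr M (N \<Otimes>\<^sub>M borel) (\<lambda>x. (Y x, \<Delta> x))"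
    using measurable_F[OF Y] st distr_pair_increment[OF st Y] unfolding \<Delta>_def
    by (auto intro!: borel_measurable_diff measurable_B)
  interpret D: prob_space "distr M borel \<Delta>" by (rule prob_space_distr) simp
  have "(\<integral>\<^sup>+\<omega>. g (Y \<omega>, \<Delta> \<omega>) \<partial>M) = (\<integral>\<^sup>+p. g p \<partial>distr M (N \<Otimes>\<^sub>M borel) (\<lambda>x. (Y x, \<Delta> x)))"
    by (subst nn_integral_distr) auto
  also have "\<dots> = (\<integral>\<^sup>+y. (\<integral>\<^sup>+z. g (y, z) \<partial>distr M borel \<Delta>) \<partial>distr M N Y)"
    unfolding d[symmetric] by (rule D.nn_integral_fst[symmetric]) simp
  also have "\<dots> = (\<integral>\<^sup>+\<omega>. (\<integral>\<^sup>+z. g (Y \<omega>, z) \<partial>distr M borel \<Delta>) \<partial>M)"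
    by (subst nn_integral_distr) (auto intro!: D.borel_measurable_nn_integral_fst)
  also have "\<dots> = (\<integral>\<^sup>+\<omega>. (\<integral>\<^sup>+z. ennreal (normal_density 0 (sqrt (t - s)) z) * g (Y \<omega>, z) \<partial>lborel) \<partial>M)"
  proof (rule nn_integral_cong)
    fix \<omega> assume "\<omega> \<in> space M"
    then have "Y \<omega> \<in> space N" by (rule measurable_space[OF rv(1)])
    then have [measurable]: "(\<lambda>z. g (Y \<omega>, z)) \<in> borel_measurable borel" by simp
    have "distr M borel \<Delta> = distr M lborel \<Delta>" by (rule distr_cong) auto
    then show "(\<integral>\<^sup>+z. g (Y \<omega>, z) \<partial>distr M borel \<Delta>)
      = (\<integral>\<^sup>+z. ennreal (normal_density 0 (sqrt (t - s)) z) * g (Y \<omega>, z) \<partial>lborel)"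
      using distributed_distr_eq_density[OF normal_increments[OF st], folded \<Delta>_def]
      by (simp add: nn_integral_density)
  qed
  finally show ?thesis by (simp add: \<Delta>_def)
qed

lemma nn_integral_exp_increment:
  assumes "0 \<le> s" "s \<le> t" and A: "A \<in> borel_measurable (F s)" and k: "k \<in> borel_measurable (F s)"
  shows "(\<integral>\<^sup>+\<omega>. ennreal (exp (A \<omega> + (k \<omega> * (B t \<omega> - B s \<omega>) - (k \<omega>)\<^sup>2 * (t - s) / 2))) \<partial>M)
    = (\<integral>\<^sup>+\<omega>. ennreal (exp (A \<omega>)) \<partial>M)"
proof (cases "s = t")
  case False
  with assms have st: "s < t" by simp
  have "(\<lambda>\<omega>. (A \<omega>, k \<omega>)) \<in> measurable (F s) (borel \<Otimes>\<^sub>M borel)" using A k by simp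
  from nn_integral_increment[OF \<open>0 \<le> s\<close> st this,
      of "\<lambda>p. ennreal (exp (fst (fst p) + (snd (fst p) * snd p - (snd (fst p))\<^sup>2 * (t - s) / 2)))"]
  show ?thesis using st by (simp add: gaussian_exp)
qed simp

lemma nn_integral_square_increment:
  assumes "0 \<le> s" "s \<le> t" and A: "A \<in> borel_measurable (F s)" and k: "k \<in> borel_measurable (F s)"
  shows "(\<integral>\<^sup>+\<omega>. ennreal ((A \<omega> + k \<omega> * (B t \<omega> - B s \<omega>))\<^sup>2) \<partial>M)
    = (\<integral>\<^sup>+\<omega>. ennreal ((A \<omega>)\<^sup>2 + (k \<omega>)\<^sup>2 * (t - s)) \<partial>M)"
proof (cases "s = t")
  case False
  with assms have st: "s < t" by simp
  have "(\<lambda>\<omega>. (A \<omega>, k \<omega>)) \<in> measurable (F s) (borel \<Otimes>\<^sub>M borel)" using A k by simp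
  from nn_integral_increment[OF \<open>0 \<le> s\<close> st this, of "\<lambda>p. ennreal ((fst (fst p) + snd (fst p) * snd p)\<^sup>2)"]
  show ?thesis using st by (simp add: gaussian_square del: ennreal_plus)
qed simp

text \<open>One induction serves the sums of products, of compensated products and of compensators
  below. The conclusion \<open>0 \<le> p n\<close> is carried along because \<open>adapted\<close>
  speaks only of nonnegative times.\<close>

lemma measurable_simple_sum:
  fixes p :: "nat \<Rightarrow> real"
  assumes "0 \<le> p 0" "\<And>j. j < n \<Longrightarrow> p j \<le> p (Suc j)"
    and "\<And>j. j < n \<Longrightarrow> g j \<in> borel_measurable (borel \<Otimes>\<^sub>M borel)"
    and "\<And>j. j < n \<Longrightarrow> k j \<in> borel_measurable (F (p j))"
  shows "(\<lambda>\<omega>. \<Sum>j<n. g j (k j \<omega>, B (p (Suc j)) \<omega> - B (p j) \<omega>) :: real) \<in> borel_measurable (F (p n)) \<and> 0 \<le> p n"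
  using assms
proof (induction n)
  case (Suc n)
  then have IH: "(\<lambda>\<omega>. \<Sum>j<n. g j (k j \<omega>, B (p (Suc j)) \<omega> - B (p j) \<omega>)) \<in> borel_measurable (F (p n))"
    and p: "0 \<le> p n" "p n \<le> p (Suc n)" by auto
  have [measurable]: "k n \<in> borel_measurable (F (p (Suc n)))" "B (p n) \<in> borel_measurable (F (p (Suc n)))"
    "B (p (Suc n)) \<in> borel_measurable (F (p (Suc n)))"
    "(\<lambda>\<omega>. \<Sum>j<n. g j (k j \<omega>, B (p (Suc j)) \<omega> - B (p j) \<omega>)) \<in> borel_measurable (F (p (Suc n)))"
    "g n \<in> borel_measurable (borel \<Otimes>\<^sub>M borel)"
    using measurable_F_mono[OF p(2) Suc.prems(4)[of n]] measurable_F_mono[OF p(2)] adapted[OF p(1)] adapted[of "p (Suc n)"] p IH Suc.prems by auto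
  show ?case using p by simp
qed auto

text \<open>The last increment is integrated out first: for a frozen past its compensated
  exponential has mean 1.\<close>

lemma nn_integral_exp_sum:
  fixes p :: "nat \<Rightarrow> real"
  assumes "0 \<le> p 0" "\<And>j. j < n \<Longrightarrow> p j \<le> p (Suc j)" "\<And>j. j < n \<Longrightarrow> k j \<in> borel_measurable (F (p j))"
  shows "(\<integral>\<^sup>+\<omega>. ennreal (exp (\<Sum>j<n. k j \<omega> * (B (p (Suc j)) \<omega> - B (p j) \<omega>)
      - (k j \<omega>)\<^sup>2 * (p (Suc j) - p j) / 2)) \<partial>M) = 1"
  using assms
proof (induction n)
  case 0
  then show ?case by (simp add: emeasure_space_1)
next
  case (Suc n)
  have "(\<lambda>\<omega>. \<Sum>j<n. k j \<omega> * (B (p (Suc j)) \<omega> - B (p j) \<omega>) - (k j \<omega>)\<^sup>2 * (p (Suc j) - p j) / 2)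
       \<in> borel_measurable (F (p n)) \<and> 0 \<le> p n"
    using Suc.prems measurable_simple_sum[of p n "\<lambda>j (k, z). k * z - k\<^sup>2 * (p (Suc j) - p j) / 2" k] by simp
  then show ?case
    using Suc.prems Suc.IH by (simp add: nn_integral_exp_increment)
qed

text \<open>The Ito isometry for step integrands. Cross terms vanish because each increment is
  centred and independent of the past; both sides may be infinite.\<close>

lemma nn_integral_square_sum:
  fixes p :: "nat \<Rightarrow> real"
  assumes "0 \<le> p 0" "\<And>j. j < n \<Longrightarrow> p j \<le> p (Suc j)" "\<And>j. j < n \<Longrightarrow> k j \<in> borel_measurable (F (p j))"
  shows "(\<integral>\<^sup>+\<omega>. ennreal ((\<Sum>j<n. k j \<omega> * (B (p (Suc j)) \<omega> - B (p j) \<omega>))\<^sup>2) \<partial>M)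
    = (\<integral>\<^sup>+\<omega>. ennreal (\<Sum>j<n. (k j \<omega>)\<^sup>2 * (p (Suc j) - p j)) \<partial>M)"
  using assms
proof (induction n)
  case (Suc n)
  let ?Z = "\<lambda>\<omega>. \<Sum>j<n. k j \<omega> * (B (p (Suc j)) \<omega> - B (p j) \<omega>)"
  let ?Q = "\<lambda>\<omega>. \<Sum>j<n. (k j \<omega>)\<^sup>2 * (p (Suc j) - p j)"
  have m: "?Z \<in> borel_measurable (F (p n))" "?Q \<in> borel_measurable (F (p n))" "0 \<le> p n"
    using Suc.prems measurable_simple_sum[of p n "\<lambda>j (k, z). k * z" k]
      measurable_simple_sum[of p n "\<lambda>j (k, z). k\<^sup>2 * (p (Suc j) - p j)" k] by auto
  have [measurable]: "?Z \<in> borel_measurable M" "?Q \<in> borel_measurable M" "k n \<in> borel_measurable M"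
    using m Suc.prems by (auto intro: measurable_F)
  have Q: "?Q \<omega> \<ge> 0" for \<omega> using Suc.prems by (intro sum_nonneg mult_nonneg_nonneg) auto
  have "(\<integral>\<^sup>+\<omega>. ennreal ((\<Sum>j<Suc n. k j \<omega> * (B (p (Suc j)) \<omega> - B (p j) \<omega>))\<^sup>2) \<partial>M)
    = (\<integral>\<^sup>+\<omega>. ennreal ((?Z \<omega>)\<^sup>2 + (k n \<omega>)\<^sup>2 * (p (Suc n) - p n)) \<partial>M)"
    using m Suc.prems nn_integral_square_increment[of "p n" "p (Suc n)" ?Z "k n"] by simp
  also have "\<dots> = (\<integral>\<^sup>+\<omega>. ennreal ((?Z \<omega>)\<^sup>2) \<partial>M) + (\<integral>\<^sup>+\<omega>. ennreal ((k n \<omega>)\<^sup>2 * (p (Suc n) - p n)) \<partial>M)"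
    using Suc.prems by (subst nn_integral_add[symmetric]) auto
  also have "(\<integral>\<^sup>+\<omega>. ennreal ((?Z \<omega>)\<^sup>2) \<partial>M) = (\<integral>\<^sup>+\<omega>. ennreal (?Q \<omega>) \<partial>M)"
    using Suc by simp
  also have "(\<integral>\<^sup>+\<omega>. ennreal (?Q \<omega>) \<partial>M) + (\<integral>\<^sup>+\<omega>. ennreal ((k n \<omega>)\<^sup>2 * (p (Suc n) - p n)) \<partial>M)
    = (\<integral>\<^sup>+\<omega>. ennreal (\<Sum>j<Suc n. (k j \<omega>)\<^sup>2 * (p (Suc j) - p j)) \<partial>M)"
    using Suc.prems Q by (subst nn_integral_add[symmetric]) (auto simp: ennreal_plus)
  finally show ?case .
qed simp

end

section \<open>Convergence in probability\<close>

lemma tendsto_0_squeeze: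
  fixes g h :: "'b \<Rightarrow> real"
  assumes "(h \<longlongrightarrow> 0) A" "\<And>n. 0 \<le> g n" "\<And>n. g n \<le> h n"
  shows "(g \<longlongrightarrow> 0) A"
  by (rule tendsto_sandwich[of "\<lambda>_. 0" g A h]) (use assms in auto)

context prob_space
begin

text \<open>Convergence to 0 in probability. Values are taken in \<open>ennreal\<close> because they
  are mostly integrals of squares, possibly infinite; measurability is included since
  \<open>prob\<close> is meaningless on non-measurable sets.\<close>

definition prob_small :: "(nat \<Rightarrow> 'a \<Rightarrow> ennreal) \<Rightarrow> bool" where
  "prob_small f \<longleftrightarrow> (\<forall>n. f n \<in> borel_measurable M) \<and>
     (\<forall>\<epsilon>>0. (\<lambda>n. prob {\<omega> \<in> space M. ennreal \<epsilon> < f n \<omega>}) \<longlonglongrightarrow> 0)"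

lemma prob_smallD: "prob_small f \<Longrightarrow> \<epsilon> > 0 \<Longrightarrow> (\<lambda>n. prob {\<omega> \<in> space M. ennreal \<epsilon> < f n \<omega>}) \<longlonglongrightarrow> 0"
  by (simp add: prob_small_def)

lemma prob_small_measurable: "prob_small f \<Longrightarrow> f n \<in> borel_measurable M"
  by (simp add: prob_small_def)

lemma prob_small_mono:
  assumes f: "prob_small f" and [measurable]: "\<And>n. g n \<in> borel_measurable M"
    and le: "\<And>n. AE \<omega> in M. g n \<omega> \<le> f n \<omega>"
  shows "prob_small g"
  unfolding prob_small_def
proof (intro conjI allI impI)
  fix \<epsilon> :: real assume \<epsilon>: "\<epsilon> > 0"
  have [measurable]: "\<And>n. f n \<in> borel_measurable M" using f by (rule prob_small_measurable)
  show "(\<lambda>n. prob {\<omega> \<in> space M. ennreal \<epsilon> < g n \<omega>}) \<longlonglongrightarrow> 0"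
  proof (rule tendsto_0_squeeze[OF prob_smallD[OF f \<epsilon>]])
    fix n
    show "prob {\<omega> \<in> space M. ennreal \<epsilon> < g n \<omega>} \<le> prob {\<omega> \<in> space M. ennreal \<epsilon> < f n \<omega>}"
    proof (rule finite_measure_mono_AE)
      show "AE \<omega> in M. \<omega> \<in> {\<omega> \<in> space M. ennreal \<epsilon> < g n \<omega>} \<longrightarrow> \<omega> \<in> {\<omega> \<in> space M. ennreal \<epsilon> < f n \<omega>}"
        using le[of n] by eventually_elim auto
    qed measurable
  qed simp
qed simp

lemma prob_small_add:
  assumes f: "prob_small f" and g: "prob_small g"
  shows "prob_small (\<lambda>n \<omega>. f n \<omega> + g n \<omega>)"
  unfolding prob_small_def
proof (intro conjI allI impI)
  fix \<epsilon> :: real assume \<epsilon>: "\<epsilon> > 0"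
  have [measurable]: "\<And>n. f n \<in> borel_measurable M" "\<And>n. g n \<in> borel_measurable M"
    using f g by (auto intro: prob_small_measurable)
  have "(\<lambda>n. prob {\<omega> \<in> space M. ennreal (\<epsilon> / 2) < f n \<omega>} + prob {\<omega> \<in> space M. ennreal (\<epsilon> / 2) < g n \<omega>}) \<longlonglongrightarrow> 0 + 0"
    using \<epsilon> by (intro tendsto_add prob_smallD f g) auto
  then have lim: "(\<lambda>n. prob {\<omega> \<in> space M. ennreal (\<epsilon> / 2) < f n \<omega>} + prob {\<omega> \<in> space M. ennreal (\<epsilon> / 2) < g n \<omega>}) \<longlonglongrightarrow> 0"
    by simp
  show "(\<lambda>n. prob {\<omega> \<in> space M. ennreal \<epsilon> < f n \<omega> + g n \<omega>}) \<longlonglongrightarrow> 0"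
  proof (rule tendsto_0_squeeze[OF lim])
    show "prob {\<omega> \<in> space M. ennreal \<epsilon> < f n \<omega> + g n \<omega>}
       \<le> prob {\<omega> \<in> space M. ennreal (\<epsilon> / 2) < f n \<omega>} + prob {\<omega> \<in> space M. ennreal (\<epsilon> / 2) < g n \<omega>}" for n
    proof -
      have "prob {\<omega> \<in> space M. ennreal \<epsilon> < f n \<omega> + g n \<omega>}
        \<le> prob ({\<omega> \<in> space M. ennreal (\<epsilon> / 2) < f n \<omega>} \<union> {\<omega> \<in> space M. ennreal (\<epsilon> / 2) < g n \<omega>})"
      proof (rule finite_measure_mono)
        have "ennreal \<epsilon> = ennreal (\<epsilon> / 2) + ennreal (\<epsilon> / 2)" using \<epsilon> by (simp flip: ennreal_plus)
        then show "{\<omega> \<in> space M. ennreal \<epsilon> < f n \<omega> + g n \<omega>}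
          \<subseteq> {\<omega> \<in> space M. ennreal (\<epsilon> / 2) < f n \<omega>} \<union> {\<omega> \<in> space M. ennreal (\<epsilon> / 2) < g n \<omega>}"
          by (smt (verit) Un_iff add_mono leD linorder_not_less mem_Collect_eq subsetI)
      qed measurable
      also have "\<dots> \<le> prob {\<omega> \<in> space M. ennreal (\<epsilon> / 2) < f n \<omega>} + prob {\<omega> \<in> space M. ennreal (\<epsilon> / 2) < g n \<omega>}"
        by (rule measure_Un_le) measurable
      finally show "prob {\<omega> \<in> space M. ennreal \<epsilon> < f n \<omega> + g n \<omega>}
       \<le> prob {\<omega> \<in> space M. ennreal (\<epsilon> / 2) < f n \<omega>} + prob {\<omega> \<in> space M. ennreal (\<epsilon> / 2) < g n \<omega>}" .
    qed
  qed simp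
next
  have [measurable]: "\<And>n. f n \<in> borel_measurable M" "\<And>n. g n \<in> borel_measurable M"
    using f g by (auto intro: prob_small_measurable)
  show "(\<lambda>\<omega>. f n \<omega> + g n \<omega>) \<in> borel_measurable M" for n by measurable
qed

lemma prob_small_cmult:
  assumes f: "prob_small f" and c: "c \<ge> 0"
  shows "prob_small (\<lambda>n \<omega>. ennreal c * f n \<omega>)"
  unfolding prob_small_def
proof (intro conjI allI impI)
  fix \<epsilon> :: real assume \<epsilon>: "\<epsilon> > 0"
  show "(\<lambda>n. prob {\<omega> \<in> space M. ennreal \<epsilon> < ennreal c * f n \<omega>}) \<longlonglongrightarrow> 0"
  proof (cases "c = 0")
    case False
    with c have c: "c > 0" by simp
    have "ennreal \<epsilon> < ennreal c * y \<longleftrightarrow> ennreal (\<epsilon> / c) < y" for y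
    proof (cases y)
      case (real r)
      then have "ennreal c * y = ennreal (c * r)" using c by (simp add: ennreal_mult)
      then show ?thesis using real c \<epsilon> by (simp add: ennreal_less_iff pos_divide_less_eq mult.commute)
    next
      case top
      then show ?thesis using c by (simp add: ennreal_mult_top)
    qed
    then show ?thesis using prob_smallD[OF f, of "\<epsilon> / c"] c \<epsilon> by simp
  qed simp
next
  have [measurable]: "\<And>n. f n \<in> borel_measurable M" using f by (rule prob_small_measurable)
  show "(\<lambda>\<omega>. ennreal c * f n \<omega>) \<in> borel_measurable M" for n by measurable
qed

text \<open>Dominated convergence, applied to the indicators of the events where
  \<open>\<epsilon>\<close> is exceeded.\<close>

lemma prob_small_AE:
  assumes [measurable]: "\<And>n. f n \<in> borel_measurable M" and lim: "AE \<omega> in M. (\<lambda>n. f n \<omega>) \<longlonglongrightarrow> 0"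
  shows "prob_small f"
  unfolding prob_small_def
proof (intro conjI allI impI)
  fix \<epsilon> :: real assume \<epsilon>: "\<epsilon> > 0"
  have "(\<lambda>n. expectation (indicator {\<omega> \<in> space M. ennreal \<epsilon> < f n \<omega>} :: 'a \<Rightarrow> real)) \<longlonglongrightarrow> expectation (\<lambda>_. 0)"
  proof (rule integral_dominated_convergence[where w = "\<lambda>_. 1"])
    show "AE \<omega> in M. (\<lambda>n. indicator {\<omega> \<in> space M. ennreal \<epsilon> < f n \<omega>} \<omega> :: real) \<longlonglongrightarrow> 0"
      using lim
    proof eventually_elim
      fix \<omega> assume "(\<lambda>n. f n \<omega>) \<longlonglongrightarrow> 0"
      then have "eventually (\<lambda>n. f n \<omega> < ennreal \<epsilon>) sequentially"
        using \<epsilon> by (auto elim!: order_tendstoD)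
      then have "eventually (\<lambda>n. indicator {\<omega> \<in> space M. ennreal \<epsilon> < f n \<omega>} \<omega> = (0::real)) sequentially"
        by eventually_elim (auto simp: indicator_def dest: less_asym)
      then show "(\<lambda>n. indicator {\<omega> \<in> space M. ennreal \<epsilon> < f n \<omega>} \<omega> :: real) \<longlonglongrightarrow> 0"
        by (rule tendsto_eventually)
    qed
  qed (auto simp: indicator_def)
  then show "(\<lambda>n. prob {\<omega> \<in> space M. ennreal \<epsilon> < f n \<omega>}) \<longlonglongrightarrow> 0"
    by simp
qed simp

text \<open>Through constant sequences, an Ito integral whose integrand is negligible will be seen
  to vanish almost surely.\<close>

lemma prob_small_const_AE:
  assumes "prob_small (\<lambda>_. f)"
  shows "AE \<omega> in M. f \<omega> = 0"
proof -
  have [measurable]: "f \<in> borel_measurable M" using prob_small_measurable[OF assms] .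
  have "AE \<omega> in M. \<not> ennreal (inverse (real (Suc n))) < f \<omega>" for n
  proof -
    have "prob {\<omega> \<in> space M. ennreal (inverse (real (Suc n))) < f \<omega>} = 0"
      using prob_smallD[OF assms, of "inverse (real (Suc n))"] by (simp add: LIMSEQ_const_iff)
    then show ?thesis by (subst AE_iff_measurable[OF _ refl]) (auto simp: emeasure_eq_measure)
  qed
  then have "AE \<omega> in M. \<forall>n. \<not> ennreal (inverse (real (Suc n))) < f \<omega>" by (simp add: AE_all_countable)
  then show ?thesis
  proof eventually_elim
    fix \<omega> assume *: "\<forall>n. \<not> ennreal (inverse (real (Suc n))) < f \<omega>"
    have "(\<lambda>n. ennreal (inverse (real (Suc n)))) \<longlonglongrightarrow> ennreal 0"
      by (intro tendsto_ennrealI LIMSEQ_inverse_real_of_nat)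
    from LIMSEQ_le_const[OF this, of "f \<omega>"] * show "f \<omega> = 0" by (auto simp: not_less)
  qed
qed

end

section \<open>Step functions on a partition\<close>

lemma sum_telescope_between:
  fixes p :: "nat \<Rightarrow> real" and g :: "real \<Rightarrow> real"
  assumes mono: "\<And>j. j < n \<Longrightarrow> p j < p (Suc j)" and ab: "a \<in> p ` {..n}" "b \<in> p ` {..n}" "a \<le> b"
  shows "(\<Sum>j<n. if a \<le> p j \<and> p j < b then g (p (Suc j)) - g (p j) else 0) = g b - g a"
proof -
  obtain \<alpha> \<beta> where \<alpha>: "\<alpha> \<le> n" "a = p \<alpha>" and \<beta>: "\<beta> \<le> n" "b = p \<beta>" using ab by auto
  have less: "p i < p j" if "i < j" "j \<le> n" for i j
    using that
  proof (induction j)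
    case (Suc j)
    then show ?case using mono[of j] by (cases "i = j") force+
  qed simp
  have iff: "p i < p j \<longleftrightarrow> i < j" if "i \<le> n" "j \<le> n" for i j
    using less[of i j] less[of j i] that by (cases i j rule: linorder_cases) auto
  have "\<alpha> \<le> \<beta>" using iff[of \<beta> \<alpha>] \<alpha> \<beta> ab by auto
  have "(\<Sum>j<n. if a \<le> p j \<and> p j < b then g (p (Suc j)) - g (p j) else 0)
    = (\<Sum>j\<in>{\<alpha>..<\<beta>}. g (p (Suc j)) - g (p j))"
    using \<alpha> \<beta> iff by (intro sum.mono_neutral_cong_right) (auto simp: not_less[symmetric])
  also have "\<dots> = g b - g a" using \<open>\<alpha> \<le> \<beta>\<close> \<alpha> \<beta> by (simp add: sum_Suc_diff'[where f = "\<lambda>j. g (p j)"])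
  finally show ?thesis .
qed

text \<open>At most one of the disjoint intervals contains \<open>u\<close>, so there are no cross
  terms. The induction needs the second conjunct: beyond the last node, where the next interval
  lies, the sum so far is 0.\<close>

lemma step_function_square:
  fixes p :: "nat \<Rightarrow> real" and k :: "nat \<Rightarrow> real"
  assumes "\<And>j. j < n \<Longrightarrow> p j \<le> p (Suc j)"
  shows "(\<Sum>j<n. k j * indicator {p j<..p (Suc j)} u)\<^sup>2 = (\<Sum>j<n. (k j)\<^sup>2 * indicator {p j<..p (Suc j)} u)
     \<and> (p n < u \<longrightarrow> (\<Sum>j<n. k j * indicator {p j<..p (Suc j)} u) = 0)"
  using assms
proof (induction n)
  case (Suc n)
  define S Q where "S = (\<Sum>j<n. k j * indicator {p j<..p (Suc j)} u)"
    and "Q = (\<Sum>j<n. (k j)\<^sup>2 * indicator {p j<..p (Suc j)} u)"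
  have "S\<^sup>2 = Q" "p n < u \<longrightarrow> S = 0" using Suc unfolding S_def Q_def by auto
  moreover have "p n \<le> p (Suc n)" using Suc.prems by simp
  ultimately show ?case
    unfolding sum.lessThan_Suc S_def[symmetric] Q_def[symmetric]
    by (cases "p n < u"; cases "u \<le> p (Suc n)") (auto simp: indicator_def power_mult_distrib)
qed simp

lemma nn_integral_step_function_square:
  fixes p :: "nat \<Rightarrow> real" and k :: "nat \<Rightarrow> real"
  assumes p: "\<And>j. j < n \<Longrightarrow> p j \<le> p (Suc j)"
  shows "(\<integral>\<^sup>+u. ennreal ((\<Sum>j<n. k j * indicator {p j<..p (Suc j)} u)\<^sup>2) \<partial>lborel)
     = ennreal (\<Sum>j<n. (k j)\<^sup>2 * (p (Suc j) - p j))"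
proof -
  have "(\<integral>\<^sup>+u. ennreal ((\<Sum>j<n. k j * indicator {p j<..p (Suc j)} u)\<^sup>2) \<partial>lborel)
    = (\<integral>\<^sup>+u. (\<Sum>j<n. ennreal ((k j)\<^sup>2) * indicator {p j<..p (Suc j)} u) \<partial>lborel)"
  proof (rule nn_integral_cong)
    fix u
    have "(\<Sum>j<n. ennreal ((k j)\<^sup>2) * indicator {p j<..p (Suc j)} u)
      = (\<Sum>j<n. ennreal ((k j)\<^sup>2 * indicator {p j<..p (Suc j)} u))"
      by (intro sum.cong) (auto simp: indicator_def)
    then show "ennreal ((\<Sum>j<n. k j * indicator {p j<..p (Suc j)} u)\<^sup>2)
      = (\<Sum>j<n. ennreal ((k j)\<^sup>2) * indicator {p j<..p (Suc j)} u)"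
      using step_function_square[where p = p and n = n and k = k and u = u] p by simp
  qed
  also have "\<dots> = (\<Sum>j<n. ennreal ((k j)\<^sup>2) * ennreal (p (Suc j) - p j))"
    using p by (subst nn_integral_sum) (auto simp: nn_integral_cmult_indicator)
  also have "\<dots> = ennreal (\<Sum>j<n. (k j)\<^sup>2 * (p (Suc j) - p j))"
  proof -
    have "(\<Sum>j<n. ennreal ((k j)\<^sup>2) * ennreal (p (Suc j) - p j))
      = (\<Sum>j<n. ennreal ((k j)\<^sup>2 * (p (Suc j) - p j)))"
      using p by (intro sum.cong) (auto simp: ennreal_mult)
    also have "\<dots> = ennreal (\<Sum>j<n. (k j)\<^sup>2 * (p (Suc j) - p j))"
      using p by (intro sum_ennreal mult_nonneg_nonneg) auto
    finally show ?thesis .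
  qed
  finally show ?thesis .
qed

section \<open>Elementary integrals and their limits\<close>

context standard_brownian_motion
begin

text \<open>Intervals may overlap, so sums need no common refinement; the lower bound \<open>s\<close> on the left endpoints
  is what allows multiplication by bounded \<open>F s\<close>-measurable factors.\<close>

inductive elem_int :: "real \<Rightarrow> (real \<Rightarrow> 'a \<Rightarrow> real) \<Rightarrow> ('a \<Rightarrow> real) \<Rightarrow> bool" for s where
  elem_zero: "elem_int s (\<lambda>u \<omega>. 0) (\<lambda>\<omega>. 0)"
| elem_add: "elem_int s (\<lambda>u \<omega>. V u \<omega> + \<xi> \<omega> * indicator {a<..b} u) (\<lambda>\<omega>. Z \<omega> + \<xi> \<omega> * (B b \<omega> - B a \<omega>))"
    if "elem_int s V Z" "s \<le> a" "a \<le> b" "\<xi> \<in> borel_measurable (F a)" "\<forall>\<omega>\<in>space M. \<bar>\<xi> \<omega>\<bar> \<le> C"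

lemma elem_int_plus:
  assumes "elem_int s V Z" "elem_int s V' Z'"
  shows "elem_int s (\<lambda>u \<omega>. V u \<omega> + V' u \<omega>) (\<lambda>\<omega>. Z \<omega> + Z' \<omega>)"
  using assms(2)
proof induction
  case elem_zero
  then show ?case using assms(1) by simp
next
  case (elem_add V' Z' a b \<xi> C)
  from elem_int.elem_add[OF elem_add.IH elem_add.hyps(2-5)] show ?case by (simp add: add.assoc)
qed

lemma elem_int_cmult:
  assumes "elem_int s V Z" and c: "c \<in> borel_measurable (F s)" "\<And>\<omega>. \<omega> \<in> space M \<Longrightarrow> \<bar>c \<omega>\<bar> \<le> K"
  shows "elem_int s (\<lambda>u \<omega>. c \<omega> * V u \<omega>) (\<lambda>\<omega>. c \<omega> * Z \<omega>)"
  using assms(1)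
proof induction
  case elem_zero
  show ?case by (simp add: elem_int.elem_zero)
next
  case (elem_add V Z a b \<xi> C)
  have m: "(\<lambda>\<omega>. c \<omega> * \<xi> \<omega>) \<in> borel_measurable (F a)"
    using measurable_F_mono[OF elem_add.hyps(2) c(1)] elem_add.hyps by simp
  have b: "\<forall>\<omega>\<in>space M. \<bar>c \<omega> * \<xi> \<omega>\<bar> \<le> K * C"
    using c(2) elem_add.hyps(5) by (auto simp: abs_mult intro!: mult_mono intro: order_trans[OF abs_ge_zero])
  show ?case
    using elem_int.elem_add[OF elem_add.IH elem_add.hyps(2,3) m b] by (simp add: algebra_simps)
qed

lemma elem_int_minus:
  assumes "elem_int s V Z" "elem_int s V' Z'"
  shows "elem_int s (\<lambda>u \<omega>. V u \<omega> - V' u \<omega>) (\<lambda>\<omega>. Z \<omega> - Z' \<omega>)"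
  using elem_int_plus[OF assms(1) elem_int_cmult[OF assms(2), of "\<lambda>_. - 1" 1]] by simp

lemma elem_int_mono: "elem_int s V Z \<Longrightarrow> s' \<le> s \<Longrightarrow> elem_int s' V Z"
  by (induction rule: elem_int.induct) (auto intro: elem_int.intros)

lemma elem_int_single:
  assumes "s \<le> a" "a \<le> b" "\<xi> \<in> borel_measurable (F a)" "\<And>\<omega>. \<omega> \<in> space M \<Longrightarrow> \<bar>\<xi> \<omega>\<bar> \<le> C"
  shows "elem_int s (\<lambda>u \<omega>. \<xi> \<omega> * indicator {a<..b} u) (\<lambda>\<omega>. \<xi> \<omega> * (B b \<omega> - B a \<omega>))"
  using elem_add[OF elem_zero assms(1-3) ballI[OF assms(4)]] by simp

text \<open>An interval straddling \<open>s\<close> is cut at \<open>s\<close>. The right part keeps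
  its coefficient, which is measurable for \<open>F s\<close> because the filtration
  increases.\<close>

lemma elem_int_split:
  assumes "elem_int r V Z" "r \<le> s"
  obtains Z1 Z2 where "elem_int r (\<lambda>u \<omega>. V u \<omega> * indicator {..s} u) Z1"
    "elem_int s (\<lambda>u \<omega>. V u \<omega> * indicator {s<..} u) Z2" "\<And>\<omega>. Z \<omega> = Z1 \<omega> + Z2 \<omega>"
proof -
  have "\<exists>Z1 Z2. elem_int r (\<lambda>u \<omega>. V u \<omega> * indicator {..s} u) Z1 \<and>
    elem_int s (\<lambda>u \<omega>. V u \<omega> * indicator {s<..} u) Z2 \<and> (\<forall>\<omega>. Z \<omega> = Z1 \<omega> + Z2 \<omega>)"
    using assms(1)
  proof induction
    case elem_zero
    have "elem_int r (\<lambda>u \<omega>. 0) (\<lambda>\<omega>. 0)" "elem_int s (\<lambda>u \<omega>. 0) (\<lambda>\<omega>. 0)" by (rule elem_int.elem_zero)+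
    then show ?case by force
  next
    case (elem_add V Z a b \<xi> C)
    then obtain Z1 Z2 where Z: "elem_int r (\<lambda>u \<omega>. V u \<omega> * indicator {..s} u) Z1"
      "elem_int s (\<lambda>u \<omega>. V u \<omega> * indicator {s<..} u) Z2" "\<And>\<omega>. Z \<omega> = Z1 \<omega> + Z2 \<omega>" by blast
    show ?case
    proof (cases "a \<le> s")
      case True
      have 1: "elem_int r (\<lambda>u \<omega>. V u \<omega> * indicator {..s} u + \<xi> \<omega> * indicator {a<..min b s} u)
        (\<lambda>\<omega>. Z1 \<omega> + \<xi> \<omega> * (B (min b s) \<omega> - B a \<omega>))"
        using elem_add.hyps True by (intro elem_int.elem_add Z(1)) auto
      \<comment> \<open>If \<open>b \<le> s\<close>, the interval from \<open>s\<close> to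
        \<open>max b s\<close> is empty and the added term is 0.\<close>
      have 2: "elem_int s (\<lambda>u \<omega>. V u \<omega> * indicator {s<..} u + \<xi> \<omega> * indicator {s<..max b s} u)
        (\<lambda>\<omega>. Z2 \<omega> + \<xi> \<omega> * (B (max b s) \<omega> - B s \<omega>))"
        using elem_add.hyps True measurable_F_mono[OF True elem_add.hyps(4)]
        by (intro elem_int.elem_add Z(2)) auto
      have e1: "(\<lambda>u \<omega>. V u \<omega> * indicator {..s} u + \<xi> \<omega> * indicator {a<..min b s} u)
        = (\<lambda>u \<omega>. (V u \<omega> + \<xi> \<omega> * indicator {a<..b} u) * indicator {..s} u)"
        by (auto simp: fun_eq_iff indicator_def)
      have e2: "(\<lambda>u \<omega>. V u \<omega> * indicator {s<..} u + \<xi> \<omega> * indicator {s<..max b s} u)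
        = (\<lambda>u \<omega>. (V u \<omega> + \<xi> \<omega> * indicator {a<..b} u) * indicator {s<..} u)"
        using True elem_add.hyps(3) by (auto simp: fun_eq_iff indicator_def)
      have e3: "Z \<omega> + \<xi> \<omega> * (B b \<omega> - B a \<omega>) = (Z1 \<omega> + \<xi> \<omega> * (B (min b s) \<omega> - B a \<omega>))
         + (Z2 \<omega> + \<xi> \<omega> * (B (max b s) \<omega> - B s \<omega>))" for \<omega>
        unfolding Z(3) by (auto simp: min_def max_def algebra_simps)
      show ?thesis using 1 2 e3 unfolding e1 e2 by blast
    next
      case False
      have 2: "elem_int s (\<lambda>u \<omega>. V u \<omega> * indicator {s<..} u + \<xi> \<omega> * indicator {a<..b} u)
        (\<lambda>\<omega>. Z2 \<omega> + \<xi> \<omega> * (B b \<omega> - B a \<omega>))"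
        using elem_add.hyps False by (intro elem_int.elem_add Z(2)) auto
      have e1: "(\<lambda>u \<omega>. (V u \<omega> + \<xi> \<omega> * indicator {a<..b} u) * indicator {..s} u) = (\<lambda>u \<omega>. V u \<omega> * indicator {..s} u)"
        using False by (auto simp: fun_eq_iff indicator_def)
      have e2: "(\<lambda>u \<omega>. V u \<omega> * indicator {s<..} u + \<xi> \<omega> * indicator {a<..b} u)
        = (\<lambda>u \<omega>. (V u \<omega> + \<xi> \<omega> * indicator {a<..b} u) * indicator {s<..} u)"
        using False by (auto simp: fun_eq_iff indicator_def)
      have e3: "Z \<omega> + \<xi> \<omega> * (B b \<omega> - B a \<omega>) = Z1 \<omega> + (Z2 \<omega> + \<xi> \<omega> * (B b \<omega> - B a \<omega>))" for \<omega>
        unfolding Z(3) by simp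
      show ?thesis using Z(1) 2 e3 unfolding e1 e2 by blast
    qed
  qed
  then show ?thesis using that by blast
qed

lemma elem_int_simple:
  assumes S: "simple_predictable M F S" and r: "0 \<le> r"
  shows "elem_int 0 (\<lambda>u \<omega>. simple_value S u \<omega> * indicator {..r} u) (simple_integral B S r)"
proof -
  have "elem_int 0 (\<lambda>u \<omega>. (\<Sum>i<m. level S i \<omega> * indicator {knot S i<..knot S (Suc i)} u) * indicator {..r} u)
     (\<lambda>\<omega>. \<Sum>i<m. level S i \<omega> * (B (min r (knot S (Suc i))) \<omega> - B (min r (knot S i)) \<omega>)) \<and> 0 \<le> knot S m"
    if "m \<le> steps S" for m
    using that
  proof (induction m)
    case 0
    then show ?case using S by (simp add: elem_int.elem_zero simple_predictable_def)
  next
    case (Suc m)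
    let ?k = "knot S m" and ?k' = "knot S (Suc m)"
    obtain C where k: "?k \<le> ?k'" and l: "level S m \<in> borel_measurable (F ?k)"
      "\<forall>\<omega>\<in>space M. \<bar>level S m \<omega>\<bar> \<le> C"
      using S Suc.prems unfolding simple_predictable_def by (meson Suc_le_lessD)
    show ?case
    proof (cases "?k \<le> r")
      case True
      have "elem_int 0 (\<lambda>u \<omega>. (\<Sum>i<m. level S i \<omega> * indicator {knot S i<..knot S (Suc i)} u) * indicator {..r} u
          + level S m \<omega> * indicator {?k<..min r ?k'} u)
        (\<lambda>\<omega>. (\<Sum>i<m. level S i \<omega> * (B (min r (knot S (Suc i))) \<omega> - B (min r (knot S i)) \<omega>))
          + level S m \<omega> * (B (min r ?k') \<omega> - B ?k \<omega>))"
        using Suc k l True by (intro elem_int.elem_add) auto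
      moreover have "(\<lambda>u \<omega>. (\<Sum>i<m. level S i \<omega> * indicator {knot S i<..knot S (Suc i)} u) * indicator {..r} u
          + level S m \<omega> * indicator {?k<..min r ?k'} u)
        = (\<lambda>u \<omega>. (\<Sum>i<Suc m. level S i \<omega> * indicator {knot S i<..knot S (Suc i)} u) * indicator {..r} u)"
        unfolding sum.lessThan_Suc by (auto simp: fun_eq_iff indicator_def)
      moreover have "min r ?k = ?k" using True by simp
      ultimately show ?thesis using Suc k by simp
    next
      case False
      \<comment> \<open>For a left knot beyond \<open>r\<close> both minima in
        \<open>simple_integral\<close> equal \<open>r\<close>, so the term contributes neither to
        the integrand up to \<open>r\<close> nor to the integral.\<close>
      have "(\<lambda>u \<omega>. (\<Sum>i<Suc m. level S i \<omega> * indicator {knot S i<..knot S (Suc i)} u) * indicator {..r} u)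
         = (\<lambda>u \<omega>. (\<Sum>i<m. level S i \<omega> * indicator {knot S i<..knot S (Suc i)} u) * indicator {..r} u)"
        using False unfolding sum.lessThan_Suc by (auto simp: fun_eq_iff indicator_def)
      then show ?thesis using Suc k False by (simp add: min_def)
    qed
  qed
  from this[of "steps S"] show ?thesis
    by (simp add: simple_value_def[abs_def] simple_integral_def[abs_def])
qed

lemma elem_int_measurable:
  assumes "elem_int s V Z" "0 \<le> s"
  shows "(\<lambda>(u, \<omega>). V u \<omega>) \<in> borel_measurable (borel \<Otimes>\<^sub>M M)" "Z \<in> borel_measurable M"
proof -
  have "(\<lambda>(u, \<omega>). V u \<omega>) \<in> borel_measurable (borel \<Otimes>\<^sub>M M) \<and> Z \<in> borel_measurable M"
    using assms(1)
  proof induction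
    case (elem_add V Z a b \<xi> C)
    have [measurable]: "(\<lambda>p. V (fst p) (snd p)) \<in> borel_measurable (borel \<Otimes>\<^sub>M M)" "Z \<in> borel_measurable M"
      "\<xi> \<in> borel_measurable M" "B a \<in> borel_measurable M" "B b \<in> borel_measurable M"
      using elem_add assms(2) measurable_F[OF elem_add.hyps(4)] by (auto intro!: measurable_B simp: case_prod_beta')
    show ?case unfolding case_prod_beta' by simp
  qed simp
  then show "(\<lambda>(u, \<omega>). V u \<omega>) \<in> borel_measurable (borel \<Otimes>\<^sub>M M)" "Z \<in> borel_measurable M" by auto
qed

text \<open>Overlapping intervals are brought onto a common partition. Since the claim covers every
  partition whose nodes include \<open>P\<close>, the induction hypothesis applies directly to a
  partition that also contains the two new endpoints.\<close>

lemma elem_int_refine: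
  assumes "elem_int s V Z" "0 \<le> s"
  shows "\<exists>P. finite P \<and> P \<subseteq> {0..} \<and> (\<forall>p n. (\<forall>j<n. p j < p (Suc j)) \<longrightarrow> P \<subseteq> p ` {..n} \<longrightarrow>
    (\<exists>k. (\<forall>j<n. k j \<in> borel_measurable (F (p j))) \<and>
      V = (\<lambda>u \<omega>. \<Sum>j<n. k j \<omega> * indicator {p j<..p (Suc j)} u) \<and>
      Z = (\<lambda>\<omega>. \<Sum>j<n. k j \<omega> * (B (p (Suc j)) \<omega> - B (p j) \<omega>))))"
  using assms(1)
proof induction
  case elem_zero
  show ?case by (rule exI[of _ "{}"]) (auto intro!: exI[of _ "\<lambda>_ _. 0"])
next
  case (elem_add V Z a b \<xi> C)
  then obtain P where P: "finite P" "P \<subseteq> {0..}"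
    and rep: "\<And>p n. (\<forall>j<n. p j < p (Suc j)) \<Longrightarrow> P \<subseteq> p ` {..n} \<Longrightarrow>
      (\<exists>k. (\<forall>j<n. k j \<in> borel_measurable (F (p j))) \<and>
      V = (\<lambda>u \<omega>. \<Sum>j<n. k j \<omega> * indicator {p j<..p (Suc j)} u) \<and>
      Z = (\<lambda>\<omega>. \<Sum>j<n. k j \<omega> * (B (p (Suc j)) \<omega> - B (p j) \<omega>)))"
    by blast
  show ?case
  proof (intro exI[of _ "insert a (insert b P)"] conjI allI impI)
    show "finite (insert a (insert b P))" "insert a (insert b P) \<subseteq> {0..}"
      using P elem_add.hyps assms(2) by auto
    fix p :: "nat \<Rightarrow> real" and n
    assume mono: "\<forall>j<n. p j < p (Suc j)" and sub: "insert a (insert b P) \<subseteq> p ` {..n}"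
    obtain k where k: "\<forall>j<n. k j \<in> borel_measurable (F (p j))"
      and V: "V = (\<lambda>u \<omega>. \<Sum>j<n. k j \<omega> * indicator {p j<..p (Suc j)} u)"
      and Z: "Z = (\<lambda>\<omega>. \<Sum>j<n. k j \<omega> * (B (p (Suc j)) \<omega> - B (p j) \<omega>))"
      using rep[OF mono] sub by blast
    \<comment> \<open>The new coefficient is added on exactly those cells that make up
      \<open>{a<..b}\<close>; there \<open>a \<le> p j\<close>, so measurability is
      preserved.\<close>
    define k' where "k' j \<omega> = k j \<omega> + (if a \<le> p j \<and> p j < b then \<xi> \<omega> else 0)" for j \<omega>
    have tel: "(\<Sum>j<n. if a \<le> p j \<and> p j < b then g (p (Suc j)) - g (p j) else 0) = g b - g a"
      for g :: "real \<Rightarrow> real"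
      using mono sub elem_add.hyps by (intro sum_telescope_between) auto
    \<comment> \<open>One identity for arbitrary \<open>g\<close> serves twice: a step function
      \<open>g\<close> yields the integrand, the Brownian path yields the integral.\<close>
    have tel': "(\<Sum>j<n. k' j \<omega> * (g (p (Suc j)) - g (p j)))
      = (\<Sum>j<n. k j \<omega> * (g (p (Suc j)) - g (p j))) + \<xi> \<omega> * (g b - g a)" for g \<omega>
      unfolding tel[symmetric] k'_def sum_distrib_left sum.distrib[symmetric]
      by (intro sum.cong) (auto simp: algebra_simps)
    show "\<exists>k. (\<forall>j<n. k j \<in> borel_measurable (F (p j))) \<and>
      (\<lambda>u \<omega>. V u \<omega> + \<xi> \<omega> * indicator {a<..b} u) = (\<lambda>u \<omega>. \<Sum>j<n. k j \<omega> * indicator {p j<..p (Suc j)} u) \<and>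
      (\<lambda>\<omega>. Z \<omega> + \<xi> \<omega> * (B b \<omega> - B a \<omega>)) = (\<lambda>\<omega>. \<Sum>j<n. k j \<omega> * (B (p (Suc j)) \<omega> - B (p j) \<omega>))"
    proof (intro exI[of _ k'] conjI allI impI)
      fix j assume "j < n"
      then show "k' j \<in> borel_measurable (F (p j))"
        using k measurable_F_mono[OF _ elem_add.hyps(4), of "p j"] unfolding k'_def[abs_def]
        by (cases "a \<le> p j \<and> p j < b") auto
    next
      show "(\<lambda>u \<omega>. V u \<omega> + \<xi> \<omega> * indicator {a<..b} u) = (\<lambda>u \<omega>. \<Sum>j<n. k' j \<omega> * indicator {p j<..p (Suc j)} u)"
      proof (intro ext)
        fix u \<omega>
        have ind: "indicator {x<..y} u = (if u \<le> y then 1 else 0) - (if u \<le> x then 1 else (0::real))"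
          if "x \<le> y" for x y :: real using that by (auto simp: indicator_def)
        have "(\<Sum>j<n. h j * indicator {p j<..p (Suc j)} u)
          = (\<Sum>j<n. h j * ((if u \<le> p (Suc j) then 1 else 0) - (if u \<le> p j then 1 else 0)))" for h :: "nat \<Rightarrow> real"
          using mono by (intro sum.cong refl) (subst ind, auto intro: less_imp_le)
        then show "V u \<omega> + \<xi> \<omega> * indicator {a<..b} u = (\<Sum>j<n. k' j \<omega> * indicator {p j<..p (Suc j)} u)"
          using tel'[of \<omega> "\<lambda>v. if u \<le> v then 1 else 0"] unfolding V ind[OF elem_add.hyps(3)] by simp
      qed
    next
      show "(\<lambda>\<omega>. Z \<omega> + \<xi> \<omega> * (B b \<omega> - B a \<omega>)) = (\<lambda>\<omega>. \<Sum>j<n. k' j \<omega> * (B (p (Suc j)) \<omega> - B (p j) \<omega>))"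
        unfolding Z using tel'[of _ "\<lambda>v. B v _"] by (intro ext) simp
    qed
  qed
qed

lemma elem_int_sorted:
  assumes "elem_int s V Z" "0 \<le> s"
  obtains p :: "nat \<Rightarrow> real" and n k where "0 \<le> p 0" "\<And>j. j < n \<Longrightarrow> p j < p (Suc j)"
    "\<And>j. j < n \<Longrightarrow> k j \<in> borel_measurable (F (p j))"
    "V = (\<lambda>u \<omega>. \<Sum>j<n. k j \<omega> * indicator {p j<..p (Suc j)} u)"
    "Z = (\<lambda>\<omega>. \<Sum>j<n. k j \<omega> * (B (p (Suc j)) \<omega> - B (p j) \<omega>))"
proof -
  obtain P where P: "finite P" "P \<subseteq> {0..}"
    and rep: "\<And>p n. (\<forall>j<n. p j < p (Suc j)) \<Longrightarrow> P \<subseteq> p ` {..n} \<Longrightarrow>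
      (\<exists>k. (\<forall>j<n. k j \<in> borel_measurable (F (p j))) \<and>
      V = (\<lambda>u \<omega>. \<Sum>j<n. k j \<omega> * indicator {p j<..p (Suc j)} u) \<and>
      Z = (\<lambda>\<omega>. \<Sum>j<n. k j \<omega> * (B (p (Suc j)) \<omega> - B (p j) \<omega>)))"
    using elem_int_refine[OF assms] by blast
  \<comment> \<open>The node 0 keeps the list nonempty even when \<open>P\<close> is empty.\<close>
  define xs where "xs = sorted_list_of_set (insert 0 P)"
  define n where "n = length xs - 1"
  have set: "set xs = insert 0 P" and sorted: "sorted_wrt (<) xs"
    using P unfolding xs_def
    by (simp_all only: set_sorted_list_of_set strict_sorted_list_of_set finite_insert)
  then have len: "length xs = Suc n" unfolding n_def by (cases xs) auto
  have "P \<subseteq> (!) xs ` {..n}"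
    using set len by (metis atMost_iff image_eqI in_set_conv_nth insertCI less_Suc_eq_le subsetI)
  moreover have mono: "\<forall>j<n. xs ! j < xs ! Suc j"
    using sorted len by (auto simp: sorted_wrt_iff_nth_less)
  moreover have "xs ! 0 \<in> set xs" using len by (intro nth_mem) simp
  then have "0 \<le> xs ! 0" using set P by auto
  ultimately show ?thesis using rep[of n "(!) xs"] that[of "(!) xs" n] by blast
qed

end

section \<open>Tail estimate for elementary integrals\<close>

lemma truncated_sum_le:
  fixes w :: "nat \<Rightarrow> real"
  assumes w: "\<And>j. j < n \<Longrightarrow> 0 \<le> w j" and "0 \<le> \<eta>"
  shows "(\<Sum>j<n. if (\<Sum>i\<le>j. w i) \<le> \<eta> then w j else 0) \<le> \<eta>"
proof -
  \<comment> \<open>The second bound strengthens the induction: if the last term is kept, the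
    truncated sum is at most the full sum, which is then at most \<open>\<eta>\<close>.\<close>
  have "(\<Sum>j<n. if (\<Sum>i\<le>j. w i) \<le> \<eta> then w j else 0) \<le> \<eta> \<and>
    (\<Sum>j<n. if (\<Sum>i\<le>j. w i) \<le> \<eta> then w j else 0) \<le> (\<Sum>j<n. w j)"
    using w
  proof (induction n)
    case (Suc n)
    then have "(\<Sum>j<n. if (\<Sum>i\<le>j. w i) \<le> \<eta> then w j else 0) \<le> \<eta> \<and>
      (\<Sum>j<n. if (\<Sum>i\<le>j. w i) \<le> \<eta> then w j else 0) \<le> (\<Sum>j<n. w j)" and "0 \<le> w n" by auto
    moreover have "(\<Sum>i\<le>n. w i) = (\<Sum>i<n. w i) + w n" by (simp flip: lessThan_Suc_atMost)
    ultimately show ?case unfolding sum.lessThan_Suc by auto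
  qed (use \<open>0 \<le> \<eta>\<close> in simp)
  then show ?thesis by blast
qed

lemma borel_measurable_nn_integral_param:
  assumes "(\<lambda>(u, \<omega>). V u \<omega>) \<in> borel_measurable (borel \<Otimes>\<^sub>M M)"
  shows "(\<lambda>\<omega>. \<integral>\<^sup>+u. ennreal ((V u \<omega> :: real)\<^sup>2) \<partial>lborel) \<in> borel_measurable M"
proof -
  have "(\<lambda>p. (snd p, fst p)) \<in> M \<Otimes>\<^sub>M lborel \<rightarrow>\<^sub>M borel \<Otimes>\<^sub>M M" by measurable
  from measurable_compose[OF this assms]
  have [measurable]: "(\<lambda>p. V (snd p) (fst p)) \<in> borel_measurable (M \<Otimes>\<^sub>M lborel)" by simp
  show ?thesis
    by (rule lborel.borel_measurable_nn_integral) (simp add: case_prod_beta')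
qed

context standard_brownian_motion
begin

text \<open>Truncating the integrand as soon as \<open>\<integral> V\<^sup>2\<close> exceeds \<open>\<eta>\<close> keeps it predictable
  and leaves the integral unchanged where \<open>\<integral> V\<^sup>2 \<le> \<eta>\<close>.\<close>

lemma elem_int_tail:
  assumes V: "elem_int s V Z" and s: "0 \<le> s" and \<epsilon>: "0 < \<epsilon>" and \<eta>: "0 < \<eta>"
  shows "prob {\<omega> \<in> space M. \<epsilon> < \<bar>Z \<omega>\<bar>}
    \<le> \<eta> / \<epsilon>\<^sup>2 + prob {\<omega> \<in> space M. ennreal \<eta> < (\<integral>\<^sup>+u. ennreal ((V u \<omega>)\<^sup>2) \<partial>lborel)}"
proof -
  obtain p :: "nat \<Rightarrow> real" and n k where p0: "0 \<le> p 0" and p: "\<And>j. j < n \<Longrightarrow> p j < p (Suc j)"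
    and k: "\<And>j. j < n \<Longrightarrow> k j \<in> borel_measurable (F (p j))"
    and Veq: "V = (\<lambda>u \<omega>. \<Sum>j<n. k j \<omega> * indicator {p j<..p (Suc j)} u)"
    and Zeq: "Z = (\<lambda>\<omega>. \<Sum>j<n. k j \<omega> * (B (p (Suc j)) \<omega> - B (p j) \<omega>))"
    using elem_int_sorted[OF V s] by blast
  note [measurable] = elem_int_measurable[OF V s]
  have p': "\<And>j. j < n \<Longrightarrow> p j \<le> p (Suc j)" using p by (simp add: less_imp_le)
  define w where "w j \<omega> = (k j \<omega>)\<^sup>2 * (p (Suc j) - p j)" for j \<omega>
  have w: "j < n \<Longrightarrow> 0 \<le> w j \<omega>" for j \<omega> using p' by (simp add: w_def)
  have int: "(\<integral>\<^sup>+u. ennreal ((V u \<omega>)\<^sup>2) \<partial>lborel) = ennreal (\<Sum>j<n. w j \<omega>)" for \<omega>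
    unfolding Veq w_def by (rule nn_integral_step_function_square[where p = p and n = n, OF p'])
  have pmono: "p i \<le> p j" if "i \<le> j" "j \<le> n" for i j
    using that
  proof (induction j)
    case (Suc j)
    then show ?case using p'[of j] by (cases "i = Suc j") auto
  qed simp
  \<comment> \<open>The sum includes index \<open>j\<close> itself: its weight uses only the
    coefficient known at \<open>p j\<close> and the length of the cell, so the decision to keep a
    cell is made at its left endpoint.\<close>
  define k' where "k' j \<omega> = (if (\<Sum>i\<le>j. w i \<omega>) \<le> \<eta> then k j \<omega> else 0)" for j \<omega>
  have k': "k' j \<in> borel_measurable (F (p j))" if j: "j < n" for j
  proof -
    have "w i \<in> borel_measurable (F (p j))" if "i \<le> j" for i
      unfolding w_def[abs_def] using measurable_F_mono[OF pmono k, of i j] that j by simp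
    then have [measurable]: "(\<lambda>\<omega>. \<Sum>i\<le>j. w i \<omega>) \<in> borel_measurable (F (p j))" by simp
    have [measurable]: "k j \<in> borel_measurable (F (p j))" using k[OF j] .
    show ?thesis unfolding k'_def[abs_def] by measurable
  qed
  define Z' where "Z' \<omega> = (\<Sum>j<n. k' j \<omega> * (B (p (Suc j)) \<omega> - B (p j) \<omega>))" for \<omega>
  have "Z' \<in> borel_measurable (F (p n))"
    using measurable_simple_sum[of p n "\<lambda>_ (k, z). k * z" k', OF p0 p' _ k']
    unfolding Z'_def[abs_def] by simp
  then have [measurable]: "Z' \<in> borel_measurable M" by (rule measurable_F)
  have eq: "Z' \<omega> = Z \<omega>" if "(\<Sum>j<n. w j \<omega>) \<le> \<eta>" for \<omega>
    unfolding Z'_def Zeq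
  proof (intro sum.cong refl)
    fix j assume "j \<in> {..<n}"
    then have "(\<Sum>i\<le>j. w i \<omega>) \<le> (\<Sum>j<n. w j \<omega>)" using w by (intro sum_mono2) auto
    then show "k' j \<omega> * (B (p (Suc j)) \<omega> - B (p j) \<omega>) = k j \<omega> * (B (p (Suc j)) \<omega> - B (p j) \<omega>)"
      using that by (simp add: k'_def)
  qed
  have "(\<integral>\<^sup>+\<omega>. ennreal ((Z' \<omega>)\<^sup>2) \<partial>M) = (\<integral>\<^sup>+\<omega>. ennreal (\<Sum>j<n. (k' j \<omega>)\<^sup>2 * (p (Suc j) - p j)) \<partial>M)"
    unfolding Z'_def by (rule nn_integral_square_sum[where p = p and n = n, OF p0 p' k'])
  also have "\<dots> \<le> (\<integral>\<^sup>+\<omega>. ennreal \<eta> \<partial>M)"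
  proof (intro nn_integral_mono ennreal_leI)
    fix \<omega>
    have "(\<Sum>j<n. (k' j \<omega>)\<^sup>2 * (p (Suc j) - p j)) = (\<Sum>j<n. if (\<Sum>i\<le>j. w i \<omega>) \<le> \<eta> then w j \<omega> else 0)"
      by (intro sum.cong) (auto simp: k'_def w_def)
    then show "(\<Sum>j<n. (k' j \<omega>)\<^sup>2 * (p (Suc j) - p j)) \<le> \<eta>"
      using truncated_sum_le[of n "\<lambda>j. w j \<omega>" \<eta>] w \<eta> by simp
  qed
  finally have L2: "(\<integral>\<^sup>+\<omega>. ennreal ((Z' \<omega>)\<^sup>2) \<partial>M) \<le> ennreal \<eta>" by (simp add: emeasure_space_1)
  have "ennreal (prob {\<omega> \<in> space M. \<epsilon> < \<bar>Z' \<omega>\<bar>}) \<le> emeasure M {\<omega> \<in> space M. 1 \<le> ennreal (1 / \<epsilon>\<^sup>2) * ennreal ((Z' \<omega>)\<^sup>2)}"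
    unfolding emeasure_eq_measure
  proof (intro ennreal_leI finite_measure_mono subsetI)
    fix \<omega> assume "\<omega> \<in> {\<omega> \<in> space M. \<epsilon> < \<bar>Z' \<omega>\<bar>}"
    then have "\<omega> \<in> space M" "\<epsilon>\<^sup>2 \<le> (Z' \<omega>)\<^sup>2" using \<epsilon> by (auto simp flip: abs_le_square_iff)
    then have "1 \<le> 1 / \<epsilon>\<^sup>2 * (Z' \<omega>)\<^sup>2" using \<epsilon> by (simp add: field_simps)
    then show "\<omega> \<in> {\<omega> \<in> space M. 1 \<le> ennreal (1 / \<epsilon>\<^sup>2) * ennreal ((Z' \<omega>)\<^sup>2)}"
      using \<open>\<omega> \<in> space M\<close> by (simp add: ennreal_mult[symmetric] del: ennreal_1 flip: ennreal_1)
  qed measurable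
  also have "\<dots> \<le> ennreal (1 / \<epsilon>\<^sup>2) * (\<integral>\<^sup>+\<omega>. ennreal ((Z' \<omega>)\<^sup>2) * indicator (space M) \<omega> \<partial>M)"
    using nn_integral_Markov_inequality[of "\<lambda>\<omega>. ennreal ((Z' \<omega>)\<^sup>2)" "space M" M "ennreal (1 / \<epsilon>\<^sup>2)"] by simp
  also have "\<dots> \<le> ennreal (1 / \<epsilon>\<^sup>2) * ennreal \<eta>"
  proof (rule mult_left_mono)
    have "(\<integral>\<^sup>+\<omega>. ennreal ((Z' \<omega>)\<^sup>2) * indicator (space M) \<omega> \<partial>M) = (\<integral>\<^sup>+\<omega>. ennreal ((Z' \<omega>)\<^sup>2) \<partial>M)"
      by (intro nn_integral_cong) simp
    then show "(\<integral>\<^sup>+\<omega>. ennreal ((Z' \<omega>)\<^sup>2) * indicator (space M) \<omega> \<partial>M) \<le> ennreal \<eta>" using L2 by simp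
  qed simp
  finally have "prob {\<omega> \<in> space M. \<epsilon> < \<bar>Z' \<omega>\<bar>} \<le> \<eta> / \<epsilon>\<^sup>2"
    using \<eta> by (simp add: ennreal_mult[symmetric])
  moreover have "prob {\<omega> \<in> space M. \<epsilon> < \<bar>Z \<omega>\<bar>}
    \<le> prob ({\<omega> \<in> space M. \<epsilon> < \<bar>Z' \<omega>\<bar>} \<union> {\<omega> \<in> space M. ennreal \<eta> < (\<integral>\<^sup>+u. ennreal ((V u \<omega>)\<^sup>2) \<partial>lborel)})"
  proof (rule finite_measure_mono)
    show "{\<omega> \<in> space M. \<epsilon> < \<bar>Z \<omega>\<bar>} \<subseteq> {\<omega> \<in> space M. \<epsilon> < \<bar>Z' \<omega>\<bar>} \<union>
       {\<omega> \<in> space M. ennreal \<eta> < (\<integral>\<^sup>+u. ennreal ((V u \<omega>)\<^sup>2) \<partial>lborel)}"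
      using eq \<eta> by (auto simp: int ennreal_less_iff not_less)
  qed (use borel_measurable_nn_integral_param[OF elem_int_measurable(1)[OF V s]] in measurable)
  moreover have "\<dots> \<le> prob {\<omega> \<in> space M. \<epsilon> < \<bar>Z' \<omega>\<bar>}
      + prob {\<omega> \<in> space M. ennreal \<eta> < (\<integral>\<^sup>+u. ennreal ((V u \<omega>)\<^sup>2) \<partial>lborel)}"
    by (rule measure_Un_le)
      (use borel_measurable_nn_integral_param[OF elem_int_measurable(1)[OF V s]] in measurable)
  ultimately show ?thesis by linarith
qed

lemma elem_int_small:
  assumes V: "\<And>m. elem_int s (V m) (Z m)" and s: "0 \<le> s"
    and small: "prob_small (\<lambda>m \<omega>. \<integral>\<^sup>+u. ennreal ((V m u \<omega>)\<^sup>2) \<partial>lborel)"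
  shows "prob_small (\<lambda>m \<omega>. ennreal \<bar>Z m \<omega>\<bar>)"
  unfolding prob_small_def
proof (intro conjI allI impI)
  fix \<epsilon> :: real assume \<epsilon>: "0 < \<epsilon>"
  show "(\<lambda>m. prob {\<omega> \<in> space M. ennreal \<epsilon> < ennreal \<bar>Z m \<omega>\<bar>}) \<longlonglongrightarrow> 0"
  proof (rule LIMSEQ_I)
    fix r :: real assume r: "0 < r"
    \<comment> \<open>Chosen so that the Chebyshev term \<open>\<eta> / \<epsilon>^2\<close> of the
      tail estimate equals \<open>r / 2\<close>.\<close>
    define \<eta> where "\<eta> = r * \<epsilon>\<^sup>2 / 2"
    have \<eta>: "0 < \<eta>" using r \<epsilon> by (simp add: \<eta>_def)
    obtain N where N: "\<And>m. m \<ge> N \<Longrightarrow> prob {\<omega> \<in> space M. ennreal \<eta> < (\<integral>\<^sup>+u. ennreal ((V m u \<omega>)\<^sup>2) \<partial>lborel)} < r / 2"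
      using LIMSEQ_D[OF prob_smallD[OF small \<eta>], of "r / 2"] r by auto
    show "\<exists>N. \<forall>m\<ge>N. norm (prob {\<omega> \<in> space M. ennreal \<epsilon> < ennreal \<bar>Z m \<omega>\<bar>} - 0) < r"
    proof (intro exI[of _ N] allI impI)
      fix m assume "N \<le> m"
      then have "prob {\<omega> \<in> space M. \<epsilon> < \<bar>Z m \<omega>\<bar>} < \<eta> / \<epsilon>\<^sup>2 + r / 2"
        using elem_int_tail[OF V[of m] s \<epsilon> \<eta>] N[of m] by linarith
      also have "\<eta> / \<epsilon>\<^sup>2 + r / 2 = r" using \<epsilon> by (simp add: \<eta>_def)
      finally show "norm (prob {\<omega> \<in> space M. ennreal \<epsilon> < ennreal \<bar>Z m \<omega>\<bar>} - 0) < r"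
        using \<epsilon> by (simp add: ennreal_less_iff)
    qed
  qed
qed (use elem_int_measurable(2)[OF V s] in measurable)

end

lemma ennreal_square_triangle:
  fixes a b w :: real
  assumes "\<bar>w\<bar> \<le> \<bar>a\<bar> + \<bar>b\<bar>"
  shows "ennreal (w\<^sup>2) \<le> ennreal 2 * ennreal (a\<^sup>2) + ennreal 2 * ennreal (b\<^sup>2)"
proof -
  have "w\<^sup>2 \<le> (\<bar>a\<bar> + \<bar>b\<bar>)\<^sup>2" using assms by (metis abs_ge_zero power2_abs power_mono)
  also have "\<dots> \<le> 2 * a\<^sup>2 + 2 * b\<^sup>2"
    using sum_squares_ge_zero[of "\<bar>a\<bar> - \<bar>b\<bar>" 0] by (simp add: power2_eq_square algebra_simps)
  finally have "ennreal (w\<^sup>2) \<le> ennreal (2 * a\<^sup>2 + 2 * b\<^sup>2)" by (rule ennreal_leI)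
  then show ?thesis by (simp add: ennreal_mult)
qed

context prob_space
begin

text \<open>The square of the random L2 norm obeys a triangle inequality up to the factor 2. Phrased
  as pointwise domination, it also covers integrands cut off at a time.\<close>

lemma prob_small_square_triangle:
  assumes V: "prob_small (\<lambda>m \<omega>. \<integral>\<^sup>+u. ennreal ((V m u \<omega>)\<^sup>2) \<partial>lborel)"
    and V': "prob_small (\<lambda>m \<omega>. \<integral>\<^sup>+u. ennreal ((V' m u \<omega>)\<^sup>2) \<partial>lborel)"
    and m: "\<And>m. (\<lambda>(u, \<omega>). V m u \<omega>) \<in> borel_measurable (borel \<Otimes>\<^sub>M M)"
      "\<And>m. (\<lambda>(u, \<omega>). V' m u \<omega>) \<in> borel_measurable (borel \<Otimes>\<^sub>M M)"
      "\<And>m. (\<lambda>(u, \<omega>). W m u \<omega>) \<in> borel_measurable (borel \<Otimes>\<^sub>M M)"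
    and le: "\<And>m u \<omega>. \<omega> \<in> space M \<Longrightarrow> \<bar>W m u \<omega>\<bar> \<le> \<bar>V m u \<omega>\<bar> + \<bar>V' m u \<omega>\<bar>"
  shows "prob_small (\<lambda>m \<omega>. \<integral>\<^sup>+u. ennreal ((W m u \<omega>)\<^sup>2) \<partial>lborel)"
proof (rule prob_small_mono)
  show "prob_small (\<lambda>m \<omega>. ennreal 2 * (\<integral>\<^sup>+u. ennreal ((V m u \<omega>)\<^sup>2) \<partial>lborel)
     + ennreal 2 * (\<integral>\<^sup>+u. ennreal ((V' m u \<omega>)\<^sup>2) \<partial>lborel))"
    using V V' by (intro prob_small_add prob_small_cmult) auto
  show "(\<lambda>\<omega>. \<integral>\<^sup>+u. ennreal ((W m u \<omega>)\<^sup>2) \<partial>lborel) \<in> borel_measurable M" for m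
    by (rule borel_measurable_nn_integral_param[OF m(3)])
  show "AE \<omega> in M. (\<integral>\<^sup>+u. ennreal ((W m u \<omega>)\<^sup>2) \<partial>lborel) \<le> ennreal 2 * (\<integral>\<^sup>+u. ennreal ((V m u \<omega>)\<^sup>2) \<partial>lborel)
     + ennreal 2 * (\<integral>\<^sup>+u. ennreal ((V' m u \<omega>)\<^sup>2) \<partial>lborel)" for m
  proof (rule AE_I2)
    fix \<omega> assume \<omega>: "\<omega> \<in> space M"
    have [measurable]: "(\<lambda>u. V m u \<omega>) \<in> borel_measurable borel" "(\<lambda>u. V' m u \<omega>) \<in> borel_measurable borel"
      using measurable_compose[OF measurable_Pair2'[OF \<omega>] m(1)[of m]]
        measurable_compose[OF measurable_Pair2'[OF \<omega>] m(2)[of m]] by simp_all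
    have "(\<integral>\<^sup>+u. ennreal ((W m u \<omega>)\<^sup>2) \<partial>lborel)
      \<le> (\<integral>\<^sup>+u. ennreal 2 * ennreal ((V m u \<omega>)\<^sup>2) + ennreal 2 * ennreal ((V' m u \<omega>)\<^sup>2) \<partial>lborel)"
      by (intro nn_integral_mono ennreal_square_triangle le \<omega>)
    also have "\<dots> = ennreal 2 * (\<integral>\<^sup>+u. ennreal ((V m u \<omega>)\<^sup>2) \<partial>lborel)
     + ennreal 2 * (\<integral>\<^sup>+u. ennreal ((V' m u \<omega>)\<^sup>2) \<partial>lborel)"
      by (subst nn_integral_add) (auto simp: nn_integral_cmult)
    finally show "(\<integral>\<^sup>+u. ennreal ((W m u \<omega>)\<^sup>2) \<partial>lborel) \<le> \<dots>" .
  qed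
qed

text \<open>Made for choosing one approximant per index: tolerance and probability shrink together,
  and any fixed \<open>\<epsilon>\<close> eventually exceeds the tolerance.\<close>

lemma prob_small_diagonal:
  assumes m: "\<And>n. f n \<in> borel_measurable M"
    and f: "\<And>n. prob {\<omega> \<in> space M. ennreal (inverse (real (Suc n))) < f n \<omega>} < inverse (real (Suc n))"
  shows "prob_small f"
  unfolding prob_small_def
proof (intro conjI allI impI m)
  fix \<epsilon> :: real assume \<epsilon>: "0 < \<epsilon>"
  note [measurable] = m
  show "(\<lambda>n. prob {\<omega> \<in> space M. ennreal \<epsilon> < f n \<omega>}) \<longlonglongrightarrow> 0"
  proof (rule tendsto_sandwich[of "\<lambda>_. 0" _ _ "\<lambda>n. inverse (real (Suc n))"])
    have "eventually (\<lambda>n. inverse (real (Suc n)) < \<epsilon>) sequentially"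
      using LIMSEQ_inverse_real_of_nat \<epsilon> by (rule order_tendstoD)
    then show "\<forall>\<^sub>F n in sequentially. prob {\<omega> \<in> space M. ennreal \<epsilon> < f n \<omega>} \<le> inverse (real (Suc n))"
    proof eventually_elim
      fix n assume n: "inverse (real (Suc n)) < \<epsilon>"
      have "prob {\<omega> \<in> space M. ennreal \<epsilon> < f n \<omega>} \<le> prob {\<omega> \<in> space M. ennreal (inverse (real (Suc n))) < f n \<omega>}"
      proof (rule finite_measure_mono)
        have "ennreal (inverse (real (Suc n))) \<le> ennreal \<epsilon>" using n by (intro ennreal_leI) simp
        then show "{\<omega> \<in> space M. ennreal \<epsilon> < f n \<omega>} \<subseteq> {\<omega> \<in> space M. ennreal (inverse (real (Suc n))) < f n \<omega>}"
          by (auto elim: le_less_trans)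
      qed measurable
      then show "prob {\<omega> \<in> space M. ennreal \<epsilon> < f n \<omega>} \<le> inverse (real (Suc n))" using f[of n] by linarith
    qed
  qed (use LIMSEQ_inverse_real_of_nat in auto)
qed

end

section \<open>Ito integrals as limits in probability of elementary integrals\<close>

context standard_brownian_motion
begin

text \<open>The range of integration is part of \<open>V\<close>, and every approximant starts at
  \<open>s\<close> or later. Hence the class remains closed under bounded factors that are known at
  time \<open>s\<close>, which the definition of the Ito integral from time 0 does not
  provide.\<close>

definition ito_lim :: "real \<Rightarrow> (real \<Rightarrow> 'a \<Rightarrow> real) \<Rightarrow> ('a \<Rightarrow> real) \<Rightarrow> bool" where
  "ito_lim s V Z \<longleftrightarrow>
     (\<lambda>(u, \<omega>). V u \<omega>) \<in> borel_measurable (borel \<Otimes>\<^sub>M M) \<and> Z \<in> borel_measurable M \<and>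
     (\<exists>V' Z'. (\<forall>m. elem_int s (V' m) (Z' m)) \<and>
        prob_small (\<lambda>m \<omega>. \<integral>\<^sup>+u. ennreal ((V' m u \<omega> - V u \<omega>)\<^sup>2) \<partial>lborel) \<and>
        prob_small (\<lambda>m \<omega>. ennreal \<bar>Z' m \<omega> - Z \<omega>\<bar>))"

lemma ito_lim_measurable:
  assumes "ito_lim s V Z"
  shows "(\<lambda>(u, \<omega>). V u \<omega>) \<in> borel_measurable (borel \<Otimes>\<^sub>M M)" "Z \<in> borel_measurable M"
  using assms by (auto simp: ito_lim_def)

lemma measurable_diff_param:
  fixes V W :: "real \<Rightarrow> 'a \<Rightarrow> real"
  assumes "(\<lambda>(u, \<omega>). V u \<omega>) \<in> borel_measurable (borel \<Otimes>\<^sub>M M)" "(\<lambda>(u, \<omega>). W u \<omega>) \<in> borel_measurable (borel \<Otimes>\<^sub>M M)"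
  shows "(\<lambda>(u, \<omega>). V u \<omega> - W u \<omega>) \<in> borel_measurable (borel \<Otimes>\<^sub>M M)"
  using borel_measurable_diff[OF assms] by (simp add: case_prod_beta')

lemma measurable_plus_param:
  fixes V W :: "real \<Rightarrow> 'a \<Rightarrow> real"
  assumes "(\<lambda>(u, \<omega>). V u \<omega>) \<in> borel_measurable (borel \<Otimes>\<^sub>M M)" "(\<lambda>(u, \<omega>). W u \<omega>) \<in> borel_measurable (borel \<Otimes>\<^sub>M M)"
  shows "(\<lambda>(u, \<omega>). V u \<omega> + W u \<omega>) \<in> borel_measurable (borel \<Otimes>\<^sub>M M)"
  using borel_measurable_add[OF assms] by (simp add: case_prod_beta')

lemma measurable_indicator_param:
  fixes V :: "real \<Rightarrow> 'a \<Rightarrow> real"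
  assumes "(\<lambda>(u, \<omega>). V u \<omega>) \<in> borel_measurable (borel \<Otimes>\<^sub>M M)" and [measurable]: "A \<in> sets borel"
  shows "(\<lambda>(u, \<omega>). V u \<omega> * indicator A u) \<in> borel_measurable (borel \<Otimes>\<^sub>M M)"
proof -
  have [measurable]: "(\<lambda>p. V (fst p) (snd p)) \<in> borel_measurable (borel \<Otimes>\<^sub>M M)"
    using assms(1) by (simp add: case_prod_beta')
  show ?thesis unfolding case_prod_beta' by measurable
qed

lemma ito_lim_elem:
  assumes "elem_int s V Z" "0 \<le> s"
  shows "ito_lim s V Z"
  unfolding ito_lim_def
proof (intro conjI exI[of _ "\<lambda>_. V"] exI[of _ "\<lambda>_. Z"] allI elem_int_measurable[OF assms] assms(1))
qed (auto intro!: prob_small_AE)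

lemma ito_lim_plus:
  assumes V: "ito_lim s V Z" and W: "ito_lim s W Y" and s: "0 \<le> s"
  shows "ito_lim s (\<lambda>u \<omega>. V u \<omega> + W u \<omega>) (\<lambda>\<omega>. Z \<omega> + Y \<omega>)"
proof -
  note mV = ito_lim_measurable[OF V] and mW = ito_lim_measurable[OF W]
  obtain V' Z' where V': "\<And>m. elem_int s (V' m) (Z' m)"
    "prob_small (\<lambda>m \<omega>. \<integral>\<^sup>+u. ennreal ((V' m u \<omega> - V u \<omega>)\<^sup>2) \<partial>lborel)"
    "prob_small (\<lambda>m \<omega>. ennreal \<bar>Z' m \<omega> - Z \<omega>\<bar>)" using V by (auto simp: ito_lim_def)
  obtain W' Y' where W': "\<And>m. elem_int s (W' m) (Y' m)"
    "prob_small (\<lambda>m \<omega>. \<integral>\<^sup>+u. ennreal ((W' m u \<omega> - W u \<omega>)\<^sup>2) \<partial>lborel)"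
    "prob_small (\<lambda>m \<omega>. ennreal \<bar>Y' m \<omega> - Y \<omega>\<bar>)" using W by (auto simp: ito_lim_def)
  note mV' = elem_int_measurable[OF V'(1) s] and mW' = elem_int_measurable[OF W'(1) s]
  show ?thesis
    unfolding ito_lim_def
  proof (intro conjI exI[of _ "\<lambda>m u \<omega>. V' m u \<omega> + W' m u \<omega>"] exI[of _ "\<lambda>m \<omega>. Z' m \<omega> + Y' m \<omega>"] allI
      elem_int_plus V' W' measurable_plus_param mV mW borel_measurable_add)
    show "prob_small (\<lambda>m \<omega>. \<integral>\<^sup>+u. ennreal ((V' m u \<omega> + W' m u \<omega> - (V u \<omega> + W u \<omega>))\<^sup>2) \<partial>lborel)"
      by (rule prob_small_square_triangle[OF V'(2) W'(2)])
        (intro measurable_diff_param measurable_plus_param mV mW mV' mW' | simp)+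
    show "prob_small (\<lambda>m \<omega>. ennreal \<bar>Z' m \<omega> + Y' m \<omega> - (Z \<omega> + Y \<omega>)\<bar>)"
      by (rule prob_small_mono[OF prob_small_add[OF V'(3) W'(3)]])
        (use mV mW mV' mW' in \<open>auto simp flip: ennreal_plus intro!: ennreal_leI\<close>)
  qed
qed

text \<open>The bound on the factor carries both convergences over, with constant \<open>K^2\<close>
  for the integrands and \<open>K\<close> for the values.\<close>

lemma ito_lim_cmult:
  assumes V: "ito_lim s V Z" and s: "0 \<le> s" and c: "c \<in> borel_measurable (F s)"
    and K: "\<And>\<omega>. \<omega> \<in> space M \<Longrightarrow> \<bar>c \<omega>\<bar> \<le> K"
  shows "ito_lim s (\<lambda>u \<omega>. c \<omega> * V u \<omega>) (\<lambda>\<omega>. c \<omega> * Z \<omega>)"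
proof -
  note mV = ito_lim_measurable[OF V]
  obtain V' Z' where V': "\<And>m. elem_int s (V' m) (Z' m)"
    "prob_small (\<lambda>m \<omega>. \<integral>\<^sup>+u. ennreal ((V' m u \<omega> - V u \<omega>)\<^sup>2) \<partial>lborel)"
    "prob_small (\<lambda>m \<omega>. ennreal \<bar>Z' m \<omega> - Z \<omega>\<bar>)" using V by (auto simp: ito_lim_def)
  note mV' = elem_int_measurable[OF V'(1) s]
  have [measurable]: "(\<lambda>p. V (fst p) (snd p)) \<in> borel_measurable (borel \<Otimes>\<^sub>M M)" "Z \<in> borel_measurable M"
    "\<And>m. (\<lambda>p. V' m (fst p) (snd p)) \<in> borel_measurable (borel \<Otimes>\<^sub>M M)" "\<And>m. Z' m \<in> borel_measurable M"
    "c \<in> borel_measurable M"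
    using mV mV' measurable_F[OF c] by (simp_all add: case_prod_beta')
  obtain \<omega>0 where "\<omega>0 \<in> space M" using not_empty by auto
  then have K0: "0 \<le> K" using K[of \<omega>0] by linarith
  have c2: "(c \<omega>)\<^sup>2 \<le> K\<^sup>2" if "\<omega> \<in> space M" for \<omega>
    using K[OF that] by (metis abs_ge_zero power2_abs power_mono)
  show ?thesis
    unfolding ito_lim_def
  proof (intro conjI exI[of _ "\<lambda>m u \<omega>. c \<omega> * V' m u \<omega>"] exI[of _ "\<lambda>m \<omega>. c \<omega> * Z' m \<omega>"] allI
      elem_int_cmult[OF _ c K] V')
    show "(\<lambda>(u, \<omega>). c \<omega> * V u \<omega>) \<in> borel_measurable (borel \<Otimes>\<^sub>M M)" unfolding case_prod_beta' by measurable
    show "(\<lambda>\<omega>. c \<omega> * Z \<omega>) \<in> borel_measurable M" by measurable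
    show "prob_small (\<lambda>m \<omega>. \<integral>\<^sup>+u. ennreal ((c \<omega> * V' m u \<omega> - c \<omega> * V u \<omega>)\<^sup>2) \<partial>lborel)"
    proof (rule prob_small_mono[OF prob_small_cmult[OF V'(2), of "K\<^sup>2"]])
      show "(\<lambda>\<omega>. \<integral>\<^sup>+u. ennreal ((c \<omega> * V' m u \<omega> - c \<omega> * V u \<omega>)\<^sup>2) \<partial>lborel) \<in> borel_measurable M" for m
        by (rule borel_measurable_nn_integral_param) (simp add: case_prod_beta')
      show "AE \<omega> in M. (\<integral>\<^sup>+u. ennreal ((c \<omega> * V' m u \<omega> - c \<omega> * V u \<omega>)\<^sup>2) \<partial>lborel)
         \<le> ennreal (K\<^sup>2) * (\<integral>\<^sup>+u. ennreal ((V' m u \<omega> - V u \<omega>)\<^sup>2) \<partial>lborel)" for m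
      proof (rule AE_I2)
        fix \<omega> assume \<omega>: "\<omega> \<in> space M"
        have [measurable]: "(\<lambda>u. V' m u \<omega> - V u \<omega>) \<in> borel_measurable borel"
          using measurable_compose[OF measurable_Pair2'[OF \<omega>] measurable_diff_param[OF mV'(1)[of m] mV(1)]] by simp
        have "(\<integral>\<^sup>+u. ennreal ((c \<omega> * V' m u \<omega> - c \<omega> * V u \<omega>)\<^sup>2) \<partial>lborel)
          \<le> (\<integral>\<^sup>+u. ennreal (K\<^sup>2) * ennreal ((V' m u \<omega> - V u \<omega>)\<^sup>2) \<partial>lborel)"
        proof (rule nn_integral_mono)
          fix u
          have "(c \<omega> * V' m u \<omega> - c \<omega> * V u \<omega>)\<^sup>2 = (c \<omega>)\<^sup>2 * (V' m u \<omega> - V u \<omega>)\<^sup>2"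
            by (simp add: power2_eq_square algebra_simps)
          also have "\<dots> \<le> K\<^sup>2 * (V' m u \<omega> - V u \<omega>)\<^sup>2" by (intro mult_right_mono c2 \<omega>) simp
          finally show "ennreal ((c \<omega> * V' m u \<omega> - c \<omega> * V u \<omega>)\<^sup>2) \<le> ennreal (K\<^sup>2) * ennreal ((V' m u \<omega> - V u \<omega>)\<^sup>2)"
            by (subst ennreal_mult[symmetric]) (auto intro!: ennreal_leI)
        qed
        also have "\<dots> = ennreal (K\<^sup>2) * (\<integral>\<^sup>+u. ennreal ((V' m u \<omega> - V u \<omega>)\<^sup>2) \<partial>lborel)"
          by (rule nn_integral_cmult) measurable
        finally show "(\<integral>\<^sup>+u. ennreal ((c \<omega> * V' m u \<omega> - c \<omega> * V u \<omega>)\<^sup>2) \<partial>lborel) \<le> \<dots>" .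
      qed
    qed simp
    show "prob_small (\<lambda>m \<omega>. ennreal \<bar>c \<omega> * Z' m \<omega> - c \<omega> * Z \<omega>\<bar>)"
    proof (rule prob_small_mono[OF prob_small_cmult[OF V'(3) K0]])
      show "AE \<omega> in M. ennreal \<bar>c \<omega> * Z' m \<omega> - c \<omega> * Z \<omega>\<bar> \<le> ennreal K * ennreal \<bar>Z' m \<omega> - Z \<omega>\<bar>" for m
        using K K0 by (intro AE_I2) (auto simp: ennreal_mult[symmetric] abs_mult mult_right_mono
            simp flip: right_diff_distrib intro!: ennreal_leI)
    qed measurable
  qed
qed

lemma ito_lim_mono:
  assumes "ito_lim s V Z" "s' \<le> s"
  shows "ito_lim s' V Z"
  using assms unfolding ito_lim_def by (meson elem_int_mono)

lemma ito_lim_sum: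
  fixes n :: nat
  assumes "\<And>i. i < n \<Longrightarrow> ito_lim s (V i) (Z i)" "0 \<le> s"
  shows "ito_lim s (\<lambda>u \<omega>. \<Sum>i<n. V i u \<omega>) (\<lambda>\<omega>. \<Sum>i<n. Z i \<omega>)"
  using assms(1)
proof (induction n)
  case 0
  show ?case using ito_lim_elem[OF elem_zero assms(2)] by simp
next
  case (Suc n)
  then show ?case using ito_lim_plus[OF _ _ assms(2)] by simp
qed

text \<open>Continuity of the integral in probability. For each \<open>n\<close> an elementary
  approximant is chosen within \<open>1 / (n + 1)\<close> in integrand and in value; its integrand
  is then small as well, and the tail estimate for elementary integrals applies.\<close>

lemma ito_lim_small:
  assumes V: "\<And>n. ito_lim s (V n) (Z n)" and s: "0 \<le> s"
    and small: "prob_small (\<lambda>n \<omega>. \<integral>\<^sup>+u. ennreal ((V n u \<omega>)\<^sup>2) \<partial>lborel)"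
  shows "prob_small (\<lambda>n \<omega>. ennreal \<bar>Z n \<omega>\<bar>)"
proof -
  note mV = ito_lim_measurable[OF V]
  have "\<exists>W Y. elem_int s W Y \<and>
      prob {\<omega> \<in> space M. ennreal (inverse (real (Suc n))) < (\<integral>\<^sup>+u. ennreal ((W u \<omega> - V n u \<omega>)\<^sup>2) \<partial>lborel)} < inverse (real (Suc n)) \<and>
      prob {\<omega> \<in> space M. ennreal (inverse (real (Suc n))) < ennreal \<bar>Y \<omega> - Z n \<omega>\<bar>} < inverse (real (Suc n))" for n
  proof -
    obtain V' Z' where V': "\<And>m. elem_int s (V' m) (Z' m)"
      "prob_small (\<lambda>m \<omega>. \<integral>\<^sup>+u. ennreal ((V' m u \<omega> - V n u \<omega>)\<^sup>2) \<partial>lborel)"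
      "prob_small (\<lambda>m \<omega>. ennreal \<bar>Z' m \<omega> - Z n \<omega>\<bar>)" using V[of n] by (auto simp: ito_lim_def)
    have pos: "0 < inverse (real (Suc n))" by simp
    have "eventually (\<lambda>m. prob {\<omega> \<in> space M. ennreal (inverse (real (Suc n))) < (\<integral>\<^sup>+u. ennreal ((V' m u \<omega> - V n u \<omega>)\<^sup>2) \<partial>lborel)} < inverse (real (Suc n))
       \<and> prob {\<omega> \<in> space M. ennreal (inverse (real (Suc n))) < ennreal \<bar>Z' m \<omega> - Z n \<omega>\<bar>} < inverse (real (Suc n))) sequentially"
      by (intro eventually_conj order_tendstoD(2)[OF prob_smallD[OF V'(2) pos] pos]
          order_tendstoD(2)[OF prob_smallD[OF V'(3) pos] pos])
    then show ?thesis using V'(1) by (auto simp: eventually_sequentially)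
  qed
  then have "\<forall>n. \<exists>p. elem_int s (fst p) (snd p) \<and>
      prob {\<omega> \<in> space M. ennreal (inverse (real (Suc n))) < (\<integral>\<^sup>+u. ennreal ((fst p u \<omega> - V n u \<omega>)\<^sup>2) \<partial>lborel)} < inverse (real (Suc n)) \<and>
      prob {\<omega> \<in> space M. ennreal (inverse (real (Suc n))) < ennreal \<bar>snd p \<omega> - Z n \<omega>\<bar>} < inverse (real (Suc n))"
    by (simp only: split_paired_Ex fst_conv snd_conv) blast
  from choice[OF this] obtain p where p: "\<forall>n. elem_int s (fst (p n)) (snd (p n)) \<and>
      prob {\<omega> \<in> space M. ennreal (inverse (real (Suc n))) < (\<integral>\<^sup>+u. ennreal ((fst (p n) u \<omega> - V n u \<omega>)\<^sup>2) \<partial>lborel)} < inverse (real (Suc n)) \<and>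
      prob {\<omega> \<in> space M. ennreal (inverse (real (Suc n))) < ennreal \<bar>snd (p n) \<omega> - Z n \<omega>\<bar>} < inverse (real (Suc n))"
    by (rule exE)
  define W Y where "W n = fst (p n)" and "Y n = snd (p n)" for n
  have W: "\<And>n. elem_int s (W n) (Y n)"
    "\<And>n. prob {\<omega> \<in> space M. ennreal (inverse (real (Suc n))) < (\<integral>\<^sup>+u. ennreal ((W n u \<omega> - V n u \<omega>)\<^sup>2) \<partial>lborel)} < inverse (real (Suc n))"
    "\<And>n. prob {\<omega> \<in> space M. ennreal (inverse (real (Suc n))) < ennreal \<bar>Y n \<omega> - Z n \<omega>\<bar>} < inverse (real (Suc n))"
    using p unfolding W_def Y_def by blast+
  note mW = elem_int_measurable[OF W(1) s]
  have 1: "prob_small (\<lambda>n \<omega>. \<integral>\<^sup>+u. ennreal ((W n u \<omega> - V n u \<omega>)\<^sup>2) \<partial>lborel)"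
    by (intro prob_small_diagonal W borel_measurable_nn_integral_param measurable_diff_param mW mV)
  have 2: "prob_small (\<lambda>n \<omega>. ennreal \<bar>Y n \<omega> - Z n \<omega>\<bar>)"
    by (rule prob_small_diagonal) (use mW(2) mV(2) W(3) in auto)
  have "prob_small (\<lambda>n \<omega>. \<integral>\<^sup>+u. ennreal ((W n u \<omega>)\<^sup>2) \<partial>lborel)"
    by (rule prob_small_square_triangle[OF 1 small]) (intro measurable_diff_param mW mV | simp)+
  then have 3: "prob_small (\<lambda>n \<omega>. ennreal \<bar>Y n \<omega>\<bar>)" by (rule elem_int_small[OF W(1) s])
  show ?thesis
    by (rule prob_small_mono[OF prob_small_add[OF 2 3]])
      (use mV in \<open>auto simp flip: ennreal_plus intro!: ennreal_leI\<close>)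
qed

text \<open>The approximating sequences of \<open>Z\<close> and \<open>Z0\<close> are unrelated.
  Splitting that of \<open>Z\<close> at \<open>s\<close> gives first parts whose integrands have the
  same limit as those of \<open>Z0\<close>; by the tail estimate their values differ by a small
  quantity, so the second parts alone approximate \<open>Z - Z0\<close>.\<close>

lemma ito_lim_increment:
  assumes V: "ito_lim 0 V Z" and V0: "ito_lim 0 (\<lambda>u \<omega>. V u \<omega> * indicator {..s} u) Z0" and s: "0 \<le> s"
  shows "ito_lim s (\<lambda>u \<omega>. V u \<omega> * indicator {s<..} u) (\<lambda>\<omega>. Z \<omega> - Z0 \<omega>)"
proof -
  note mV = ito_lim_measurable[OF V] and mV0 = ito_lim_measurable[OF V0]
  obtain V' Z' where V': "\<And>m. elem_int 0 (V' m) (Z' m)"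
    "prob_small (\<lambda>m \<omega>. \<integral>\<^sup>+u. ennreal ((V' m u \<omega> - V u \<omega>)\<^sup>2) \<partial>lborel)"
    "prob_small (\<lambda>m \<omega>. ennreal \<bar>Z' m \<omega> - Z \<omega>\<bar>)" using V by (auto simp: ito_lim_def)
  obtain W Y where W: "\<And>m. elem_int 0 (W m) (Y m)"
    "prob_small (\<lambda>m \<omega>. \<integral>\<^sup>+u. ennreal ((W m u \<omega> - V u \<omega> * indicator {..s} u)\<^sup>2) \<partial>lborel)"
    "prob_small (\<lambda>m \<omega>. ennreal \<bar>Y m \<omega> - Z0 \<omega>\<bar>)" using V0 by (auto simp: ito_lim_def)
  note mV' = elem_int_measurable[OF V'(1) order_refl] and mW = elem_int_measurable[OF W(1) order_refl]
  have "\<forall>m. \<exists>p. elem_int 0 (\<lambda>u \<omega>. V' m u \<omega> * indicator {..s} u) (fst p) \<and>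
    elem_int s (\<lambda>u \<omega>. V' m u \<omega> * indicator {s<..} u) (snd p) \<and> (\<forall>\<omega>. Z' m \<omega> = fst p \<omega> + snd p \<omega>)"
  proof
    fix m
    obtain Z1 Z2 where "elem_int 0 (\<lambda>u \<omega>. V' m u \<omega> * indicator {..s} u) Z1"
      "elem_int s (\<lambda>u \<omega>. V' m u \<omega> * indicator {s<..} u) Z2" "\<And>\<omega>. Z' m \<omega> = Z1 \<omega> + Z2 \<omega>"
      by (rule elem_int_split[OF V'(1)[of m] s]) (rule that)
    then show "\<exists>p. elem_int 0 (\<lambda>u \<omega>. V' m u \<omega> * indicator {..s} u) (fst p) \<and>
      elem_int s (\<lambda>u \<omega>. V' m u \<omega> * indicator {s<..} u) (snd p) \<and> (\<forall>\<omega>. Z' m \<omega> = fst p \<omega> + snd p \<omega>)"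
      by (intro exI[of _ "(Z1, Z2)"]) simp
  qed
  from choice[OF this] obtain p where p: "\<forall>m. elem_int 0 (\<lambda>u \<omega>. V' m u \<omega> * indicator {..s} u) (fst (p m)) \<and>
    elem_int s (\<lambda>u \<omega>. V' m u \<omega> * indicator {s<..} u) (snd (p m)) \<and> (\<forall>\<omega>. Z' m \<omega> = fst (p m) \<omega> + snd (p m) \<omega>)"
    by (rule exE)
  define Z1 Z2 where "Z1 m = fst (p m)" and "Z2 m = snd (p m)" for m
  have Z1: "elem_int 0 (\<lambda>u \<omega>. V' m u \<omega> * indicator {..s} u) (Z1 m)"
    and Z2: "elem_int s (\<lambda>u \<omega>. V' m u \<omega> * indicator {s<..} u) (Z2 m)"
    and Z: "Z' m \<omega> = Z1 m \<omega> + Z2 m \<omega>" for m \<omega>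
    using p[rule_format, of m] unfolding Z1_def Z2_def by simp_all
  note mZ1 = elem_int_measurable[OF Z1 order_refl] and mZ2 = elem_int_measurable[OF Z2 s]
  have "prob_small (\<lambda>m \<omega>. \<integral>\<^sup>+u. ennreal ((V' m u \<omega> * indicator {..s} u - W m u \<omega>)\<^sup>2) \<partial>lborel)"
    by (rule prob_small_square_triangle[OF V'(2) W(2)])
      (intro measurable_diff_param mV mV0 mV' mW mZ1 | auto simp: indicator_def)+
  from elem_int_small[OF elem_int_minus[OF Z1 W(1)] order_refl this]
  have 1: "prob_small (\<lambda>m \<omega>. ennreal \<bar>Z1 m \<omega> - Y m \<omega>\<bar>)" .
  show ?thesis
    unfolding ito_lim_def
  proof (intro conjI exI[of _ "\<lambda>m u \<omega>. V' m u \<omega> * indicator {s<..} u"] exI[of _ Z2] allI Z2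
      measurable_indicator_param mV borel_measurable_diff mV0)
    show "prob_small (\<lambda>m \<omega>. \<integral>\<^sup>+u. ennreal ((V' m u \<omega> * indicator {s<..} u - V u \<omega> * indicator {s<..} u)\<^sup>2) \<partial>lborel)"
      by (rule prob_small_square_triangle[OF V'(2) V'(2)])
        (intro measurable_diff_param measurable_indicator_param mV mV' | auto simp: indicator_def)+
    show "prob_small (\<lambda>m \<omega>. ennreal \<bar>Z2 m \<omega> - (Z \<omega> - Z0 \<omega>)\<bar>)"
      by (rule prob_small_mono[OF prob_small_add[OF prob_small_add[OF V'(3) 1] W(3)]])
        (use mV(2) mV0(2) mZ2(2) in \<open>auto simp: Z simp flip: ennreal_plus intro!: ennreal_leI\<close>)
  qed simp
qed

text \<open>Progressive measurability speaks of \<open>{0..t}\<close> and \<open>F t\<close>;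
  clamping time to this interval extends it to joint measurability on the whole line. Simple
  processes vanish at negative times, so cutting them at \<open>t\<close> alone restricts them to
  \<open>{0..t}\<close>.\<close>

lemma has_ito_integral_imp_ito_lim:
  assumes I: "has_ito_integral M F B H t Z" and t: "0 \<le> t"
  shows "ito_lim 0 (\<lambda>u \<omega>. H u \<omega> * indicator {0..t} u) Z"
proof -
  have prog: "(\<lambda>(u, \<omega>). H u \<omega>) \<in> borel_measurable (restrict_space borel {0..t} \<Otimes>\<^sub>M F t)"
    and Z [measurable]: "Z \<in> borel_measurable M"
    using I t unfolding has_ito_integral_def progressively_measurable_upto_def by auto
  obtain S where S: "\<And>n. simple_predictable M F (S n)"
    and S1: "\<And>\<epsilon>. \<epsilon> > 0 \<Longrightarrow> (\<lambda>n. prob {\<omega>\<in>space M.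
            (\<integral>\<^sup>+u\<in>{0..t}. ennreal ((simple_value (S n) u \<omega> - H u \<omega>)\<^sup>2) \<partial>lborel) > ennreal \<epsilon>}) \<longlonglongrightarrow> 0"
    and S2: "\<And>\<epsilon>. \<epsilon> > 0 \<Longrightarrow> (\<lambda>n. prob {\<omega>\<in>space M. \<bar>simple_integral B (S n) t \<omega> - Z \<omega>\<bar> > \<epsilon>}) \<longlonglongrightarrow> 0"
    using I unfolding has_ito_integral_def by blast
  have "(\<lambda>p. (max 0 (min t (fst p)), snd p)) \<in> borel \<Otimes>\<^sub>M M \<rightarrow>\<^sub>M restrict_space borel {0..t} \<Otimes>\<^sub>M F t"
    using t by (intro measurable_Pair measurable_restrict_space2
        measurable_compose[OF measurable_snd measurable_F[OF measurable_ident_sets[OF refl]]]) auto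
  from measurable_compose[OF this prog]
  have [measurable]: "(\<lambda>p. H (max 0 (min t (fst p))) (snd p)) \<in> borel_measurable (borel \<Otimes>\<^sub>M M)" by simp
  have "(\<lambda>(u, \<omega>). H u \<omega> * indicator {0..t} u) = (\<lambda>p. H (max 0 (min t (fst p))) (snd p) * indicator {0..t} (fst p))"
    by (auto simp: fun_eq_iff indicator_def)
  then have mH: "(\<lambda>(u, \<omega>). H u \<omega> * indicator {0..t} u) \<in> borel_measurable (borel \<Otimes>\<^sub>M M)" by simp
  define V where "V n u \<omega> = simple_value (S n) u \<omega> * indicator {..t} u" for n u \<omega>
  have V: "elem_int 0 (V n) (simple_integral B (S n) t)" for n
    unfolding V_def[abs_def] by (rule elem_int_simple[OF S t])
  note mV = elem_int_measurable[OF V order_refl]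
  have knot: "0 \<le> knot (S n) i" if "i \<le> steps (S n)" for n i
    using that
  proof (induction i)
    case 0
    then show ?case using S[of n] by (simp add: simple_predictable_def)
  next
    case (Suc i)
    then have "knot (S n) i \<le> knot (S n) (Suc i)" using S[of n] by (simp add: simple_predictable_def)
    then show ?case using Suc by simp
  qed
  have neg: "simple_value (S n) u \<omega> = 0" if "u < 0" for n u \<omega>
    unfolding simple_value_def
  proof (intro sum.neutral ballI)
    fix i assume "i \<in> {..<steps (S n)}"
    then show "level (S n) i \<omega> * indicator {knot (S n) i<..knot (S n) (Suc i)} u = 0"
      using knot[of i n] that by (auto simp: indicator_def)
  qed
  have eq: "(\<integral>\<^sup>+u. ennreal ((V n u \<omega> - H u \<omega> * indicator {0..t} u)\<^sup>2) \<partial>lborel)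
     = (\<integral>\<^sup>+u\<in>{0..t}. ennreal ((simple_value (S n) u \<omega> - H u \<omega>)\<^sup>2) \<partial>lborel)" for n \<omega>
    unfolding V_def by (intro nn_integral_cong) (auto simp: indicator_def neg)
  show ?thesis
    unfolding ito_lim_def
  proof (intro conjI exI[of _ V] exI[of _ "\<lambda>n. simple_integral B (S n) t"] allI V mH Z)
    show "prob_small (\<lambda>m \<omega>. \<integral>\<^sup>+u. ennreal ((V m u \<omega> - H u \<omega> * indicator {0..t} u)\<^sup>2) \<partial>lborel)"
      unfolding prob_small_def
      by (intro conjI allI borel_measurable_nn_integral_param measurable_diff_param mV mH) (use S1 eq in simp)
    show "prob_small (\<lambda>m \<omega>. ennreal \<bar>simple_integral B (S m) t \<omega> - Z \<omega>\<bar>)"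
      unfolding prob_small_def using mV(2) S2 by (simp add: ennreal_less_iff)
  qed
qed

end

section \<open>The Laplace transform of the bridge\<close>

context prob_space
begin

text \<open>The second moments act as uniform integrability. Where \<open>A\<close> and
  \<open>D\<close> are within \<open>\<epsilon>\<close>, the exponentials differ by at most
  \<open>c * (exp \<epsilon> - 1)\<close>; elsewhere, on an event of small probability,
  \<open>exp A \<le> exp (2 * A) / T + T\<close> and \<open>exp D \<le> c\<close>. The constants are
  set so that each of the three contributions to the expectation is at most
  \<open>r / 4\<close>.\<close>

lemma expectation_exp_limit:
  assumes mA [measurable]: "\<And>n. A n \<in> borel_measurable M" and mD [measurable]: "\<And>n. D n \<in> borel_measurable M"
    and small: "prob_small (\<lambda>n \<omega>. ennreal \<bar>A n \<omega> - D n \<omega>\<bar>)"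
    and one: "\<And>n. (\<integral>\<^sup>+\<omega>. ennreal (exp (A n \<omega>)) \<partial>M) = 1"
    and sq: "\<And>n. (\<integral>\<^sup>+\<omega>. ennreal (exp (2 * A n \<omega>)) \<partial>M) \<le> ennreal Q"
    and bd: "\<And>n. AE \<omega> in M. exp (D n \<omega>) \<le> c" and c: "0 < c" and Q: "0 < Q"
  shows "(\<lambda>n. expectation (\<lambda>\<omega>. exp (D n \<omega>))) \<longlonglongrightarrow> 1"
proof (rule LIMSEQ_I)
  fix r :: real assume r: "0 < r"
  define \<epsilon> where "\<epsilon> = ln (1 + r / (4 * c))"
  have \<epsilon>: "0 < \<epsilon>" "c * (exp \<epsilon> - 1) = r / 4" using r c by (auto simp: \<epsilon>_def add_pos_pos)
  define T where "T = 4 * Q / r"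
  have T: "0 < T" "Q / T = r / 4" using r Q by (auto simp: T_def)
  have intA: "integrable M (\<lambda>\<omega>. exp (A n \<omega>))" and EA: "expectation (\<lambda>\<omega>. exp (A n \<omega>)) = 1" for n
    using one[of n] by (auto intro!: integrableI_nonneg simp: integral_eq_nn_integral)
  have intA2: "integrable M (\<lambda>\<omega>. exp (2 * A n \<omega>))" for n
    using sq[of n] by (auto intro!: integrableI_nonneg elim: le_less_trans)
  have EA2: "expectation (\<lambda>\<omega>. exp (2 * A n \<omega>)) \<le> Q" for n
    using sq[of n] Q by (auto simp: integral_eq_nn_integral intro!: enn2real_leI)
  have intD: "integrable M (\<lambda>\<omega>. exp (D n \<omega>))" for n
    by (rule integrable_const_bound[of _ c]) (use bd[of n] in auto)
  obtain N where N: "\<And>n. n \<ge> N \<Longrightarrow> prob {\<omega> \<in> space M. ennreal \<epsilon> < ennreal \<bar>A n \<omega> - D n \<omega>\<bar>} < r / (4 * (T + c))"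
    using LIMSEQ_D[OF prob_smallD[OF small \<epsilon>(1)], of "r / (4 * (T + c))"] r T c by auto
  show "\<exists>N. \<forall>n\<ge>N. norm (expectation (\<lambda>\<omega>. exp (D n \<omega>)) - 1) < r"
  proof (intro exI[of _ N] allI impI)
    fix n assume n: "N \<le> n"
    let ?E = "{\<omega> \<in> space M. ennreal \<epsilon> < ennreal \<bar>A n \<omega> - D n \<omega>\<bar>}"
    have intE: "integrable M (indicator ?E :: 'a \<Rightarrow> real)"
      by (rule integrable_const_bound[of _ 1]) (auto simp: indicator_def)
    have "AE \<omega> in M. \<bar>exp (D n \<omega>) - exp (A n \<omega>)\<bar>
      \<le> c * (exp \<epsilon> - 1) + exp (2 * A n \<omega>) / T + (T + c) * indicator ?E \<omega>"
      using bd[of n] AE_space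
    proof eventually_elim
      fix \<omega> assume D: "exp (D n \<omega>) \<le> c" and \<omega>: "\<omega> \<in> space M"
      show "\<bar>exp (D n \<omega>) - exp (A n \<omega>)\<bar> \<le> c * (exp \<epsilon> - 1) + exp (2 * A n \<omega>) / T + (T + c) * indicator ?E \<omega>"
      proof (cases "\<bar>A n \<omega> - D n \<omega>\<bar> \<le> \<epsilon>")
        case True
        define d where "d = A n \<omega> - D n \<omega>"
        have "\<bar>exp d - 1\<bar> \<le> exp \<bar>d\<bar> - 1"
        proof (cases "0 \<le> d")
          case False
          have "1 + 1 \<le> exp d + exp (- d)"
            using exp_ge_add_one_self[of d] exp_ge_add_one_self[of "- d"] by linarith
          then show ?thesis using False by simp
        qed simp
        also have "\<dots> \<le> exp \<epsilon> - 1" using True by (simp add: d_def)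
        finally have "exp (D n \<omega>) * \<bar>exp d - 1\<bar> \<le> c * (exp \<epsilon> - 1)"
          using D c by (intro mult_mono) auto
        moreover have "\<bar>exp (D n \<omega>) - exp (A n \<omega>)\<bar> = exp (D n \<omega>) * \<bar>exp d - 1\<bar>"
        proof -
          have "exp (A n \<omega>) = exp (D n \<omega>) * exp d" by (simp add: d_def flip: exp_add)
          then have "exp (D n \<omega>) - exp (A n \<omega>) = exp (D n \<omega>) * (1 - exp d)" by (simp add: algebra_simps)
          then show ?thesis by (simp add: abs_mult abs_minus_commute)
        qed
        moreover have "0 \<le> exp (2 * A n \<omega>) / T" "0 \<le> (T + c) * indicator ?E \<omega>"
          using T c by (auto intro!: mult_nonneg_nonneg)
        ultimately show ?thesis by linarith
      next
        case False
        then have "\<omega> \<in> ?E" using \<omega> \<epsilon> by (simp add: ennreal_less_iff)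
        moreover have "exp (A n \<omega>) \<le> exp (2 * A n \<omega>) / T + T"
        proof -
          have e: "exp (2 * A n \<omega>) = exp (A n \<omega>) * exp (A n \<omega>)" by (simp flip: exp_add)
          have "0 \<le> (exp (A n \<omega>) - T)\<^sup>2 + exp (A n \<omega>) * T" using T by simp
          then have "exp (A n \<omega>) * T \<le> exp (A n \<omega>) * exp (A n \<omega>) + T * T"
            by (simp add: power2_eq_square algebra_simps)
          then show ?thesis unfolding e using T by (simp add: field_simps)
        qed
        moreover have "0 \<le> c * (exp \<epsilon> - 1)" using c \<epsilon> by simp
        moreover have "\<bar>exp (D n \<omega>) - exp (A n \<omega>)\<bar> \<le> exp (D n \<omega>) + exp (A n \<omega>)"
          using exp_gt_zero[of "D n \<omega>"] exp_gt_zero[of "A n \<omega>"] by linarith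
        ultimately show ?thesis using D by simp
      qed
    qed
    then have "expectation (\<lambda>\<omega>. \<bar>exp (D n \<omega>) - exp (A n \<omega>)\<bar>)
      \<le> expectation (\<lambda>\<omega>. c * (exp \<epsilon> - 1) + exp (2 * A n \<omega>) / T + (T + c) * indicator ?E \<omega>)"
      by (intro integral_mono_AE) (auto intro!: intA intD intA2 intE integrable_mult_right Bochner_Integration.integrable_add
          integrable_divide Bochner_Integration.integrable_diff)
    also have "\<dots> = c * (exp \<epsilon> - 1) + expectation (\<lambda>\<omega>. exp (2 * A n \<omega>)) / T + (T + c) * prob ?E"
      using intA2[of n] intE by (subst Bochner_Integration.integral_add; (subst Bochner_Integration.integral_add)?)
        (auto simp: prob_space)
    also have "\<dots> < r / 4 + r / 4 + r / 4"
    proof -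
      have "expectation (\<lambda>\<omega>. exp (2 * A n \<omega>)) / T \<le> Q / T"
        using EA2[of n] T by (intro divide_right_mono) auto
      moreover have "(T + c) * prob ?E < (T + c) * (r / (4 * (T + c)))"
        using N[OF n] T c by (intro mult_strict_left_mono) auto
      moreover have "(T + c) * (r / (4 * (T + c))) = r / 4" using T c by (simp add: field_simps)
      ultimately show ?thesis using \<epsilon> T by linarith
    qed
    finally have "expectation (\<lambda>\<omega>. \<bar>exp (D n \<omega>) - exp (A n \<omega>)\<bar>) < r" using r by linarith
    moreover have "\<bar>expectation (\<lambda>\<omega>. exp (D n \<omega>) - exp (A n \<omega>))\<bar> \<le> expectation (\<lambda>\<omega>. \<bar>exp (D n \<omega>) - exp (A n \<omega>)\<bar>)"
      by (rule integral_abs_bound)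
    moreover have "expectation (\<lambda>\<omega>. exp (D n \<omega>) - exp (A n \<omega>)) = expectation (\<lambda>\<omega>. exp (D n \<omega>)) - 1"
      using intA intD EA by (subst Bochner_Integration.integral_diff) auto
    ultimately show "norm (expectation (\<lambda>\<omega>. exp (D n \<omega>)) - 1) < r" by simp
  qed
qed

end

section \<open>Uniform grids\<close>

definition grid :: "real \<Rightarrow> nat \<Rightarrow> nat \<Rightarrow> real" where
  "grid t n i = t * real i / real (Suc n)"

lemma grid_0 [simp]: "grid t n 0 = 0" and grid_last [simp]: "grid t n (Suc n) = t"
  by (simp_all add: grid_def del: of_nat_Suc)

lemma grid_mono: "0 \<le> t \<Longrightarrow> i \<le> j \<Longrightarrow> grid t n i \<le> grid t n j"
  unfolding grid_def by (intro divide_right_mono mult_left_mono) auto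

lemma grid_in: "0 \<le> t \<Longrightarrow> i \<le> Suc n \<Longrightarrow> grid t n i \<in> {0..t}"
  using grid_mono[of t 0 i n] grid_mono[of t i "Suc n" n] by simp

lemma grid_step: "grid t n (Suc i) - grid t n i = t / real (Suc n)"
proof -
  have "t * real (Suc i) - t * real i = t" by (simp add: algebra_simps)
  then show ?thesis unfolding grid_def diff_divide_distrib[symmetric] by simp
qed

text \<open>Here \<open>h\<close> is an error term on a cell, depending on the two endpoints and on
  a time in between. Cells of a fine grid lie near the diagonal, where \<open>h\<close> vanishes, so
  uniform continuity on the compact cube gives the bound for all cells at once.\<close>

lemma grid_uniform:
  fixes h :: "real \<Rightarrow> real \<Rightarrow> real \<Rightarrow> real"
  assumes t: "0 \<le> t"
    and cont: "continuous_on ({0..t} \<times> {0..t} \<times> {0..t}) (\<lambda>(x, y, u). h x y u)"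
    and diag: "\<And>u. u \<in> {0..t} \<Longrightarrow> h u u u = 0" and \<epsilon>: "0 < \<epsilon>"
  shows "\<forall>\<^sub>F n in sequentially. \<forall>i\<le>n. \<forall>u\<in>{grid t n i..grid t n (Suc i)}.
    \<bar>h (grid t n i) (grid t n (Suc i)) u\<bar> \<le> \<epsilon>"
proof -
  have "uniformly_continuous_on ({0..t} \<times> {0..t} \<times> {0..t}) (\<lambda>(x, y, u). h x y u)"
    using cont by (intro compact_uniformly_continuous compact_Times) auto
  then obtain d where d: "0 < d" and uc: "\<And>p q. p \<in> {0..t} \<times> {0..t} \<times> {0..t} \<Longrightarrow> q \<in> {0..t} \<times> {0..t} \<times> {0..t} \<Longrightarrow>
    dist q p < d \<Longrightarrow> dist ((\<lambda>(x, y, u). h x y u) q) ((\<lambda>(x, y, u). h x y u) p) < \<epsilon>"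
    using \<epsilon> unfolding uniformly_continuous_on_def by metis
  have "(\<lambda>n. t * inverse (real (Suc n))) \<longlonglongrightarrow> t * 0"
    by (intro tendsto_intros LIMSEQ_inverse_real_of_nat)
  then have "\<forall>\<^sub>F n in sequentially. t * inverse (real (Suc n)) < d / 3"
    using d by (intro order_tendstoD) auto
  then show ?thesis
  proof eventually_elim
    fix n assume "t * inverse (real (Suc n)) < d / 3"
    then have n: "t / real (Suc n) < d / 3" by (simp add: field_simps)
    show "\<forall>i\<le>n. \<forall>u\<in>{grid t n i..grid t n (Suc i)}. \<bar>h (grid t n i) (grid t n (Suc i)) u\<bar> \<le> \<epsilon>"
    proof (intro allI impI ballI)
      fix i u assume i: "i \<le> n" and u: "u \<in> {grid t n i..grid t n (Suc i)}"
      let ?x = "grid t n i" and ?y = "grid t n (Suc i)"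
      have in': "?x \<in> {0..t}" "?y \<in> {0..t}" using grid_in[OF t, of i n] grid_in[OF t, of "Suc i" n] i by auto
      with u have "u \<in> {0..t}" by auto
      have xy: "?x \<le> ?y" "?y - ?x < d / 3" using n t by (auto simp: grid_step grid_mono)
      have "dist (?x, ?y, u) (u, u, u) \<le> dist ?x u + dist ?y u"
        by (simp add: dist_Pair_Pair sqrt_sum_squares_le_sum)
      also have "\<dots> < d" using xy u by (auto simp: dist_real_def)
      finally have "dist (h ?x ?y u) (h u u u) < \<epsilon>"
        using uc[of "(u, u, u)" "(?x, ?y, u)"] in' \<open>u \<in> {0..t}\<close> by simp
      then show "\<bar>h ?x ?y u\<bar> \<le> \<epsilon>" using diag[OF \<open>u \<in> {0..t}\<close>] by (simp add: dist_real_def)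
    qed
  qed
qed

lemma LBINT_eq_integral:
  fixes f :: "real \<Rightarrow> real"
  assumes "continuous_on {a..b} f"
  shows "(LBINT u:{a..b}. f u) = integral {a..b} f"
  using set_borel_integral_eq_integral(2)[OF borel_integrable_atLeastAtMost'[OF assms]] .

text \<open>The setting isolates what the argument uses: a time \<open>t < 1\<close>, so that
  \<open>1 / (1 - u)\<close> is continuous on \<open>{0..t}\<close>, and a nonnegative solution
  \<open>a\<close> of the Riccati equation. Each \<open>I r\<close> is a version for its own
  \<open>r\<close>; no relation between different times is assumed.\<close>

locale riccati_bridge = standard_brownian_motion M F B
  for M :: "'a measure" and F :: "real \<Rightarrow> 'a measure" and B :: "real \<Rightarrow> 'a \<Rightarrow> real" +
  fixes X I :: "real \<Rightarrow> 'a \<Rightarrow> real" and a :: "real \<Rightarrow> real" and x \<delta> \<gamma> t :: real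
  assumes \<delta>: "0 \<le> \<delta>" and \<gamma>: "0 \<le> \<gamma>" and t: "0 \<le> t" "t < 1"
    and X_adapted: "r \<in> {0..t} \<Longrightarrow> X r \<in> borel_measurable (F r)"
    and X_cont: "\<omega> \<in> space M \<Longrightarrow> continuous_on {0..t} (\<lambda>r. X r \<omega>)"
    and X_nonneg: "\<omega> \<in> space M \<Longrightarrow> r \<in> {0..t} \<Longrightarrow> 0 \<le> X r \<omega>"
    and ito: "r \<in> {0..t} \<Longrightarrow> has_ito_integral M F B (\<lambda>s \<omega>. sqrt (X s \<omega>)) r (I r)"
    and sde: "r \<in> {0..t} \<Longrightarrow>
      AE \<omega> in M. X r \<omega> = x + 2 * I r \<omega> + (LBINT s:{0..r}. \<delta> - 2 * X s \<omega> / (1 - s))"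
    and a_deriv: "u \<in> {0..t} \<Longrightarrow> (a has_real_derivative 2 * (a u)\<^sup>2 + 2 * a u / (1 - u) - \<gamma>) (at u)"
    and a_nonneg: "u \<in> {0..t} \<Longrightarrow> 0 \<le> a u"
begin

lemma a_cont: "continuous_on {0..t} a"
  using a_deriv by (meson DERIV_isCont continuous_at_imp_continuous_on)

lemma ito_lim_I:
  assumes "r \<in> {0..t}"
  shows "ito_lim 0 (\<lambda>u \<omega>. sqrt (X u \<omega>) * indicator {0..r} u) (I r)"
  using has_ito_integral_imp_ito_lim[OF ito[OF assms]] assms by simp

lemma X_measurable: "r \<in> {0..t} \<Longrightarrow> X r \<in> borel_measurable M"
  using measurable_F[OF X_adapted] .

text \<open>The two versions belong to one integrand cut at different times, so additivity in time
  links them.\<close>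

lemma ito_increment:
  assumes "0 \<le> r" "r \<le> r'" "r' \<le> t"
  shows "ito_lim r (\<lambda>u \<omega>. sqrt (X u \<omega>) * indicator {r<..r'} u) (\<lambda>\<omega>. I r' \<omega> - I r \<omega>)"
proof -
  have 1: "(\<lambda>u \<omega>. sqrt (X u \<omega>) * indicator {0..r'} u * indicator {..r} u)
    = (\<lambda>u \<omega>. sqrt (X u \<omega>) * indicator {0..r} u)"
    using assms by (auto simp: fun_eq_iff indicator_def)
  have 2: "(\<lambda>u \<omega>. sqrt (X u \<omega>) * indicator {0..r'} u * indicator {r<..} u)
    = (\<lambda>u \<omega>. sqrt (X u \<omega>) * indicator {r<..r'} u)"
    using assms by (auto simp: fun_eq_iff indicator_def)
  have "ito_lim r (\<lambda>u \<omega>. sqrt (X u \<omega>) * indicator {0..r'} u * indicator {r<..} u) (\<lambda>\<omega>. I r' \<omega> - I r \<omega>)"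
    by (rule ito_lim_increment) (unfold 1, use assms in \<open>auto intro!: ito_lim_I\<close>)
  then show ?thesis unfolding 2 .
qed

text \<open>The integrand of \<open>I 0\<close> is 0 off a single point, so continuity of the
  integral in probability forces \<open>I 0 = 0\<close> almost surely.\<close>

lemma X_start: "AE \<omega> in M. X 0 \<omega> = x"
proof -
  have "(\<integral>\<^sup>+u. ennreal ((sqrt (X u \<omega>) * indicator {0..0} u)\<^sup>2) \<partial>lborel) = 0" for \<omega>
  proof -
    have "(\<integral>\<^sup>+u. ennreal ((sqrt (X u \<omega>) * indicator {0..0} u)\<^sup>2) \<partial>lborel) = (\<integral>\<^sup>+(u::real). 0 \<partial>lborel)"
      by (rule nn_integral_cong_AE) (use AE_lborel_singleton[of "0::real"] in \<open>eventually_elim, simp\<close>)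
    then show ?thesis by simp
  qed
  then have "prob_small (\<lambda>n \<omega>. \<integral>\<^sup>+u. ennreal ((sqrt (X u \<omega>) * indicator {0..0} u)\<^sup>2) \<partial>lborel)"
    by (intro prob_small_AE) auto
  from ito_lim_small[OF ito_lim_I order_refl this] t
  have "AE \<omega> in M. ennreal \<bar>I 0 \<omega>\<bar> = 0" by (intro prob_small_const_AE) auto
  moreover have "AE \<omega> in M. X 0 \<omega> = x + 2 * I 0 \<omega> + (LBINT s:{0..0}. \<delta> - 2 * X s \<omega> / (1 - s))"
    using sde[of 0] t by simp
  moreover have "(LBINT s:{0..0}. g s) = 0" for g :: "real \<Rightarrow> real"
    by (subst interval_integral_Icc[symmetric]) auto
  ultimately show ?thesis by (auto elim!: eventually_elim2)
qed

section \<open>The exponent and its increments\<close>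

definition bridge_exponent :: "real \<Rightarrow> 'a \<Rightarrow> real" where
  "bridge_exponent r \<omega> = - a r * X r \<omega> - \<gamma> * integral {0..r} (\<lambda>u. X u \<omega>) + \<delta> * integral {0..r} a"

lemma bridge_exponent_measurable:
  assumes r: "r \<in> {0..t}"
  shows "bridge_exponent r \<in> borel_measurable M"
proof -
  have "(\<lambda>p. (snd p, fst p)) \<in> M \<Otimes>\<^sub>M lborel \<rightarrow>\<^sub>M borel \<Otimes>\<^sub>M M" by measurable
  from measurable_compose[OF this ito_lim_measurable(1)[OF ito_lim_I[OF r]]]
  have [measurable]: "(\<lambda>p. sqrt (X (snd p) (fst p)) * indicator {0..r} (snd p)) \<in> borel_measurable (M \<Otimes>\<^sub>M lborel)" by simp
  \<comment> \<open>Adaptedness gives measurability of \<open>X\<close> only at single times. Joint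
    measurability comes with the Ito integrand \<open>sqrt X\<close>, whose square is integrated
    here.\<close>
  have "(\<lambda>\<omega>. \<integral>u. (sqrt (X u \<omega>) * indicator {0..r} u)\<^sup>2 \<partial>lborel) \<in> borel_measurable M"
    by (rule lborel.borel_measurable_lebesgue_integral) (simp add: case_prod_beta')
  also have "?this \<longleftrightarrow> (\<lambda>\<omega>. integral {0..r} (\<lambda>u. X u \<omega>)) \<in> borel_measurable M"
  proof (rule measurable_cong)
    fix \<omega> assume \<omega>: "\<omega> \<in> space M"
    have "(\<integral>u. (sqrt (X u \<omega>) * indicator {0..r} u)\<^sup>2 \<partial>lborel) = (LBINT u:{0..r}. X u \<omega>)"
      unfolding set_lebesgue_integral_def using X_nonneg[OF \<omega>] r
      by (intro Bochner_Integration.integral_cong) (auto simp: indicator_def)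
    also have "\<dots> = integral {0..r} (\<lambda>u. X u \<omega>)"
      using r by (intro LBINT_eq_integral continuous_on_subset[OF X_cont[OF \<omega>]]) auto
    finally show "(\<integral>u. (sqrt (X u \<omega>) * indicator {0..r} u)\<^sup>2 \<partial>lborel) = integral {0..r} (\<lambda>u. X u \<omega>)" .
  qed
  finally have [measurable]: "(\<lambda>\<omega>. integral {0..r} (\<lambda>u. X u \<omega>)) \<in> borel_measurable M" .
  have [measurable]: "X r \<in> borel_measurable M" using X_measurable[OF r] .
  show ?thesis unfolding bridge_exponent_def[abs_def] by measurable
qed

text \<open>The error density on a cell from \<open>r\<close> to \<open>r'\<close>. The three times
  are kept as separate arguments so that it is a continuous function on a cube; on the diagonal the
  terms cancel because the first bracket is the right-hand side of the Riccati equation.\<close>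

definition local_error :: "'a \<Rightarrow> real \<Rightarrow> real \<Rightarrow> real \<Rightarrow> real" where
  "local_error \<omega> r r' u = - ((2 * (a u)\<^sup>2 + 2 * a u / (1 - u) - \<gamma>) * X r' \<omega>) - \<gamma> * X u \<omega> + \<delta> * a u
     - a r * (\<delta> - 2 * X u \<omega> / (1 - u)) + 2 * (a r)\<^sup>2 * X r \<omega>"

lemma local_error_diag: "u \<in> {0..t} \<Longrightarrow> local_error \<omega> u u u = 0"
  using t by (simp add: local_error_def algebra_simps)

lemma local_error_cont:
  assumes "\<omega> \<in> space M"
  shows "continuous_on ({0..t} \<times> {0..t} \<times> {0..t}) (\<lambda>(r, r', u). local_error \<omega> r r' u)"
proof -
  have a: "continuous_on ({0..t} \<times> {0..t} \<times> {0..t}) (\<lambda>p. a (g p))"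
    and X: "continuous_on ({0..t} \<times> {0..t} \<times> {0..t}) (\<lambda>p. X (g p) \<omega>)"
    if "g = fst \<or> g = (\<lambda>p. fst (snd p)) \<or> g = (\<lambda>p. snd (snd p))" for g :: "real \<times> real \<times> real \<Rightarrow> real"
    by (rule continuous_on_compose2[OF a_cont] continuous_on_compose2[OF X_cont[OF assms]];
        use that in \<open>auto intro!: continuous_intros\<close>)+
  show ?thesis
    unfolding local_error_def case_prod_beta'
    by (intro continuous_intros a X) (use t in auto)
qed

text \<open>Summation by parts replaces the product rule: \<open>a r' * X r' - a r * X r\<close> is
  \<open>a r * (X r' - X r)\<close> plus \<open>(a r' - a r) * X r'\<close>, and the increment of
  \<open>a\<close> is the integral of its derivative. As \<open>a\<close> is deterministic and
  differentiable, no covariation enters. The term with \<open>(a r)^2\<close> is placed here to meet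
  the compensator of the Euler exponent.\<close>

lemma bridge_exponent_increment:
  assumes \<omega>: "\<omega> \<in> space M" and r: "0 \<le> r" "r \<le> r'" "r' \<le> t"
  shows "bridge_exponent r' \<omega> - bridge_exponent r \<omega> + a r * (X r' \<omega> - X r \<omega>)
      - a r * integral {r..r'} (\<lambda>u. \<delta> - 2 * X u \<omega> / (1 - u)) + 2 * (a r)\<^sup>2 * X r \<omega> * (r' - r)
    = integral {r..r'} (local_error \<omega> r r')"
proof -
  have sub: "{r..r'} \<subseteq> {0..t}" using r by auto
  note cX = continuous_on_subset[OF X_cont[OF \<omega>] sub] and ca = continuous_on_subset[OF a_cont sub]
  have FTC: "((\<lambda>u. 2 * (a u)\<^sup>2 + 2 * a u / (1 - u) - \<gamma>) has_integral (a r' - a r)) {r..r'}"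
    using r by (intro fundamental_theorem_of_calculus)
      (auto intro!: DERIV_subset[OF a_deriv] simp flip: has_real_derivative_iff_has_vector_derivative)
  have iX: "((\<lambda>u. X u \<omega>) has_integral integral {r..r'} (\<lambda>u. X u \<omega>)) {r..r'}"
    by (intro integrable_integral integrable_continuous_real cX)
  have ia: "(a has_integral integral {r..r'} a) {r..r'}"
    by (intro integrable_integral integrable_continuous_real ca)
  have id: "((\<lambda>u. \<delta> - 2 * X u \<omega> / (1 - u)) has_integral integral {r..r'} (\<lambda>u. \<delta> - 2 * X u \<omega> / (1 - u))) {r..r'}"
    by (intro integrable_integral integrable_continuous_real continuous_intros cX) (use r t in auto)
  have ic: "((\<lambda>u. 2 * (a r)\<^sup>2 * X r \<omega>) has_integral (r' - r) *\<^sub>R (2 * (a r)\<^sup>2 * X r \<omega>)) {r..r'}"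
    using has_integral_const_real[of "2 * (a r)\<^sup>2 * X r \<omega>" r r'] r by simp
  have "(local_error \<omega> r r' has_integral - ((a r' - a r) * X r' \<omega>) - \<gamma> * integral {r..r'} (\<lambda>u. X u \<omega>)
      + \<delta> * integral {r..r'} a - a r * integral {r..r'} (\<lambda>u. \<delta> - 2 * X u \<omega> / (1 - u))
      + (r' - r) *\<^sub>R (2 * (a r)\<^sup>2 * X r \<omega>)) {r..r'}"
    unfolding local_error_def[abs_def]
    by (intro has_integral_add has_integral_diff has_integral_neg has_integral_mult_left
        has_integral_mult_right FTC iX ia id ic)
  then have "integral {r..r'} (local_error \<omega> r r') = - ((a r' - a r) * X r' \<omega>) - \<gamma> * integral {r..r'} (\<lambda>u. X u \<omega>)
      + \<delta> * integral {r..r'} a - a r * integral {r..r'} (\<lambda>u. \<delta> - 2 * X u \<omega> / (1 - u))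
      + (r' - r) *\<^sub>R (2 * (a r)\<^sup>2 * X r \<omega>)" by (rule integral_unique)
  moreover have "integral {0..r'} (\<lambda>u. X u \<omega>) = integral {0..r} (\<lambda>u. X u \<omega>) + integral {r..r'} (\<lambda>u. X u \<omega>)"
    using r by (intro Henstock_Kurzweil_Integration.integral_combine[symmetric] integrable_continuous_real
        continuous_on_subset[OF X_cont[OF \<omega>]]) auto
  moreover have "integral {0..r'} a = integral {0..r} a + integral {r..r'} a"
    using r by (intro Henstock_Kurzweil_Integration.integral_combine[symmetric] integrable_continuous_real
        continuous_on_subset[OF a_cont]) auto
  ultimately show ?thesis by (simp add: bridge_exponent_def algebra_simps)
qed

lemma integral_drift:
  assumes \<omega>: "\<omega> \<in> space M" and r: "0 \<le> r" "r \<le> r'" "r' \<le> t"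
  shows "(LBINT u:{0..r'}. \<delta> - 2 * X u \<omega> / (1 - u)) - (LBINT u:{0..r}. \<delta> - 2 * X u \<omega> / (1 - u))
    = integral {r..r'} (\<lambda>u. \<delta> - 2 * X u \<omega> / (1 - u))"
proof -
  have c: "continuous_on {0..t} (\<lambda>u. \<delta> - 2 * X u \<omega> / (1 - u))"
    by (intro continuous_intros X_cont[OF \<omega>]) (use t in auto)
  have "integral {0..r'} (\<lambda>u. \<delta> - 2 * X u \<omega> / (1 - u))
    = integral {0..r} (\<lambda>u. \<delta> - 2 * X u \<omega> / (1 - u)) + integral {r..r'} (\<lambda>u. \<delta> - 2 * X u \<omega> / (1 - u))"
    using r by (intro Henstock_Kurzweil_Integration.integral_combine[symmetric] integrable_continuous_real
        continuous_on_subset[OF c]) auto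
  moreover have "(LBINT u:{0..s}. \<delta> - 2 * X u \<omega> / (1 - u)) = integral {0..s} (\<lambda>u. \<delta> - 2 * X u \<omega> / (1 - u))"
    if "s \<le> t" for s
    using that by (intro LBINT_eq_integral continuous_on_subset[OF c]) auto
  ultimately show ?thesis using r by simp
qed

section \<open>Discretization with a cut-off at the level R\<close>

definition below :: "real \<Rightarrow> nat \<Rightarrow> nat \<Rightarrow> 'a \<Rightarrow> real" where
  "below R n i \<omega> = (if \<forall>j\<le>i. X (grid t n j) \<omega> \<le> R then 1 else 0)"

text \<open>The factor \<open>below\<close> occurs both here and in \<open>level_X\<close>. There it
  bounds the coefficient of an elementary integral; here it removes the cells on which the cut-off
  is active, where \<open>sqrt X - level_X\<close> is not small. In products it is
  idempotent.\<close>

definition bridge_coeff :: "real \<Rightarrow> nat \<Rightarrow> nat \<Rightarrow> 'a \<Rightarrow> real" where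
  "bridge_coeff R n i \<omega> = - 2 * a (grid t n i) * below R n i \<omega>"

definition level_X :: "real \<Rightarrow> nat \<Rightarrow> nat \<Rightarrow> 'a \<Rightarrow> real" where
  "level_X R n i \<omega> = below R n i \<omega> * sqrt (X (grid t n i) \<omega>)"

definition euler_exponent :: "real \<Rightarrow> nat \<Rightarrow> 'a \<Rightarrow> real" where
  "euler_exponent R n \<omega> = (\<Sum>i<Suc n. bridge_coeff R n i \<omega> * level_X R n i \<omega> * (B (grid t n (Suc i)) \<omega> - B (grid t n i) \<omega>)
     - (bridge_coeff R n i \<omega> * level_X R n i \<omega>)\<^sup>2 * (grid t n (Suc i) - grid t n i) / 2)"

definition stopped_exponent :: "real \<Rightarrow> nat \<Rightarrow> 'a \<Rightarrow> real" where
  "stopped_exponent R n \<omega> = (\<Sum>i<Suc n. below R n i \<omega> * (bridge_exponent (grid t n (Suc i)) \<omega> - bridge_exponent (grid t n i) \<omega>))"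

definition ito_error :: "real \<Rightarrow> nat \<Rightarrow> 'a \<Rightarrow> real" where
  "ito_error R n \<omega> = (\<Sum>i<Suc n. bridge_coeff R n i \<omega> * ((I (grid t n (Suc i)) \<omega> - I (grid t n i) \<omega>)
     - level_X R n i \<omega> * (B (grid t n (Suc i)) \<omega> - B (grid t n i) \<omega>)))"

definition ito_error_integrand :: "real \<Rightarrow> nat \<Rightarrow> real \<Rightarrow> 'a \<Rightarrow> real" where
  "ito_error_integrand R n u \<omega> = (\<Sum>i<Suc n. bridge_coeff R n i \<omega> *
     (sqrt (X u \<omega>) * indicator {grid t n i<..grid t n (Suc i)} u
      - level_X R n i \<omega> * indicator {grid t n i<..grid t n (Suc i)} u))"

lemma grid_bounds:
  assumes "i \<le> n"
  shows "0 \<le> grid t n i" "grid t n i \<le> grid t n (Suc i)" "grid t n (Suc i) \<le> t" "grid t n i \<le> t"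
    "grid t n i \<in> {0..t}" "grid t n (Suc i) \<in> {0..t}"
  using grid_in[OF t(1), of i n] grid_in[OF t(1), of "Suc i" n] grid_mono[OF t(1), of i "Suc i" n] assms by auto

lemma below_01: "below R n i \<omega> = 0 \<or> below R n i \<omega> = 1"
  by (simp add: below_def)

lemma below_measurable:
  assumes i: "i \<le> n"
  shows "below R n i \<in> borel_measurable (F (grid t n i))"
proof -
  have [measurable]: "X (grid t n j) \<in> borel_measurable (F (grid t n i))" if "j \<le> i" for j
    using measurable_F_mono[OF grid_mono[OF t(1) that] X_adapted[OF grid_bounds(5)]] i that by simp
  have "{\<omega> \<in> space (F (grid t n i)). \<forall>j\<in>{..i}. X (grid t n j) \<omega> \<le> R} \<in> sets (F (grid t n i))"
    by (rule sets.sets_Collect_finite_All) auto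
  then have [measurable]: "Measurable.pred (F (grid t n i)) (\<lambda>\<omega>. \<forall>j\<le>i. X (grid t n j) \<omega> \<le> R)"
    by (simp add: pred_def Ball_def)
  show ?thesis unfolding below_def[abs_def] by measurable
qed

lemma bridge_coeff_measurable: "i \<le> n \<Longrightarrow> bridge_coeff R n i \<in> borel_measurable (F (grid t n i))"
  unfolding bridge_coeff_def[abs_def] using below_measurable by (intro borel_measurable_times) auto

lemma level_X_measurable: "i \<le> n \<Longrightarrow> level_X R n i \<in> borel_measurable (F (grid t n i))"
  unfolding level_X_def[abs_def] using below_measurable X_adapted[OF grid_bounds(5)]
  by (intro borel_measurable_times) auto

lemma level_X_bound:
  assumes "\<omega> \<in> space M" "i \<le> n"
  shows "\<bar>level_X R n i \<omega>\<bar> \<le> sqrt \<bar>R\<bar>"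
proof (cases "below R n i \<omega> = 0")
  case False
  then have "X (grid t n i) \<omega> \<le> R" by (auto simp: below_def split: if_splits)
  then have "sqrt (X (grid t n i) \<omega>) \<le> sqrt \<bar>R\<bar>" by simp
  then show ?thesis using below_01[of R n i \<omega>] X_nonneg[OF assms(1) grid_bounds(5)[OF assms(2)]]
    by (auto simp: level_X_def)
qed (simp add: level_X_def)

lemma bridge_coeff_bound:
  assumes A: "\<And>u. u \<in> {0..t} \<Longrightarrow> a u \<le> A" and "i \<le> n"
  shows "\<bar>bridge_coeff R n i \<omega>\<bar> \<le> 2 * A"
  using A[OF grid_bounds(5)[OF assms(2)]] a_nonneg[OF grid_bounds(5)[OF assms(2)]] below_01[of R n i \<omega>]
  by (auto simp: bridge_coeff_def)

lemma a_bound: obtains A where "0 < A" "\<And>u. u \<in> {0..t} \<Longrightarrow> a u \<le> A"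
proof -
  have "bounded (a ` {0..t})"
    using a_cont by (intro compact_imp_bounded compact_continuous_image) auto
  then obtain A where "0 < A" "\<forall>y\<in>a ` {0..t}. norm y \<le> A" by (auto simp: bounded_pos)
  then show ?thesis using that[of A] by (auto simp: abs_le_iff)
qed

text \<open>On each cell the increment is an integral starting at the left endpoint, so a
  coefficient known there may be multiplied in; only afterwards is the start moved back to 0, in
  order to sum over cells.\<close>

lemma ito_lim_error: "ito_lim 0 (ito_error_integrand R n) (ito_error R n)"
  unfolding ito_error_integrand_def[abs_def] ito_error_def[abs_def]
proof (rule ito_lim_sum)
  fix i assume "i < Suc n"
  then have i: "i \<le> n" by simp
  note g = grid_bounds[OF i]
  obtain A where A: "0 < A" "\<And>u. u \<in> {0..t} \<Longrightarrow> a u \<le> A" by (rule a_bound) (rule that)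
  let ?s = "grid t n i" and ?s' = "grid t n (Suc i)"
  have "elem_int ?s (\<lambda>u \<omega>. - level_X R n i \<omega> * indicator {?s<..?s'} u) (\<lambda>\<omega>. - level_X R n i \<omega> * (B ?s' \<omega> - B ?s \<omega>))"
    using g level_X_bound[OF _ i] level_X_measurable[OF i]
    by (intro elem_int_single[where C = "sqrt \<bar>R\<bar>"] borel_measurable_uminus) auto
  from ito_lim_plus[OF ito_increment[OF g(1,2,3)] ito_lim_elem[OF this g(1)] g(1)]
  have "ito_lim ?s (\<lambda>u \<omega>. sqrt (X u \<omega>) * indicator {?s<..?s'} u - level_X R n i \<omega> * indicator {?s<..?s'} u)
    (\<lambda>\<omega>. (I ?s' \<omega> - I ?s \<omega>) - level_X R n i \<omega> * (B ?s' \<omega> - B ?s \<omega>))" by simp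
  from ito_lim_mono[OF ito_lim_cmult[OF this g(1) bridge_coeff_measurable[OF i] bridge_coeff_bound[OF A(2) i]] g(1)]
  show "ito_lim 0 (\<lambda>u \<omega>. bridge_coeff R n i \<omega> * (sqrt (X u \<omega>) * indicator {?s<..?s'} u - level_X R n i \<omega> * indicator {?s<..?s'} u))
    (\<lambda>\<omega>. bridge_coeff R n i \<omega> * ((I ?s' \<omega> - I ?s \<omega>) - level_X R n i \<omega> * (B ?s' \<omega> - B ?s \<omega>)))" .
qed simp

lemma sum_indicator_grid:
  "(\<Sum>i<Suc n. indicator {grid t n i<..grid t n (Suc i)} u) = (indicator {0<..t} u :: real)"
proof -
  have ind: "indicator {y<..z} u = (if u \<le> z then 1 else 0) - (if u \<le> y then 1 else (0::real))"
    if "y \<le> z" for y z :: real using that by (auto simp: indicator_def)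
  have "(\<Sum>i<Suc n. indicator {grid t n i<..grid t n (Suc i)} u)
    = (\<Sum>i<Suc n. (if u \<le> grid t n (Suc i) then 1 else 0) - (if u \<le> grid t n i then 1 else (0::real)))"
    by (intro sum.cong refl ind grid_mono t) simp
  also have "\<dots> = (if u \<le> grid t n (Suc n) then 1 else 0) - (if u \<le> grid t n 0 then 1 else 0)"
    by (rule sum_lessThan_telescope)
  also have "\<dots> = indicator {0<..t} u" using t by (auto simp: indicator_def)
  finally show ?thesis .
qed

lemma ito_error_integrand_bound:
  assumes "\<And>i u. i \<le> n \<Longrightarrow> u \<in> {grid t n i..grid t n (Suc i)} \<Longrightarrow> \<bar>sqrt (X u \<omega>) - sqrt (X (grid t n i) \<omega>)\<bar> \<le> \<epsilon>"
    and A: "\<And>u. u \<in> {0..t} \<Longrightarrow> a u \<le> A" and "0 \<le> A"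
  shows "\<bar>ito_error_integrand R n u \<omega>\<bar> \<le> 2 * A * \<epsilon> * indicator {0<..t} u"
proof -
  have "\<bar>ito_error_integrand R n u \<omega>\<bar> \<le> (\<Sum>i<Suc n. 2 * A * \<epsilon> * indicator {grid t n i<..grid t n (Suc i)} u)"
    unfolding ito_error_integrand_def
  proof (rule order_trans[OF sum_abs sum_mono])
    fix i assume "i \<in> {..<Suc n}"
    then have i: "i \<le> n" by simp
    show "\<bar>bridge_coeff R n i \<omega> * (sqrt (X u \<omega>) * indicator {grid t n i<..grid t n (Suc i)} u
      - level_X R n i \<omega> * indicator {grid t n i<..grid t n (Suc i)} u)\<bar>
      \<le> 2 * A * \<epsilon> * indicator {grid t n i<..grid t n (Suc i)} u"
    proof (cases "u \<in> {grid t n i<..grid t n (Suc i)}")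
      case True
      \<comment> \<open>On a cell that is switched off both sides are 0; otherwise
        \<open>level_X\<close> is the value of \<open>sqrt X\<close> at the left endpoint.\<close>
      have "bridge_coeff R n i \<omega> * (sqrt (X u \<omega>) - level_X R n i \<omega>) = bridge_coeff R n i \<omega> * (sqrt (X u \<omega>) - sqrt (X (grid t n i) \<omega>))"
        using below_01[of R n i \<omega>] by (auto simp: bridge_coeff_def level_X_def)
      moreover have "\<bar>bridge_coeff R n i \<omega> * (sqrt (X u \<omega>) - sqrt (X (grid t n i) \<omega>))\<bar> \<le> (2 * A) * \<epsilon>"
        unfolding abs_mult using bridge_coeff_bound[OF A i] assms(1)[OF i, of u] True \<open>0 \<le> A\<close>
        by (intro mult_mono) auto
      ultimately have "\<bar>bridge_coeff R n i \<omega> * (sqrt (X u \<omega>) - level_X R n i \<omega>)\<bar> \<le> 2 * A * \<epsilon>" by (simp only:)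
      then show ?thesis using True by simp
    qed simp
  qed
  also have "\<dots> = 2 * A * \<epsilon> * indicator {0<..t} u"
    unfolding sum_distrib_left[symmetric] sum_indicator_grid ..
  finally show ?thesis .
qed

lemma ito_error_small: "prob_small (\<lambda>n \<omega>. ennreal \<bar>ito_error R n \<omega>\<bar>)"
proof (rule ito_lim_small[OF ito_lim_error order_refl prob_small_AE])
  show "(\<lambda>\<omega>. \<integral>\<^sup>+u. ennreal ((ito_error_integrand R n u \<omega>)\<^sup>2) \<partial>lborel) \<in> borel_measurable M" for n
    by (rule borel_measurable_nn_integral_param[OF ito_lim_measurable(1)[OF ito_lim_error]])
  show "AE \<omega> in M. (\<lambda>n. \<integral>\<^sup>+u. ennreal ((ito_error_integrand R n u \<omega>)\<^sup>2) \<partial>lborel) \<longlonglongrightarrow> 0"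
  proof (rule AE_I2)
    fix \<omega> assume \<omega>: "\<omega> \<in> space M"
    obtain A where A: "0 < A" "\<And>u. u \<in> {0..t} \<Longrightarrow> a u \<le> A" by (rule a_bound) (rule that)
    have cont: "continuous_on ({0..t} \<times> {0..t} \<times> {0..t}) (\<lambda>(r, r', u). sqrt (X u \<omega>) - sqrt (X r \<omega>))"
      unfolding case_prod_beta'
      by (intro continuous_intros continuous_on_compose2[OF X_cont[OF \<omega>]]) auto
    show "(\<lambda>n. \<integral>\<^sup>+u. ennreal ((ito_error_integrand R n u \<omega>)\<^sup>2) \<partial>lborel) \<longlonglongrightarrow> 0"
    proof (rule order_tendstoI)
      fix y :: ennreal assume "0 < y"
      then obtain e where e: "0 < ennreal e" "ennreal e < y"
        by (metis dense ennreal_cases neq_top_trans not_less order_less_imp_le top_greatest)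
      then have e0: "0 < e" by simp
      \<comment> \<open>The integrand is bounded by \<open>2 * A * \<epsilon>\<close> on an interval
        of length \<open>t\<close>, so its squared norm is at most \<open>e * t / (1 + t)\<close>;
        the summand 1 also covers \<open>t = 0\<close>.\<close>
      define \<epsilon> where "\<epsilon> = sqrt (e / (1 + t)) / (2 * A)"
      have \<epsilon>: "0 < \<epsilon>" "(2 * A * \<epsilon>)\<^sup>2 * t \<le> e"
        using e0 A t by (auto simp: \<epsilon>_def field_simps)
      from grid_uniform[OF t(1) cont _ \<epsilon>(1)]
      have "\<forall>\<^sub>F n in sequentially. \<forall>i\<le>n. \<forall>u\<in>{grid t n i..grid t n (Suc i)}. \<bar>sqrt (X u \<omega>) - sqrt (X (grid t n i) \<omega>)\<bar> \<le> \<epsilon>"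
        by simp
      then show "\<forall>\<^sub>F n in sequentially. (\<integral>\<^sup>+u. ennreal ((ito_error_integrand R n u \<omega>)\<^sup>2) \<partial>lborel) < y"
      proof eventually_elim
        fix n assume n: "\<forall>i\<le>n. \<forall>u\<in>{grid t n i..grid t n (Suc i)}. \<bar>sqrt (X u \<omega>) - sqrt (X (grid t n i) \<omega>)\<bar> \<le> \<epsilon>"
        have "(\<integral>\<^sup>+u. ennreal ((ito_error_integrand R n u \<omega>)\<^sup>2) \<partial>lborel)
          \<le> (\<integral>\<^sup>+u. ennreal ((2 * A * \<epsilon>)\<^sup>2) * indicator {0<..t} u \<partial>lborel)"
        proof (rule nn_integral_mono)
          fix u
          have "\<bar>ito_error_integrand R n u \<omega>\<bar> \<le> 2 * A * \<epsilon> * indicator {0<..t} u"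
            using n A by (intro ito_error_integrand_bound) auto
          then have "(ito_error_integrand R n u \<omega>)\<^sup>2 \<le> (2 * A * \<epsilon> * indicator {0<..t} u)\<^sup>2"
            by (metis abs_ge_zero power2_abs power_mono)
          then show "ennreal ((ito_error_integrand R n u \<omega>)\<^sup>2) \<le> ennreal ((2 * A * \<epsilon>)\<^sup>2) * indicator {0<..t} u"
            by (cases "u \<in> {0<..t}") (auto intro!: ennreal_leI)
        qed
        also have "\<dots> = ennreal ((2 * A * \<epsilon>)\<^sup>2 * t)"
          using t by (simp add: nn_integral_cmult_indicator ennreal_mult)
        also have "\<dots> \<le> ennreal e" using \<epsilon>(2) by (rule ennreal_leI)
        finally show "(\<integral>\<^sup>+u. ennreal ((ito_error_integrand R n u \<omega>)\<^sup>2) \<partial>lborel) < y" using e(2) by simp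
      qed
    qed simp
  qed
qed

text \<open>Inserting the equation for \<open>X\<close>, an increment of the exponent is
  \<open>- 2 * a\<close> times that of \<open>I\<close>, minus \<open>2 * a^2 * X\<close> times the
  cell length, plus the local error. The first term is the Brownian term of
  \<open>euler_exponent\<close> plus a term of \<open>ito_error\<close>, the second is the Euler
  compensator. All grids together have countably many points, so one null set suffices.\<close>

lemma exponent_difference:
  "AE \<omega> in M. \<forall>n. stopped_exponent R n \<omega> - euler_exponent R n \<omega> - ito_error R n \<omega>
    = (\<Sum>i<Suc n. below R n i \<omega> * integral {grid t n i..grid t n (Suc i)} (local_error \<omega> (grid t n i) (grid t n (Suc i))))"
proof -
  have "AE \<omega> in M. \<forall>n i. i \<le> Suc n \<longrightarrow> X (grid t n i) \<omega>
    = x + 2 * I (grid t n i) \<omega> + (LBINT s:{0..grid t n i}. \<delta> - 2 * X s \<omega> / (1 - s))"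
    unfolding AE_all_countable using sde[OF grid_in[OF t(1)]] by auto
  then show ?thesis using AE_space
  proof eventually_elim
    fix \<omega>
    assume eq: "\<forall>n i. i \<le> Suc n \<longrightarrow> X (grid t n i) \<omega>
      = x + 2 * I (grid t n i) \<omega> + (LBINT s:{0..grid t n i}. \<delta> - 2 * X s \<omega> / (1 - s))" and \<omega>: "\<omega> \<in> space M"
    show "\<forall>n. stopped_exponent R n \<omega> - euler_exponent R n \<omega> - ito_error R n \<omega>
      = (\<Sum>i<Suc n. below R n i \<omega> * integral {grid t n i..grid t n (Suc i)} (local_error \<omega> (grid t n i) (grid t n (Suc i))))"
    proof
      fix n
      show "stopped_exponent R n \<omega> - euler_exponent R n \<omega> - ito_error R n \<omega>
        = (\<Sum>i<Suc n. below R n i \<omega> * integral {grid t n i..grid t n (Suc i)} (local_error \<omega> (grid t n i) (grid t n (Suc i))))"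
        unfolding stopped_exponent_def euler_exponent_def ito_error_def sum_subtractf[symmetric]
      proof (rule sum.cong[OF refl])
        fix i assume "i \<in> {..<Suc n}"
        then have i: "i \<le> n" by simp
        note g = grid_bounds[OF i]
        let ?s = "grid t n i" and ?s' = "grid t n (Suc i)"
        define D where "D = integral {?s..?s'} (\<lambda>u. \<delta> - 2 * X u \<omega> / (1 - u))"
        define q where "q = sqrt (X ?s \<omega>)"
        have q: "q\<^sup>2 = X ?s \<omega>" using X_nonneg[OF \<omega> g(5)] by (simp add: q_def)
        have dI: "X ?s' \<omega> - X ?s \<omega> = 2 * (I ?s' \<omega> - I ?s \<omega>) + D"
          using eq[rule_format, of i n] eq[rule_format, of "Suc i" n] i integral_drift[OF \<omega> g(1-3)]
          unfolding D_def by simp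
        have inc: "bridge_exponent ?s' \<omega> - bridge_exponent ?s \<omega> + a ?s * (X ?s' \<omega> - X ?s \<omega>) - a ?s * D + 2 * (a ?s)\<^sup>2 * X ?s \<omega> * (?s' - ?s)
          = integral {?s..?s'} (local_error \<omega> ?s ?s')"
          using bridge_exponent_increment[OF \<omega> g(1-3)] unfolding D_def .
        have e0: "bridge_exponent ?s' \<omega> - bridge_exponent ?s \<omega> + 2 * a ?s * (I ?s' \<omega> - I ?s \<omega>) + 2 * (a ?s)\<^sup>2 * q\<^sup>2 * (?s' - ?s)
          = integral {?s..?s'} (local_error \<omega> ?s ?s')"
          unfolding inc[symmetric] dI q by (simp add: algebra_simps)
        have e2: "(bridge_coeff R n i \<omega> * level_X R n i \<omega>)\<^sup>2 * (?s' - ?s) / 2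
          = below R n i \<omega> * (2 * (a ?s)\<^sup>2 * q\<^sup>2 * (?s' - ?s))"
          using below_01[of R n i \<omega>] by (auto simp: bridge_coeff_def level_X_def q_def power_mult_distrib)
        have e3: "w * dL - (c * v * b - (c * v)\<^sup>2 * e / 2) - c * (dI - v * b) = w * dL + (c * v)\<^sup>2 * e / 2 - c * dI"
          for w dL c v b e dI :: real by (simp add: algebra_simps)
        show "below R n i \<omega> * (bridge_exponent ?s' \<omega> - bridge_exponent ?s \<omega>)
           - (bridge_coeff R n i \<omega> * level_X R n i \<omega> * (B ?s' \<omega> - B ?s \<omega>)
              - (bridge_coeff R n i \<omega> * level_X R n i \<omega>)\<^sup>2 * (?s' - ?s) / 2)
           - bridge_coeff R n i \<omega> * (I ?s' \<omega> - I ?s \<omega> - level_X R n i \<omega> * (B ?s' \<omega> - B ?s \<omega>))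
          = below R n i \<omega> * integral {?s..?s'} (local_error \<omega> ?s ?s')"
          unfolding e3 e2 e0[symmetric] by (simp add: bridge_coeff_def algebra_simps)
      qed
    qed
  qed
qed

lemma remainder_tendsto:
  assumes \<omega>: "\<omega> \<in> space M"
  shows "(\<lambda>n. \<Sum>i<Suc n. below R n i \<omega> * integral {grid t n i..grid t n (Suc i)} (local_error \<omega> (grid t n i) (grid t n (Suc i))))
    \<longlonglongrightarrow> 0"
proof (rule LIMSEQ_I)
  fix r :: real assume r: "0 < r"
  define \<epsilon> where "\<epsilon> = r / (2 * (1 + t))"
  have "r * t < r * (2 * (1 + t))" using r t by (intro mult_strict_left_mono) auto
  then have \<epsilon>: "0 < \<epsilon>" "\<epsilon> * t < r" using r t by (auto simp: \<epsilon>_def pos_divide_less_eq)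
  from grid_uniform[OF t(1) local_error_cont[OF \<omega>] local_error_diag \<epsilon>(1)]
  obtain N where N: "\<And>n i u. N \<le> n \<Longrightarrow> i \<le> n \<Longrightarrow> u \<in> {grid t n i..grid t n (Suc i)} \<Longrightarrow>
    \<bar>local_error \<omega> (grid t n i) (grid t n (Suc i)) u\<bar> \<le> \<epsilon>"
    unfolding eventually_sequentially by blast
  show "\<exists>N. \<forall>n\<ge>N. norm ((\<Sum>i<Suc n. below R n i \<omega> *
    integral {grid t n i..grid t n (Suc i)} (local_error \<omega> (grid t n i) (grid t n (Suc i)))) - 0) < r"
  proof (intro exI[of _ N] allI impI)
    fix n assume n: "N \<le> n"
    have "\<bar>\<Sum>i<Suc n. below R n i \<omega> * integral {grid t n i..grid t n (Suc i)} (local_error \<omega> (grid t n i) (grid t n (Suc i)))\<bar>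
      \<le> (\<Sum>i<Suc n. \<epsilon> * (grid t n (Suc i) - grid t n i))"
    proof (rule order_trans[OF sum_abs sum_mono])
      fix i assume "i \<in> {..<Suc n}"
      then have i: "i \<le> n" by simp
      note g = grid_bounds[OF i]
      have "continuous_on {grid t n i..grid t n (Suc i)} (\<lambda>u. (\<lambda>(r, r', u). local_error \<omega> r r' u) (grid t n i, grid t n (Suc i), u))"
        using g by (intro continuous_on_compose2[OF local_error_cont[OF \<omega>]] continuous_intros) auto
      then have "norm (integral {grid t n i..grid t n (Suc i)} (local_error \<omega> (grid t n i) (grid t n (Suc i))))
        \<le> \<epsilon> * (grid t n (Suc i) - grid t n i)"
        using N[OF n i] g(2) by (intro integral_bound) auto
      moreover have "0 \<le> \<epsilon> * (grid t n (Suc i) - grid t n i)" using \<epsilon> g by simp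
      ultimately show "\<bar>below R n i \<omega> * integral {grid t n i..grid t n (Suc i)} (local_error \<omega> (grid t n i) (grid t n (Suc i)))\<bar>
        \<le> \<epsilon> * (grid t n (Suc i) - grid t n i)"
        using below_01[of R n i \<omega>] by auto
    qed
    also have "\<dots> = \<epsilon> * t"
      unfolding sum_distrib_left[symmetric] sum_lessThan_telescope by simp
    finally show "norm ((\<Sum>i<Suc n. below R n i \<omega> *
      integral {grid t n i..grid t n (Suc i)} (local_error \<omega> (grid t n i) (grid t n (Suc i)))) - 0) < r"
      using \<epsilon> by simp
  qed
qed

lemma euler_exponent_measurable: "euler_exponent R n \<in> borel_measurable M"
proof -
  have "(\<lambda>\<omega>. bridge_coeff R n i \<omega> * level_X R n i \<omega> * (B (grid t n (Suc i)) \<omega> - B (grid t n i) \<omega>)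
     - (bridge_coeff R n i \<omega> * level_X R n i \<omega>)\<^sup>2 * (grid t n (Suc i) - grid t n i) / 2) \<in> borel_measurable M" if "i < Suc n" for i
  proof -
    have [measurable]: "bridge_coeff R n i \<in> borel_measurable M" "level_X R n i \<in> borel_measurable M"
      "B (grid t n (Suc i)) \<in> borel_measurable M" "B (grid t n i) \<in> borel_measurable M"
      using that measurable_F[OF bridge_coeff_measurable[of i n R]] measurable_F[OF level_X_measurable[of i n R]]
        measurable_B grid_bounds[of i n] by auto
    show ?thesis by measurable
  qed
  then show ?thesis unfolding euler_exponent_def[abs_def] by (intro borel_measurable_sum) auto
qed

lemma stopped_exponent_measurable: "stopped_exponent R n \<in> borel_measurable M"
  unfolding stopped_exponent_def[abs_def]
  using measurable_F[OF below_measurable] bridge_exponent_measurable grid_bounds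
  by (intro borel_measurable_sum borel_measurable_times borel_measurable_diff) auto

lemma exponents_small: "prob_small (\<lambda>n \<omega>. ennreal \<bar>euler_exponent R n \<omega> - stopped_exponent R n \<omega>\<bar>)"
proof -
  let ?R = "\<lambda>n \<omega>. stopped_exponent R n \<omega> - euler_exponent R n \<omega> - ito_error R n \<omega>"
  note [measurable] = euler_exponent_measurable stopped_exponent_measurable ito_lim_measurable(2)[OF ito_lim_error]
  have "AE \<omega> in M. (\<lambda>n. ?R n \<omega>) \<longlonglongrightarrow> 0"
    using exponent_difference[of R] AE_space by eventually_elim (simp add: remainder_tendsto del: sum.lessThan_Suc)
  then have "AE \<omega> in M. (\<lambda>n. ennreal \<bar>?R n \<omega>\<bar>) \<longlonglongrightarrow> 0"
  proof eventually_elim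
    fix \<omega> assume "(\<lambda>n. ?R n \<omega>) \<longlonglongrightarrow> 0"
    from tendsto_ennrealI[OF tendsto_rabs[OF this]] show "(\<lambda>n. ennreal \<bar>?R n \<omega>\<bar>) \<longlonglongrightarrow> 0" by simp
  qed
  then have "prob_small (\<lambda>n \<omega>. ennreal \<bar>?R n \<omega>\<bar>)" by (intro prob_small_AE) auto
  from prob_small_add[OF this ito_error_small[of R]] show ?thesis
    by (rule prob_small_mono) (auto simp flip: ennreal_plus intro!: ennreal_leI)
qed

lemma euler_coeff_measurable:
  "i < Suc n \<Longrightarrow> (\<lambda>\<omega>. c * (bridge_coeff R n i \<omega> * level_X R n i \<omega>)) \<in> borel_measurable (F (grid t n i))"
  using bridge_coeff_measurable level_X_measurable
  by (intro borel_measurable_times borel_measurable_const) auto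

lemma nn_integral_euler_exponent: "(\<integral>\<^sup>+\<omega>. ennreal (exp (euler_exponent R n \<omega>)) \<partial>M) = 1"
  unfolding euler_exponent_def
  by (rule nn_integral_exp_sum) (use grid_bounds euler_coeff_measurable[where c = 1] in auto)

text \<open>Twice the exponent is the exponent for the doubled coefficients, whose exponential has
  mean 1, plus the sum of \<open>k^2\<close> times the cell lengths. By the cut-off this sum is at
  most \<open>K * t\<close>, uniformly in the mesh.\<close>

lemma nn_integral_euler_exponent_square:
  obtains Q where "0 < Q" "\<And>n. (\<integral>\<^sup>+\<omega>. ennreal (exp (2 * euler_exponent R n \<omega>)) \<partial>M) \<le> ennreal Q"
proof -
  obtain A where A: "0 < A" "\<And>u. u \<in> {0..t} \<Longrightarrow> a u \<le> A" by (rule a_bound) (rule that)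
  define K where "K = (2 * A * sqrt \<bar>R\<bar>)\<^sup>2"
  define k where "k n i \<omega> = bridge_coeff R n i \<omega> * level_X R n i \<omega>" for n i \<omega>
  have "(\<integral>\<^sup>+\<omega>. ennreal (exp (2 * euler_exponent R n \<omega>)) \<partial>M) \<le> ennreal (exp (K * t))" for n
  proof -
    let ?E = "\<lambda>\<omega>. \<Sum>i<Suc n. 2 * k n i \<omega> * (B (grid t n (Suc i)) \<omega> - B (grid t n i) \<omega>)
       - (2 * k n i \<omega>)\<^sup>2 * (grid t n (Suc i) - grid t n i) / 2"
    have alg: "2 * (y * b - y\<^sup>2 * e / 2) - (2 * y * b - (2 * y)\<^sup>2 * e / 2) = y\<^sup>2 * e" for y b e :: real
      by (simp add: power_mult_distrib)
    have le: "2 * euler_exponent R n \<omega> \<le> K * t + ?E \<omega>" if \<omega>: "\<omega> \<in> space M" for \<omega>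
    proof -
      have "2 * euler_exponent R n \<omega> - ?E \<omega> = (\<Sum>i<Suc n. (k n i \<omega>)\<^sup>2 * (grid t n (Suc i) - grid t n i))"
        unfolding euler_exponent_def k_def[symmetric] sum_distrib_left sum_subtractf[symmetric]
        by (rule sum.cong[OF refl alg])
      also have "\<dots> \<le> (\<Sum>i<Suc n. K * (grid t n (Suc i) - grid t n i))"
      proof (rule sum_mono)
        fix i assume "i \<in> {..<Suc n}"
        then have i: "i \<le> n" by simp
        have "\<bar>k n i \<omega>\<bar> \<le> 2 * A * sqrt \<bar>R\<bar>"
          unfolding k_def abs_mult using A bridge_coeff_bound[OF A(2) i] level_X_bound[OF \<omega> i]
          by (intro mult_mono) auto
        then have "(k n i \<omega>)\<^sup>2 \<le> K" unfolding K_def by (metis abs_ge_zero power2_abs power_mono)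
        then show "(k n i \<omega>)\<^sup>2 * (grid t n (Suc i) - grid t n i) \<le> K * (grid t n (Suc i) - grid t n i)"
          using grid_bounds(2)[OF i] by (intro mult_right_mono) auto
      qed
      also have "\<dots> = K * t" unfolding sum_distrib_left[symmetric] sum_lessThan_telescope by simp
      finally show ?thesis by linarith
    qed
    have [measurable]: "?E \<in> borel_measurable M"
    proof (rule borel_measurable_sum)
      fix i assume "i \<in> {..<Suc n}"
      then have [measurable]: "k n i \<in> borel_measurable M"
        "B (grid t n (Suc i)) \<in> borel_measurable M" "B (grid t n i) \<in> borel_measurable M"
        using measurable_F[OF euler_coeff_measurable[of i n 1 R]] measurable_B grid_bounds[of i n]
        unfolding k_def by auto
      show "(\<lambda>\<omega>. 2 * k n i \<omega> * (B (grid t n (Suc i)) \<omega> - B (grid t n i) \<omega>)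
         - (2 * k n i \<omega>)\<^sup>2 * (grid t n (Suc i) - grid t n i) / 2) \<in> borel_measurable M" by measurable
    qed
    have "(\<integral>\<^sup>+\<omega>. ennreal (exp (2 * euler_exponent R n \<omega>)) \<partial>M)
      \<le> (\<integral>\<^sup>+\<omega>. ennreal (exp (K * t)) * ennreal (exp (?E \<omega>)) \<partial>M)"
    proof (rule nn_integral_mono)
      fix \<omega> assume "\<omega> \<in> space M"
      then have "exp (2 * euler_exponent R n \<omega>) \<le> exp (K * t) * exp (?E \<omega>)"
        using le[of \<omega>] by (simp del: sum.lessThan_Suc flip: exp_add)
      then show "ennreal (exp (2 * euler_exponent R n \<omega>)) \<le> ennreal (exp (K * t)) * ennreal (exp (?E \<omega>))"
        by (subst ennreal_mult[symmetric]) (auto intro!: ennreal_leI)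
    qed
    also have "\<dots> = ennreal (exp (K * t)) * (\<integral>\<^sup>+\<omega>. ennreal (exp (?E \<omega>)) \<partial>M)"
      by (rule nn_integral_cmult) measurable
    also have "(\<integral>\<^sup>+\<omega>. ennreal (exp (?E \<omega>)) \<partial>M) = 1"
      by (rule nn_integral_exp_sum) (use grid_bounds euler_coeff_measurable[where c = 2] in \<open>auto simp: k_def[abs_def]\<close>)
    finally show ?thesis by simp
  qed
  then show ?thesis using that[of "exp (K * t)"] by simp
qed

text \<open>As \<open>below\<close> can only drop from 1 to 0 along the grid, weighting by it stops
  the sum at the first index where \<open>X\<close> exceeds \<open>R\<close>;
  \<open>\<sigma>\<close> is that index, or \<open>m\<close> if there is none before
  \<open>m\<close>.\<close>

lemma stopped_sum_telescope:
  "\<exists>\<sigma>\<le>m. (\<Sum>i<m. below R n i \<omega> * (g (Suc i) - g i)) = g \<sigma> - g 0 \<and>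
    ((\<forall>j<m. X (grid t n j) \<omega> \<le> R) \<longrightarrow> \<sigma> = m)"
proof (induction m)
  case (Suc m)
  then obtain \<sigma> where \<sigma>: "\<sigma> \<le> m" "(\<Sum>i<m. below R n i \<omega> * (g (Suc i) - g i)) = g \<sigma> - g 0"
    "(\<forall>j<m. X (grid t n j) \<omega> \<le> R) \<Longrightarrow> \<sigma> = m" by blast
  show ?case
  proof (cases "\<forall>j\<le>m. X (grid t n j) \<omega> \<le> R")
    case True
    then have "\<sigma> = m" "below R n m \<omega> = 1" using \<sigma>(3) by (auto simp: below_def)
    then show ?thesis using \<sigma>(2) by (intro exI[of _ "Suc m"]) simp
  next
    case False
    then have "below R n m \<omega> = 0" by (simp add: below_def)
    then show ?thesis using \<sigma> False by (intro exI[of _ \<sigma>]) (auto simp: less_Suc_eq_le)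
  qed
qed simp

section \<open>Bounds, and the limits in the mesh and in the level\<close>

definition density_bound :: real where "density_bound = exp (\<delta> * integral {0..t} a + a 0 * x)"

text \<open>Here \<open>a \<ge> 0\<close> and \<open>X \<ge> 0\<close> enter. The bound depends
  neither on a grid nor on \<open>R\<close>, so it survives both limits.\<close>

lemma bridge_exponent_le:
  assumes \<omega>: "\<omega> \<in> space M" and r: "r \<in> {0..t}"
  shows "bridge_exponent r \<omega> \<le> \<delta> * integral {0..t} a"
proof -
  have "0 \<le> integral {0..r} (\<lambda>u. X u \<omega>)"
    using r X_nonneg[OF \<omega>] by (intro Henstock_Kurzweil_Integration.integral_nonneg integrable_continuous_real
        continuous_on_subset[OF X_cont[OF \<omega>]]) auto
  moreover have "integral {0..r} a \<le> integral {0..t} a"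
    using r a_nonneg by (intro integral_subset_le integrable_continuous_real continuous_on_subset[OF a_cont]) auto
  ultimately have "0 \<le> a r * X r \<omega>" "0 \<le> \<gamma> * integral {0..r} (\<lambda>u. X u \<omega>)" "\<delta> * integral {0..r} a \<le> \<delta> * integral {0..t} a"
    using a_nonneg[OF r] X_nonneg[OF \<omega> r] \<gamma> \<delta> by (auto intro: mult_left_mono)
  then show ?thesis by (simp add: bridge_exponent_def)
qed

lemma exp_exponent_le:
  "AE \<omega> in M. bridge_exponent 0 \<omega> = - a 0 * x \<and> (\<forall>r\<in>{0..t}. exp (bridge_exponent r \<omega> - bridge_exponent 0 \<omega>) \<le> density_bound)"
  using X_start AE_space
proof eventually_elim
  fix \<omega> assume "X 0 \<omega> = x" and \<omega>: "\<omega> \<in> space M"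
  then have L0: "bridge_exponent 0 \<omega> = - a 0 * x" by (simp add: bridge_exponent_def)
  then show "bridge_exponent 0 \<omega> = - a 0 * x \<and> (\<forall>r\<in>{0..t}. exp (bridge_exponent r \<omega> - bridge_exponent 0 \<omega>) \<le> density_bound)"
    using bridge_exponent_le[OF \<omega>] by (auto simp: density_bound_def)
qed

lemma stopped_exponent_limit:
  "(\<lambda>n. expectation (\<lambda>\<omega>. exp (stopped_exponent R n \<omega>))) \<longlonglongrightarrow> 1"
proof -
  obtain Q where Q: "0 < Q" "\<And>n. (\<integral>\<^sup>+\<omega>. ennreal (exp (2 * euler_exponent R n \<omega>)) \<partial>M) \<le> ennreal Q"
    by (rule nn_integral_euler_exponent_square) (rule that)
  have bd: "AE \<omega> in M. exp (stopped_exponent R n \<omega>) \<le> density_bound" for n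
    using exp_exponent_le
  proof eventually_elim
    fix \<omega> assume *: "bridge_exponent 0 \<omega> = - a 0 * x \<and> (\<forall>r\<in>{0..t}. exp (bridge_exponent r \<omega> - bridge_exponent 0 \<omega>) \<le> density_bound)"
    obtain \<sigma> where "\<sigma> \<le> Suc n" "stopped_exponent R n \<omega> = bridge_exponent (grid t n \<sigma>) \<omega> - bridge_exponent (grid t n 0) \<omega>"
      using stopped_sum_telescope[of "Suc n" R n \<omega> "\<lambda>i. bridge_exponent (grid t n i) \<omega>"] unfolding stopped_exponent_def by blast
    then show "exp (stopped_exponent R n \<omega>) \<le> density_bound"
      using *[THEN conjunct2, rule_format, OF grid_in[OF t(1), of \<sigma> n]] by simp
  qed
  show ?thesis
    by (rule expectation_exp_limit[OF euler_exponent_measurable stopped_exponent_measurable exponents_small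
        nn_integral_euler_exponent Q(2) bd _ Q(1)]) (simp add: density_bound_def)
qed

text \<open>All grids are taken at once to make the event independent of the mesh. The last grid
  point is left out, just as the sums use \<open>below\<close> only up to index
  \<open>n\<close>.\<close>

definition exceed :: "nat \<Rightarrow> 'a set" where
  "exceed R = {\<omega> \<in> space M. \<exists>n. \<exists>i\<in>{..n}. real R < X (grid t n i) \<omega>}"

lemma exceed_sets: "exceed R \<in> sets M"
proof -
  have [measurable]: "X (grid t n i) \<in> borel_measurable M" if "i \<le> n" for n i
    using X_measurable[OF grid_bounds(5)[OF that]] .
  have "{\<omega> \<in> space M. \<exists>i\<in>{..n}. real R < X (grid t n i) \<omega>} \<in> sets M" for n
    by (rule sets.sets_Collect_finite_Ex) auto
  then show ?thesis unfolding exceed_def by (rule sets.sets_Collect_countable_Ex)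
qed

text \<open>A continuous path is bounded on the compact interval, so no path lies in all of these
  decreasing events.\<close>

lemma exceed_limit: "(\<lambda>R. prob (exceed R)) \<longlonglongrightarrow> 0"
proof -
  have "(\<Inter>R. exceed R) = {}"
  proof (rule equals0I)
    fix \<omega> assume *: "\<omega> \<in> (\<Inter>R. exceed R)"
    then have \<omega>: "\<omega> \<in> space M" by (auto simp: exceed_def)
    have "bounded ((\<lambda>r. X r \<omega>) ` {0..t})"
      using X_cont[OF \<omega>] by (intro compact_imp_bounded compact_continuous_image) auto
    then obtain K where "\<forall>y\<in>(\<lambda>r. X r \<omega>) ` {0..t}. norm y \<le> K" by (auto simp: bounded_iff)
    then have K: "X r \<omega> \<le> K" if "r \<in> {0..t}" for r using that by (auto simp: abs_le_iff)
    obtain R :: nat where R: "K \<le> real R" using real_arch_simple by blast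
    from * have "\<omega> \<in> exceed R" by auto
    then obtain n i where "i \<le> n" "real R < X (grid t n i) \<omega>" by (auto simp: exceed_def)
    with K[OF grid_bounds(5)[of i n]] R show False by simp
  qed
  moreover have "(\<lambda>R. prob (exceed R)) \<longlonglongrightarrow> prob (\<Inter>R. exceed R)"
  proof (rule finite_Lim_measure_decseq)
    show "range exceed \<subseteq> sets M" using exceed_sets by auto
    show "decseq exceed"
      unfolding decseq_def exceed_def by (fastforce elim: le_less_trans[rotated])
  qed
  ultimately show ?thesis by simp
qed

text \<open>Off \<open>exceed R\<close> the cut-off never acts and the stopped exponential is the
  true one; on it both are at most \<open>density_bound\<close>. This comparison is uniform in
  \<open>n\<close>, so the mesh can tend to 0 for fixed \<open>R\<close> before \<open>R\<close>
  tends to infinity.\<close>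

lemma expectation_exp_exponent: "expectation (\<lambda>\<omega>. exp (bridge_exponent t \<omega> - bridge_exponent 0 \<omega>)) = 1"
proof -
  have mt: "t \<in> {0..t}" "0 \<in> {0..t}" using t by auto
  note [measurable] = bridge_exponent_measurable[OF mt(1)] bridge_exponent_measurable[OF mt(2)] stopped_exponent_measurable exceed_sets
  have b0: "0 < density_bound" by (simp add: density_bound_def)
  have iL: "integrable M (\<lambda>\<omega>. exp (bridge_exponent t \<omega> - bridge_exponent 0 \<omega>))"
    by (rule integrable_const_bound[of _ density_bound]) (use exp_exponent_le mt in \<open>auto elim: eventually_mono\<close>)
  have le: "\<bar>expectation (\<lambda>\<omega>. exp (bridge_exponent t \<omega> - bridge_exponent 0 \<omega>)) - expectation (\<lambda>\<omega>. exp (stopped_exponent (real R) n \<omega>))\<bar>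
    \<le> density_bound * prob (exceed R)" for n R
  proof -
    have AE: "AE \<omega> in M. exp (stopped_exponent (real R) n \<omega>) \<le> density_bound \<and>
      \<bar>exp (bridge_exponent t \<omega> - bridge_exponent 0 \<omega>) - exp (stopped_exponent (real R) n \<omega>)\<bar> \<le> density_bound * indicator (exceed R) \<omega>"
      using exp_exponent_le AE_space
    proof eventually_elim
      fix \<omega> assume *: "bridge_exponent 0 \<omega> = - a 0 * x \<and> (\<forall>r\<in>{0..t}. exp (bridge_exponent r \<omega> - bridge_exponent 0 \<omega>) \<le> density_bound)" and \<omega>: "\<omega> \<in> space M"
      obtain \<sigma> where \<sigma>: "\<sigma> \<le> Suc n" "stopped_exponent (real R) n \<omega> = bridge_exponent (grid t n \<sigma>) \<omega> - bridge_exponent (grid t n 0) \<omega>"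
        "(\<forall>j<Suc n. X (grid t n j) \<omega> \<le> real R) \<Longrightarrow> \<sigma> = Suc n"
        using stopped_sum_telescope[of "Suc n" "real R" n \<omega> "\<lambda>i. bridge_exponent (grid t n i) \<omega>"] unfolding stopped_exponent_def by blast
      have 1: "exp (stopped_exponent (real R) n \<omega>) \<le> density_bound" "exp (bridge_exponent t \<omega> - bridge_exponent 0 \<omega>) \<le> density_bound"
        using * grid_in[OF t(1) \<sigma>(1)] \<sigma>(2) mt by auto
      have "\<bar>exp (bridge_exponent t \<omega> - bridge_exponent 0 \<omega>) - exp (stopped_exponent (real R) n \<omega>)\<bar> \<le> density_bound * indicator (exceed R) \<omega>"
      proof (cases "\<omega> \<in> exceed R")
        case True
        moreover have "\<bar>exp (bridge_exponent t \<omega> - bridge_exponent 0 \<omega>) - exp (stopped_exponent (real R) n \<omega>)\<bar> \<le> density_bound"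
          using 1 exp_gt_zero[of "bridge_exponent t \<omega> - bridge_exponent 0 \<omega>"] exp_gt_zero[of "stopped_exponent (real R) n \<omega>"] by linarith
        ultimately show ?thesis by simp
      next
        case False
        then have "\<sigma> = Suc n" using \<omega> by (intro \<sigma>(3)) (force simp: exceed_def not_less)
        then show ?thesis using \<sigma>(2) False by simp
      qed
      with 1 show "exp (stopped_exponent (real R) n \<omega>) \<le> density_bound \<and>
        \<bar>exp (bridge_exponent t \<omega> - bridge_exponent 0 \<omega>) - exp (stopped_exponent (real R) n \<omega>)\<bar> \<le> density_bound * indicator (exceed R) \<omega>" by simp
    qed
    have iS: "integrable M (\<lambda>\<omega>. exp (stopped_exponent (real R) n \<omega>))"
      by (rule integrable_const_bound[of _ density_bound]) (use AE in \<open>auto elim: eventually_mono\<close>)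
    have "\<bar>expectation (\<lambda>\<omega>. exp (bridge_exponent t \<omega> - bridge_exponent 0 \<omega>) - exp (stopped_exponent (real R) n \<omega>))\<bar>
      \<le> expectation (\<lambda>\<omega>. \<bar>exp (bridge_exponent t \<omega> - bridge_exponent 0 \<omega>) - exp (stopped_exponent (real R) n \<omega>)\<bar>)"
      by (rule integral_abs_bound)
    also have "\<dots> \<le> expectation (\<lambda>\<omega>. density_bound * indicator (exceed R) \<omega>)"
    proof (rule integral_mono_AE)
      show "integrable M (\<lambda>\<omega>. \<bar>exp (bridge_exponent t \<omega> - bridge_exponent 0 \<omega>) - exp (stopped_exponent (real R) n \<omega>)\<bar>)"
        using iL iS by auto
      show "integrable M (\<lambda>\<omega>. density_bound * indicator (exceed R) \<omega>)"
        by (rule integrable_const_bound[of _ density_bound]) (use b0 in \<open>auto simp: indicator_def\<close>)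
      show "AE \<omega> in M. \<bar>exp (bridge_exponent t \<omega> - bridge_exponent 0 \<omega>) - exp (stopped_exponent (real R) n \<omega>)\<bar> \<le> density_bound * indicator (exceed R) \<omega>"
        using AE by eventually_elim simp
    qed
    also have "\<dots> = density_bound * prob (exceed R)" by simp
    finally show ?thesis using iL iS by simp
  qed
  have "\<bar>expectation (\<lambda>\<omega>. exp (bridge_exponent t \<omega> - bridge_exponent 0 \<omega>)) - 1\<bar> \<le> density_bound * prob (exceed R)" for R
  proof (rule LIMSEQ_le_const2)
    show "(\<lambda>n. \<bar>expectation (\<lambda>\<omega>. exp (bridge_exponent t \<omega> - bridge_exponent 0 \<omega>)) - expectation (\<lambda>\<omega>. exp (stopped_exponent (real R) n \<omega>))\<bar>)
      \<longlonglongrightarrow> \<bar>expectation (\<lambda>\<omega>. exp (bridge_exponent t \<omega> - bridge_exponent 0 \<omega>)) - 1\<bar>"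
      by (intro tendsto_intros stopped_exponent_limit)
  qed (use le in auto)
  moreover have "(\<lambda>R. density_bound * prob (exceed R)) \<longlonglongrightarrow> density_bound * 0"
    by (intro tendsto_intros exceed_limit)
  ultimately have "\<bar>expectation (\<lambda>\<omega>. exp (bridge_exponent t \<omega> - bridge_exponent 0 \<omega>)) - 1\<bar> \<le> density_bound * 0"
    by (intro LIMSEQ_le_const[of _ "density_bound * 0"]) auto
  then show ?thesis by simp
qed

lemma laplace_transform:
  "expectation (\<lambda>\<omega>. exp (- a t * X t \<omega> - \<gamma> * (LBINT u:{0..t}. X u \<omega>)))
    = exp (- x * a 0 - \<delta> * integral {0..t} a)"
proof -
  have mt: "t \<in> {0..t}" "0 \<in> {0..t}" using t by auto
  note [measurable] = bridge_exponent_measurable[OF mt(1)] bridge_exponent_measurable[OF mt(2)]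
  have "expectation (\<lambda>\<omega>. exp (bridge_exponent t \<omega> - bridge_exponent 0 \<omega>))
    = expectation (\<lambda>\<omega>. exp (x * a 0 + \<delta> * integral {0..t} a) * exp (bridge_exponent t \<omega> - \<delta> * integral {0..t} a))"
  proof (rule integral_cong_AE)
    show "AE \<omega> in M. exp (bridge_exponent t \<omega> - bridge_exponent 0 \<omega>) = exp (x * a 0 + \<delta> * integral {0..t} a) * exp (bridge_exponent t \<omega> - \<delta> * integral {0..t} a)"
      using exp_exponent_le by eventually_elim (simp add: algebra_simps flip: exp_add)
  qed measurable
  also have "\<dots> = exp (x * a 0 + \<delta> * integral {0..t} a) * expectation (\<lambda>\<omega>. exp (bridge_exponent t \<omega> - \<delta> * integral {0..t} a))"
    by simp
  also have "expectation (\<lambda>\<omega>. exp (bridge_exponent t \<omega> - \<delta> * integral {0..t} a))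
    = expectation (\<lambda>\<omega>. exp (- a t * X t \<omega> - \<gamma> * (LBINT u:{0..t}. X u \<omega>)))"
    by (intro Bochner_Integration.integral_cong refl) (simp add: bridge_exponent_def LBINT_eq_integral[OF X_cont])
  finally have "exp (x * a 0 + \<delta> * integral {0..t} a)
    * expectation (\<lambda>\<omega>. exp (- a t * X t \<omega> - \<gamma> * (LBINT u:{0..t}. X u \<omega>))) = 1"
    unfolding expectation_exp_exponent by simp
  then have "expectation (\<lambda>\<omega>. exp (- a t * X t \<omega> - \<gamma> * (LBINT u:{0..t}. X u \<omega>)))
    = inverse (exp (x * a 0 + \<delta> * integral {0..t} a))"
    by (simp add: field_simps)
  also have "\<dots> = exp (- x * a 0 - \<delta> * integral {0..t} a)" by (simp flip: exp_minus)
  finally show ?thesis .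
qed

end

section \<open>Application to the bridge, including the endpoint t = 1\<close>

lemma bridge_laplace_lt:
  fixes M :: "'a measure" and F :: "real \<Rightarrow> 'a measure" and B X :: "real \<Rightarrow> 'a \<Rightarrow> real"
    and x \<delta> l \<gamma> t :: real
  assumes BM: "standard_brownian_motion M F B" and "\<delta> \<ge> 0"
    and X: "squared_bessel_bridge M F B x \<delta> X"
    and "l \<ge> 0" and "\<gamma> > 0" and t: "0 \<le> t" "t < 1"
  shows "prob_space.expectation M (\<lambda>\<omega>. exp (- l * X t \<omega> - \<gamma> * (LBINT u:{0..t}. X u \<omega>)))
    = exp (- x * riccati_sol (sqrt (2 * \<gamma>)) l t 0 - \<delta> * (ln (riccati_den (sqrt (2 * \<gamma>)) l (1 - t) t) / 2))"
proof -
  define c where "c = sqrt (2 * \<gamma>)"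
  have c: "0 < c" "c\<^sup>2 / 2 = \<gamma>" using \<open>\<gamma> > 0\<close> by (auto simp: c_def)
  define a where "a = riccati_sol c l t"
  obtain I where I: "\<And>r. r \<in> {0..<1} \<Longrightarrow> has_ito_integral M F B (\<lambda>s \<omega>. sqrt (X s \<omega>)) r (I r)"
    "\<And>r. r \<in> {0..<1} \<Longrightarrow> AE \<omega> in M. X r \<omega> = x + 2 * I r \<omega> + (LBINT s:{0..r}. \<delta> - 2 * X s \<omega> / (1 - s))"
    using X unfolding squared_bessel_bridge_def by blast
  interpret standard_brownian_motion M F B by fact
  interpret riccati_bridge M F B X I a x \<delta> \<gamma> t
  proof
    show "X r \<in> borel_measurable (F r)" if "r \<in> {0..t}" for r
      using X that t unfolding squared_bessel_bridge_def by auto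
    show "continuous_on {0..t} (\<lambda>r. X r \<omega>)" if "\<omega> \<in> space M" for \<omega>
    proof (rule continuous_on_subset)
      show "continuous_on {0..1} (\<lambda>r. X r \<omega>)"
        using X that unfolding squared_bessel_bridge_def by blast
    qed (use t in auto)
    show "0 \<le> X r \<omega>" if "\<omega> \<in> space M" "r \<in> {0..t}" for r \<omega>
      using X that t unfolding squared_bessel_bridge_def by auto
    show "(a has_real_derivative 2 * (a u)\<^sup>2 + 2 * a u / (1 - u) - \<gamma>) (at u)" if "u \<in> {0..t}" for u
      unfolding a_def c(2)[symmetric] by (rule DERIV_riccati_sol) (use c that t assms in auto)
    show "0 \<le> a u" if "u \<in> {0..t}" for u
      unfolding a_def by (rule riccati_sol_nonneg) (use c that t assms in auto)
  qed (use I t assms in auto)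
  have "integral {0..t} a = ln (riccati_den c l (1 - t) t) / 2"
  proof (cases "t = 0")
    case False
    have "integral {0..t} a = (LBINT u=0..t. a u)"
      unfolding LBINT_eq_integral[OF a_cont, symmetric] zero_ereal_def
      by (rule interval_integral_Icc[symmetric]) (use t in simp)
    then show ?thesis unfolding a_def using riccati_integral(2)[of c l t] c t assms False by simp
  qed (simp add: riccati_den_def)
  moreover have "a t = l" unfolding a_def by (rule riccati_sol_end) (use t in simp)
  ultimately show ?thesis using laplace_transform unfolding c_def[symmetric] a_def[symmetric] by simp
qed

theorem proposition3p18:
  fixes M :: "'a measure" and F :: "real \<Rightarrow> 'a measure" and B X :: "real \<Rightarrow> 'a \<Rightarrow> real"
    and x \<delta> l \<gamma> t :: real
  assumes "standard_brownian_motion M F B"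
    and "x \<ge> 0" and "\<delta> \<ge> 0"
    and "squared_bessel_bridge M F B x \<delta> X"
    and "l \<ge> 0" and "\<gamma> > 0" and "t \<in> {0..1}"
  shows "prob_space.expectation M
           (\<lambda>\<omega>. exp (- l * X t \<omega> - \<gamma> * (LBINT u:{0..t}. X u \<omega>)))
         = exp (- x * bridge_phi \<gamma> t l - bridge_psi \<gamma> \<delta> t l)"
proof -
  interpret standard_brownian_motion M F B by fact
  define c where "c = sqrt (2 * \<gamma>)"
  have c: "0 < c" using \<open>\<gamma> > 0\<close> by (simp add: c_def)
  define E where "E t = expectation (\<lambda>\<omega>. exp (- l * X t \<omega> - \<gamma> * (LBINT u:{0..t}. X u \<omega>)))" for t
  define rhs where "rhs t = exp (- x * riccati_sol c l t 0 - \<delta> * (ln (riccati_den c l (1 - t) t) / 2))" for t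
  have lt: "E t = rhs t" if "0 \<le> t" "t < 1" for t
    unfolding E_def rhs_def c_def by (rule bridge_laplace_lt) (use assms that in auto)
  have "E t = rhs t"
  proof (cases "t < 1")
    case True
    then show ?thesis using assms lt by simp
  next
    case False
    with assms have t: "t = 1" by simp
    define s where "s n = 1 - inverse (real (Suc n))" for n
    have s: "s n \<in> {0..1}" "s n < 1" for n by (auto simp: s_def field_simps)
    have s_lim: "s \<longlonglongrightarrow> 1"
      unfolding s_def using tendsto_diff[OF tendsto_const LIMSEQ_inverse_real_of_nat, of 1] by simp
    have Xc: "continuous_on {0..1} (\<lambda>t. X t \<omega>)" and X0: "\<And>t. t \<in> {0..1} \<Longrightarrow> 0 \<le> X t \<omega>" if "\<omega> \<in> space M" for \<omega>
      using assms(4) that unfolding squared_bessel_bridge_def by auto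
    have X_int: "(LBINT u:{0..r}. X u \<omega>) = integral {0..r} (\<lambda>u. X u \<omega>)" if "\<omega> \<in> space M" "r \<in> {0..1}" for \<omega> r
      using that by (intro LBINT_eq_integral continuous_on_subset[OF Xc]) auto
    have "(\<lambda>n. E (s n)) \<longlonglongrightarrow> E 1"
      unfolding E_def
    proof (rule integral_dominated_convergence[where w = "\<lambda>_. 1"])
      have lim: "(\<lambda>n. exp (- l * X (s n) \<omega> - \<gamma> * (LBINT u:{0..s n}. X u \<omega>)))
        \<longlonglongrightarrow> exp (- l * X 1 \<omega> - \<gamma> * (LBINT u:{0..1}. X u \<omega>))" if \<omega>: "\<omega> \<in> space M" for \<omega>
      proof -
        have "(\<lambda>n. X (s n) \<omega>) \<longlonglongrightarrow> X 1 \<omega>"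
          by (rule continuous_on_tendsto_compose[OF Xc[OF \<omega>] s_lim]) (use s in auto)
        moreover have "continuous_on {0..1} (\<lambda>r. integral {0..r} (\<lambda>u. X u \<omega>))"
          by (intro indefinite_integral_continuous_1 integrable_continuous_real Xc \<omega>)
        then have "(\<lambda>n. integral {0..s n} (\<lambda>u. X u \<omega>)) \<longlonglongrightarrow> integral {0..1} (\<lambda>u. X u \<omega>)"
          by (rule continuous_on_tendsto_compose[OF _ s_lim]) (use s in auto)
        ultimately show ?thesis
          using X_int[OF \<omega>] s by (auto intro!: tendsto_intros)
      qed
      then show "AE \<omega> in M. (\<lambda>n. exp (- l * X (s n) \<omega> - \<gamma> * (LBINT u:{0..s n}. X u \<omega>)))
        \<longlonglongrightarrow> exp (- l * X 1 \<omega> - \<gamma> * (LBINT u:{0..1}. X u \<omega>))" by (rule AE_I2)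
      show "AE \<omega> in M. norm (exp (- l * X (s n) \<omega> - \<gamma> * (LBINT u:{0..s n}. X u \<omega>))) \<le> 1" for n
      proof (rule AE_I2)
        fix \<omega> assume \<omega>: "\<omega> \<in> space M"
        have "0 \<le> integral {0..s n} (\<lambda>u. X u \<omega>)"
          using s[of n] by (intro Henstock_Kurzweil_Integration.integral_nonneg integrable_continuous_real
              continuous_on_subset[OF Xc[OF \<omega>]] X0[OF \<omega>]) auto
        then have "0 \<le> \<gamma> * integral {0..s n} (\<lambda>u. X u \<omega>)" "0 \<le> l * X (s n) \<omega>"
          using X0[OF \<omega> s(1)] assms by auto
        then show "norm (exp (- l * X (s n) \<omega> - \<gamma> * (LBINT u:{0..s n}. X u \<omega>))) \<le> 1"
          unfolding X_int[OF \<omega> s(1)] by simp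
      qed
      show m: "(\<lambda>\<omega>. exp (- l * X (s n) \<omega> - \<gamma> * (LBINT u:{0..s n}. X u \<omega>))) \<in> borel_measurable M" for n
      proof -
        \<comment> \<open>Measurability is read off from the value: the Bochner integral of a
          non-integrable function is 0, whereas \<open>E (s n)\<close> equals an
          exponential.\<close>
        have "E (s n) \<noteq> 0" using lt[of "s n"] s[of n] by (simp add: rhs_def)
        then show ?thesis
          unfolding E_def using not_integrable_integral_eq borel_measurable_integrable by blast
      qed
      show "(\<lambda>\<omega>. exp (- l * X 1 \<omega> - \<gamma> * (LBINT u:{0..1}. X u \<omega>))) \<in> borel_measurable M"
        by (rule borel_measurable_LIMSEQ_real[OF lim m])
    qed simp
    moreover have "(\<lambda>n. rhs (s n)) \<longlonglongrightarrow> rhs 1"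
    proof -
      \<comment> \<open>This value occurs at \<open>t = 1\<close> both as a denominator and inside
        the logarithm; its positivity makes the right-hand side continuous there.\<close>
      have "0 < riccati_den c l 0 1" by (rule riccati_den_pos) (use c assms in auto)
      then show ?thesis
        unfolding rhs_def riccati_sol_def riccati_den_def riccati_num_def
        by (intro tendsto_intros s_lim) (use c in auto)
    qed
    moreover have "(\<lambda>n. E (s n)) = (\<lambda>n. rhs (s n))" using lt s by auto
    ultimately show ?thesis using t LIMSEQ_unique by metis
  qed
  then show ?thesis
    using assms by (simp add: E_def rhs_def bridge_phi_eq bridge_psi_eq c_def)
qed

end
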